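(* Let $(X,\mathscr B,\mu,T)$ be a pointwise dual ergodic conservative ergodic measure preserving transformation whose normalizing sequence $(a_n)_{n\ge1}$ is regularly varying of index $\alpha$ for some $0<\alpha\le1$. Let $Y\in\mathscr B$ be a uniform set with $\mu(Y)<+\infty$, and let $(B_n)_{n\ge1}$ be a sequence of asymptotically rare events with $B_n\subset Y$ for all $n\ge1$. Let $\nu$ be the law of a nonnegative (finite) random variable $W$, and assume: (i) there exist measurable functions $\tau_n:B_n\to\mathbb N$ and a compact subset $\mathcal U$ of $L^1(\mu)$ such that for all $n\ge1$ and all $k\ge0$ with $\mu(B_n\cap\{\tau_n=k\})>0$, $$\widehat T^k\left(\frac{\mathbf 1_{B_n\cap\{\tau_n=k\}}}{\mu(B_n\cap\{\tau_n=k\})}\right)\in\mathcal U;$$ (ii) $\gamma(\mu(B_n))\,\tau_n$ converges in law to $W$ under $\mu_{B_n}$ as $n\to+\infty$; (iii) $\mu_{B_n}(r_{B_n}\le\tau_n)\to0$ as $n\to+\infty$. Then, as $n\to+\infty$, $N_{B_n}^\gamma$ converges in law to $\mathrm{DRPP}(J_\alpha(\nu),\widetilde J_\alpha(\nu))$ under every probability measure absolutely continuous with respect to $\mu$, and to $\mathrm{RPP}(\widetilde J_\alpha(\nu))$ under $\mu_{B_n}$.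
   Context: $(X,\mathscr B,\mu)$ is a measure space with $\mu$ finite or $\sigma$-finite, and $T:X\to X$ preserves $\mu$. The transfer operator $\widehat T:L^1(\mu)\to L^1(\mu)$ is defined by $\int f\cdot(g\circ T)\,d\mu=\int(\widehat Tf)\,g\,d\mu$ for $f\in L^1(\mu)$, $g\in L^\infty(\mu)$. The system is a conservative ergodic measure preserving transformation (CEMPT) if $\sum_{k\ge0}\widehat T^ku=+\infty$ $\mu$-a.e. for all $u\in L^1(\mu)$ with $u\ge0$, $\int u\,d\mu>0$. It is pointwise dual ergodic (PDE) with normalizing sequence $(a_n)$ if $\frac1{a_n}\sum_{k=0}^{n-1}\widehat T^kf\to\int f\,d\mu$ $\mu$-a.e. for all $f\in L^1(\mu)$. For $0<\mu(B)<\infty$, $\mu_B=\mu(\cdot\cap B)/\mu(B)$. A set $Y\in\mathscr B$ with $\mu(Y)>0$ is uniform if there are $f\in L^1(\mu)$, $f\ge0$, $\int f\,d\mu>0$, and a sequence $(a_n)$ with $\big\|\frac1{a_n}\sum_{k=0}^{n-1}\widehat T^kf-\int f\,d\mu\big\|_{L^\infty(\mu_Y)}\to0$. A sequence $(B_n)$ in $\mathscr B$ is a sequence of asymptotically rare events if $\mu(B_n)>0$ for all $n$ and $\mu(B_n)\to0$. A sequence $(a_n)$ is regularly varying of index $\alpha$ if $a(\lambda s)/a(s)\to\lambda^\alpha$ as $s\to\infty$ for all $\lambda>0$, where $a(s)=a_{\lfloor s\rfloor}$. With $a^{\leftarrow}(y)=\inf\{s\ge0:a(s)>y\}$, put $\gamma(s)=1/a^{\leftarrow}(1/s)$.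 $r_B=r_B^{(1)}(x)=\inf\{n\ge1:T^nx\in B\}$, $r_B^{(k+1)}(x)=\inf\{n>r_B^{(k)}(x):T^nx\in B\}$, and $N_B^\gamma=\sum_{k\ge1}\delta_{\gamma(\mu(B))\,r_B^{(k)}}$. Point processes on $\mathbb R_+=[0,\infty)$ are random boundedly finite counting measures; convergence in law is for the weak$^*$ (vague) topology. $\mathrm{RPP}(W)=\sum_{i\ge1}\delta_{W_1+\dots+W_i}$, $(W_i)$ i.i.d. copies of $W\ge0$. $\mathrm{DRPP}(U,W)=\sum_{i\ge1}\delta_{T_i}$ with $T_1=U$ and $T_{i+1}-T_i=W_{i+1}$ for $i\ge1$, $(W_i)_{i\ge2}$ i.i.d. copies of $W$ independent of $U$. For $W\sim\nu$, $J_\alpha(\nu)$ and $\widetilde J_\alpha(\nu)$ are the nonnegative random variables with Laplace transforms, for $s\ge0$, $$\mathbb E[e^{-sJ_\alpha(\nu)}]=\Big(\mathbb E[e^{-sW}]+\tfrac{s^\alpha}{\Gamma(1+\alpha)}\Big)^{-1},\qquad \mathbb E[e^{-s\widetilde J_\alpha(\nu)}]=\frac{\mathbb E[e^{-sW}]}{\mathbb E[e^{-sW}]+s^\alpha/\Gamma(1+\alpha)}$$ (under the hypotheses of the claim these are indeed Laplace transforms of probability laws). *)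

theory Defs
  imports "HOL-Probability.Probability"
begin

section \<open>Measure preserving systems and the transfer operator\<close>

definition measure_preserving_map :: "'a measure \<Rightarrow> ('a \<Rightarrow> 'a) \<Rightarrow> bool" where
  "measure_preserving_map M T \<longleftrightarrow> T \<in> measurable M M \<and> distr M M T = M"

text \<open>
  Functions \<open>g\<close> representing elements of \<open>L\<^sup>\<infinity>\<close> are the measurable functions that are bounded
  almost everywhere.
\<close>

definition is_transfer ::
  "'a measure \<Rightarrow> ('a \<Rightarrow> 'a) \<Rightarrow> ('a \<Rightarrow> real) \<Rightarrow> ('a \<Rightarrow> real) \<Rightarrow> bool" where
  "is_transfer M T f h \<longleftrightarrow> integrable M h \<and>
     (\<forall>g\<in>borel_measurable M. (\<exists>C. AE x in M. \<bar>g x\<bar> \<le> C) \<longrightarrow>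
        (\<integral>x. f x * g (T x) \<partial>M) = (\<integral>x. h x * g x \<partial>M))"

text \<open>
  The transfer operator is determined only up to null sets, so on functions it is a choice of
  representative; every notion below depends only on the almost everywhere class.
\<close>

definition transfer_op :: "'a measure \<Rightarrow> ('a \<Rightarrow> 'a) \<Rightarrow> ('a \<Rightarrow> real) \<Rightarrow> 'a \<Rightarrow> real" where
  "transfer_op M T f = (SOME h. is_transfer M T f h)"

definition cempt :: "'a measure \<Rightarrow> ('a \<Rightarrow> 'a) \<Rightarrow> bool" where
  "cempt M T \<longleftrightarrow> measure_preserving_map M T \<and>
     (\<forall>u. integrable M u \<and> (AE x in M. 0 \<le> u x) \<and> 0 < (\<integral>x. u x \<partial>M) \<longrightarrow>
        (AE x in M. filterlim (\<lambda>n. \<Sum>k<n. (transfer_op M T ^^ k) u x) at_top sequentially))"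

definition pointwise_dual_ergodic ::
  "'a measure \<Rightarrow> ('a \<Rightarrow> 'a) \<Rightarrow> (nat \<Rightarrow> real) \<Rightarrow> bool" where
  "pointwise_dual_ergodic M T a \<longleftrightarrow>
     (\<forall>f. integrable M f \<longrightarrow>
        (AE x in M. (\<lambda>n. 1 / a n * (\<Sum>k<n. (transfer_op M T ^^ k) f x))
           \<longlonglongrightarrow> (\<integral>y. f y \<partial>M)))"

text \<open>
  The conditional measure \<open>\<mu>\<^sub>B\<close> is \<^term>\<open>uniform_measure M B\<close>, which is meaningful for
  \<open>0 < \<mu>(B) < \<infinity>\<close>; this is why finiteness of \<open>\<mu>(Y)\<close> is part of the next definition.
  The sequence \<open>b\<close> is not required to be the normalizing sequence of the system.
\<close>

definition uniform_set :: "'a measure \<Rightarrow> ('a \<Rightarrow> 'a) \<Rightarrow> 'a set \<Rightarrow> bool" where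
  "uniform_set M T Y \<longleftrightarrow> Y \<in> sets M \<and> 0 < emeasure M Y \<and> emeasure M Y < \<infinity> \<and>
     (\<exists>f b. integrable M f \<and> (AE x in M. 0 \<le> f x) \<and> 0 < (\<integral>x. f x \<partial>M) \<and>
        (\<lambda>n. esssup (uniform_measure M Y)
               (\<lambda>x. ereal \<bar>1 / b n * (\<Sum>k<n. (transfer_op M T ^^ k) f x) - (\<integral>y. f y \<partial>M)\<bar>))
          \<longlonglongrightarrow> 0)"

definition asymptotically_rare :: "'a measure \<Rightarrow> (nat \<Rightarrow> 'a set) \<Rightarrow> bool" where
  "asymptotically_rare M B \<longleftrightarrow>
     (\<forall>n. B n \<in> sets M \<and> 0 < emeasure M (B n)) \<and> (\<lambda>n. emeasure M (B n)) \<longlonglongrightarrow> 0"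


section \<open>The metric space of integrable functions modulo null sets\<close>

definition L1_class :: "'a measure \<Rightarrow> ('a \<Rightarrow> real) \<Rightarrow> ('a \<Rightarrow> real) set" where
  "L1_class M f = {g. integrable M g \<and> (AE x in M. g x = f x)}"

definition L1_space :: "'a measure \<Rightarrow> ('a \<Rightarrow> real) set set" where
  "L1_space M = L1_class M ` {f. integrable M f}"

definition L1_dist :: "'a measure \<Rightarrow> ('a \<Rightarrow> real) set \<Rightarrow> ('a \<Rightarrow> real) set \<Rightarrow> real" where
  "L1_dist M F G = (\<integral>x. \<bar>(SOME f. f \<in> F) x - (SOME g. g \<in> G) x\<bar> \<partial>M)"

lemma L1_space_some:
  assumes "F \<in> L1_space M"
  shows "integrable M (SOME f. f \<in> F)" "F = L1_class M (SOME f. f \<in> F)"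
proof -
  obtain f where f: "integrable M f" "F = L1_class M f"
    using assms by (auto simp: L1_space_def)
  have "f \<in> F" using f by (auto simp: L1_class_def)
  then have s: "(SOME f. f \<in> F) \<in> F" by (rule someI[of "\<lambda>f. f \<in> F"])
  show "integrable M (SOME f. f \<in> F)" using s f by (auto simp: L1_class_def)
  have "AE x in M. (SOME f. f \<in> F) x = f x" using s f by (auto simp: L1_class_def)
  then have "L1_class M f = L1_class M (SOME f. f \<in> F)"
    by (auto simp: L1_class_def elim: eventually_elim2)
  then show "F = L1_class M (SOME f. f \<in> F)" using f by simp
qed

lemma Metric_space_L1: "Metric_space (L1_space M) (L1_dist M)"
proof
  fix F G show "0 \<le> L1_dist M F G" by (simp add: L1_dist_def)
  show "L1_dist M F G = L1_dist M G F" by (simp add: L1_dist_def abs_minus_commute)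
next
  fix F G assume F: "F \<in> L1_space M" and G: "G \<in> L1_space M"
  let ?f = "SOME f. f \<in> F" and ?g = "SOME g. g \<in> G"
  note f = L1_space_some[OF F] and g = L1_space_some[OF G]
  have "L1_dist M F G = 0 \<longleftrightarrow> (AE x in M. \<bar>?f x - ?g x\<bar> = 0)"
    unfolding L1_dist_def using f(1) g(1)
    by (intro integral_nonneg_eq_0_iff_AE) auto
  also have "\<dots> \<longleftrightarrow> (AE x in M. ?f x = ?g x)" by simp
  also have "\<dots> \<longleftrightarrow> F = G"
  proof
    assume "AE x in M. ?f x = ?g x"
    then have "L1_class M ?f = L1_class M ?g"
      by (auto simp: L1_class_def elim: eventually_elim2)
    then show "F = G" using f(2) g(2) by simp
  qed simp
  finally show "L1_dist M F G = 0 \<longleftrightarrow> F = G" .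
next
  fix F G H assume F: "F \<in> L1_space M" and G: "G \<in> L1_space M" and H: "H \<in> L1_space M"
  note i = L1_space_some(1)[OF F] L1_space_some(1)[OF G] L1_space_some(1)[OF H]
  have "L1_dist M F H \<le> (\<integral>x. \<bar>(SOME f. f \<in> F) x - (SOME g. g \<in> G) x\<bar>
      + \<bar>(SOME g. g \<in> G) x - (SOME h. h \<in> H) x\<bar> \<partial>M)"
    unfolding L1_dist_def using i
    by (intro integral_mono Bochner_Integration.integrable_add integrable_abs
          Bochner_Integration.integrable_diff) auto
  also have "\<dots> = L1_dist M F G + L1_dist M G H"
    unfolding L1_dist_def using i
    by (intro Bochner_Integration.integral_add integrable_abs
          Bochner_Integration.integrable_diff) auto
  finally show "L1_dist M F H \<le> L1_dist M F G + L1_dist M G H" .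
qed

definition compact_in_L1 :: "'a measure \<Rightarrow> ('a \<Rightarrow> real) set set \<Rightarrow> bool" where
  "compact_in_L1 M U \<longleftrightarrow> compactin (Metric_space.mtopology (L1_space M) (L1_dist M)) U"


section \<open>Regular variation and scaling\<close>

definition step_ext :: "(nat \<Rightarrow> real) \<Rightarrow> real \<Rightarrow> real" where
  "step_ext a s = a (nat \<lfloor>s\<rfloor>)"

definition regularly_varying :: "(nat \<Rightarrow> real) \<Rightarrow> real \<Rightarrow> bool" where
  "regularly_varying a \<alpha> \<longleftrightarrow>
     (\<forall>l>0. ((\<lambda>s. step_ext a (l * s) / step_ext a s) \<longlongrightarrow> l powr \<alpha>) at_top)"

definition left_inverse :: "(nat \<Rightarrow> real) \<Rightarrow> real \<Rightarrow> real" where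
  "left_inverse a y = Inf {s. 0 \<le> s \<and> step_ext a s > y}"

definition scaling :: "(nat \<Rightarrow> real) \<Rightarrow> real \<Rightarrow> real" where
  "scaling a s = 1 / left_inverse a (1 / s)"


section \<open>Point processes on the nonnegative half-line\<close>

abbreviation nonneg_borel :: "real measure" where
  "nonneg_borel \<equiv> restrict_space borel {0..}"

definition point_configs :: "real measure set" where
  "point_configs = {N. sets N = sets nonneg_borel \<and>
     (\<forall>A\<in>sets nonneg_borel. emeasure N A \<in> range ennreal_of_enat) \<and>
     (\<forall>A\<in>sets nonneg_borel. bounded A \<longrightarrow> emeasure N A < \<infinity>)}"

definition vague_test :: "(real \<Rightarrow> real) set" where
  "vague_test = {f. continuous_on {0..} f \<and> (\<exists>b. \<forall>x>b. f x = 0)}"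

definition vague_topology :: "real measure topology" where
  "vague_topology = topology_generated_by
     {{N \<in> point_configs. (\<integral>x. f x \<partial>N) \<in> V} | f V. f \<in> vague_test \<and> open V}"

lemma topspace_vague_topology: "topspace vague_topology = point_configs"
proof -
  have "point_configs \<in> {{N \<in> point_configs. (\<integral>x. f x \<partial>N) \<in> V} | f V. f \<in> vague_test \<and> open V}"
    by (intro CollectI exI[of _ "\<lambda>_. 0::real"] exI[of _ "UNIV :: real set"])
       (auto simp: vague_test_def)
  then show ?thesis
    unfolding vague_topology_def topology_generated_by_topspace by blast
qed

definition vague_borel :: "real measure measure" where
  "vague_borel = sigma point_configs {U. openin vague_topology U}"

text \<open>Weak convergence of probability laws on the Borel sets of a topological space.\<close>

definition laws_converge :: "'b topology \<Rightarrow> (nat \<Rightarrow> 'b measure) \<Rightarrow> 'b measure \<Rightarrow> bool" where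
  "laws_converge X L L' \<longleftrightarrow>
     (\<forall>\<phi>. continuous_map X euclideanreal \<phi> \<and> bounded (\<phi> ` topspace X) \<longrightarrow>
        (\<lambda>n. \<integral>x. \<phi> x \<partial>(L n)) \<longlonglongrightarrow> (\<integral>x. \<phi> x \<partial>L'))"

text \<open>The measure \<open>\<Sum>i\<in>I. \<delta>\<^bsub>t i\<^esub>\<close> on the half-line, counted with multiplicities.\<close>

definition dirac_sum :: "'i set \<Rightarrow> ('i \<Rightarrow> real) \<Rightarrow> real measure" where
  "dirac_sum I t = distr (count_space I) nonneg_borel t"

text \<open>
  For renewal processes the sum of Dirac masses is boundedly finite only almost surely; on the
  exceptional null set it is replaced by the empty configuration so as to have a random element of
  \<^const>\<open>point_configs\<close>.
\<close>

definition config :: "(nat \<Rightarrow> real) \<Rightarrow> real measure" where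
  "config t = (if dirac_sum UNIV t \<in> point_configs then dirac_sum UNIV t
               else null_measure nonneg_borel)"

text \<open>
  Laws of the renewal processes, for \<open>U\<close> and \<open>W\<close> given by their laws \<open>\<sigma>\<close> and \<open>\<rho>\<close>. Indices start
  at 0, so the \<open>i\<close>-th point is \<open>W 0 + \<dots> + W i\<close> for \<open>RPP\<close> and
  \<open>U + W 0 + \<dots> + W (i - 1)\<close> for \<open>DRPP\<close>.
\<close>

definition RPP_law :: "real measure \<Rightarrow> real measure measure" where
  "RPP_law \<rho> = distr (\<Pi>\<^sub>M i\<in>(UNIV :: nat set). \<rho>) vague_borel (\<lambda>w. config (\<lambda>i. \<Sum>j\<le>i. w j))"

definition DRPP_law :: "real measure \<Rightarrow> real measure \<Rightarrow> real measure measure" where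
  "DRPP_law \<sigma> \<rho> = distr (\<sigma> \<Otimes>\<^sub>M (\<Pi>\<^sub>M i\<in>(UNIV :: nat set). \<rho>)) vague_borel
     (\<lambda>(u, w). config (\<lambda>i. u + (\<Sum>j<i. w j)))"


section \<open>Hitting times\<close>

text \<open>
  The infimum of the empty set is \<open>\<infinity>\<close>. Starting the recursion with \<open>0\<close> makes index \<open>1\<close> the first
  hitting time \<open>inf {n \<ge> 1. T\<^sup>n x \<in> B}\<close>.
\<close>

primrec hit_time :: "('a \<Rightarrow> 'a) \<Rightarrow> 'a set \<Rightarrow> nat \<Rightarrow> 'a \<Rightarrow> enat" where
  "hit_time T B 0 x = 0"
| "hit_time T B (Suc k) x = Inf {enat n | n. hit_time T B k x < enat n \<and> (T ^^ n) x \<in> B}"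

text \<open>Infinite hitting times give no point of the half-line and are left out of the sum.\<close>

definition hit_process ::
  "'a measure \<Rightarrow> ('a \<Rightarrow> 'a) \<Rightarrow> (nat \<Rightarrow> real) \<Rightarrow> 'a set \<Rightarrow> 'a \<Rightarrow> real measure" where
  "hit_process M T a B x =
     dirac_sum {k. 1 \<le> k \<and> hit_time T B k x \<noteq> \<infinity>}
       (\<lambda>k. scaling a (measure M B) * real (the_enat (hit_time T B k x)))"


section \<open>The limit laws\<close>

definition nonneg_law :: "real measure \<Rightarrow> bool" where
  "nonneg_law \<nu> \<longleftrightarrow> real_distribution \<nu> \<and> (AE w in \<nu>. 0 \<le> w)"

definition laplace :: "real measure \<Rightarrow> real \<Rightarrow> real" where
  "laplace \<nu> s = (\<integral>w. exp (- s * w) \<partial>\<nu>)"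

text \<open>
  A law on the half-line is determined by its Laplace transform, so the choice below is unique
  whenever such a law exists.
\<close>

definition law_of_laplace :: "(real \<Rightarrow> real) \<Rightarrow> real measure" where
  "law_of_laplace L = (SOME \<rho>. nonneg_law \<rho> \<and> (\<forall>s\<ge>0. laplace \<rho> s = L s))"

definition J_law :: "real \<Rightarrow> real measure \<Rightarrow> real measure" where
  "J_law \<alpha> \<nu> = law_of_laplace (\<lambda>s. 1 / (laplace \<nu> s + s powr \<alpha> / Gamma (1 + \<alpha>)))"

definition J_tilde_law :: "real \<Rightarrow> real measure \<Rightarrow> real measure" where
  "J_tilde_law \<alpha> \<nu> =
     law_of_laplace (\<lambda>s. laplace \<nu> s / (laplace \<nu> s + s powr \<alpha> / Gamma (1 + \<alpha>)))"

end

(*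
  A configuration with points t_0 <= t_1 <= ... is coded by the decreasing sequence z_k = exp (- t_k)
  in the compact cube [0,1]^N. Decoding is continuous for the vague topology on the decreasing null
  sequences, so by Stone-Weierstrass and an infimal convolution argument convergence in law follows
  from convergence of the moments E [prod z_k^(e_k)], that is, of the expectations of
  Q = exp (- s_1 g r_1) exp (- s_2 g (r_2 - r_1)) ..., where g is the scaling factor and all s_i > 0.

  Let H be Q with its first factor dropped, evaluated from the first visit to B on. Telescoping over
  the visits to B gives int f Q = sum_{k >= 1} exp (- k s_1 g) int_B (H - Q) That^k f for the transfer
  operator That, and uniformity of Y with Karamata's Abelian theorem turn the right-hand side into
  Gamma (1 + alpha) s_1^(-alpha) (E_B H - E_B Q) asymptotically, for int f = 1. On the other hand Q
  is asymptotically T-invariant, so its expectation is asymptotically the same under all densities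
  in a compact set: by Chacon and Ornstein's filling scheme, functions of integral 0 are limits in
  L^1 of coboundaries. Hence (i)-(iii) give E_B Q ~ E [exp (- s_1 W)] int f Q. Solving the two linear
  relations, an induction on the number of factors yields the product form of the limits, and
  Helly's theorem the existence of the two limit laws.
*)
theory Submission
  imports Defs
begin

section \<open>The transfer operator and the filling scheme\<close>

text \<open>The Abel mean of the normalizing sequence at parameter s g is of order 1 / measure B.
  The sums of That^k f, integrated over B, must therefore be known up to an error proportional to
  measure B. This is what uniformity of Y provides, through an estimate whose constants depend on
  neither B nor n. The passage from partial sums to Abel means rests on a dominating function, which
  comes from monotonicity. The given a may oscillate, and the sequence attached to the uniform set
  is not tied to a. Both are replaced by c_n = (sum_{k<n} That^k f (x0)) / int f at one generic
  point x0 of Y: this is increasing, equivalent to a, and describes the sums at almost every point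
  of Y. The vague topology poses two difficulties. Decoding makes sense only on null sequences,
  which do not form a closed subset of the cube, so continuous functions there are approximated by
  Lipschitz minorants defined on the whole product. And its Borel sets have to be reached without a
  countable base, which is done by giving every configuration an explicit ordered code.\<close>

lemma integrable_mult_AE_bounded:
  fixes f g :: "'a \<Rightarrow> real"
  assumes "integrable M f" "g \<in> borel_measurable M" "AE x in M. \<bar>g x\<bar> \<le> C"
  shows "integrable M (\<lambda>x. f x * g x)"
proof (rule Bochner_Integration.integrable_bound)
  show "integrable M (\<lambda>x. C * f x)" using assms(1) by simp
  show "(\<lambda>x. f x * g x) \<in> borel_measurable M" using assms by auto
  show "AE x in M. norm (f x * g x) \<le> norm (C * f x)"
    using assms(3)
  proof eventually_elim
    case (elim x)
    then have "\<bar>g x\<bar> * \<bar>f x\<bar> \<le> \<bar>C\<bar> * \<bar>f x\<bar>" by (intro mult_right_mono) auto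
    then show ?case by (simp add: abs_mult mult.commute)
  qed
qed

text \<open>Finite total mass makes the derivative finite almost everywhere, so it can be chosen
  real valued and nonnegative at every point. Serves both to build the transfer operator and to
  write a law absolutely continuous with respect to \<open>M\<close> as a density.\<close>

lemma (in sigma_finite_measure) Radon_Nikodym_integrable:
  assumes "absolutely_continuous M N" "sets N = sets M" and fin_N: "emeasure N (space M) < \<infinity>"
  shows "\<exists>h. integrable M h \<and> (\<forall>x. 0 \<le> h x) \<and> density M (\<lambda>x. ennreal (h x)) = N"
proof -
  obtain h' where h': "h' \<in> borel_measurable M" "density M h' = N"
    using Radon_Nikodym[OF assms(1,2)] by auto
  note [measurable] = h'(1)
  have "(\<integral>\<^sup>+x. h' x \<partial>M) = emeasure N (space M)"
    unfolding h'(2)[symmetric] by (simp add: emeasure_density nn_integral_set_ennreal cong: nn_integral_cong)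
  then have fin: "(\<integral>\<^sup>+x. h' x \<partial>M) < \<infinity>" using fin_N by simp
  define h where "h x = enn2real (h' x)" for x
  have [measurable]: "h \<in> borel_measurable M" unfolding h_def by measurable
  have AEfin: "AE x in M. h' x = ennreal (h x)"
    using nn_integral_PInf_AE[of h' M] fin
    by (auto simp: h_def less_top elim!: eventually_mono)
  have "density M (\<lambda>x. ennreal (h x)) = N"
    using AEfin by (subst h'(2)[symmetric], intro density_cong) auto
  moreover have "0 \<le> h x" for x by (simp add: h_def)
  moreover have "(\<integral>\<^sup>+x. ennreal (h x) \<partial>M) < \<infinity>"
    using fin nn_integral_cong_AE[OF AEfin] by simp
  then have "integrable M h"
    by (intro integrableI_nonneg) (auto simp: h_def)
  ultimately show ?thesis by blast
qed

section \<open>Existence, duality and positivity of the transfer operator\<close>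

locale mp_system = sigma_finite_measure M for M :: "'a measure" +
  fixes T :: "'a \<Rightarrow> 'a"
  assumes mp: "measure_preserving_map M T"
begin

abbreviation "L \<equiv> transfer_op M T"

lemma T_measurable [measurable]: "T \<in> measurable M M"
  using mp by (simp add: measure_preserving_map_def)

lemma distr_T: "distr M M T = M"
  using mp by (simp add: measure_preserving_map_def)

lemma Tn_measurable [measurable]: "(T ^^ n) \<in> measurable M M"
proof (induction n)
  case (Suc n)
  show ?case using measurable_comp[OF Suc T_measurable] by simp
qed simp

lemma AE_T: "AE x in M. P x \<Longrightarrow> AE x in M. P (T x)"
  using AE_distrD[OF T_measurable, of P] unfolding distr_T .

lemma is_transferD:
  assumes "is_transfer M T f h" "g \<in> borel_measurable M" "AE x in M. \<bar>g x\<bar> \<le> C"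
  shows "(\<integral>x. f x * g (T x) \<partial>M) = (\<integral>x. h x * g x \<partial>M)"
proof -
  have "\<exists>C. AE x in M. \<bar>g x\<bar> \<le> C" using assms(3) by blast
  then show ?thesis using assms(1,2) unfolding is_transfer_def by simp
qed

text \<open>The transfer of \<open>f\<close> is the Radon-Nikodym derivative of the image under
  \<open>T\<close> of the measure with density \<open>f\<close>. Since \<open>T\<close> preserves
  \<open>M\<close>, preimages of null sets are null, whence absolute continuity.\<close>

lemma ex_transfer_nonneg:
  assumes f: "integrable M f" "\<And>x. 0 \<le> f x"
  shows "\<exists>h. is_transfer M T f h"
proof -
  define N where "N = distr (density M (\<lambda>x. ennreal (f x))) M T"
  have [measurable]: "f \<in> borel_measurable M" using f by auto
  have sN: "sets N = sets M" by (simp add: N_def)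
  have "absolutely_continuous M N"
    unfolding absolutely_continuous_def
  proof
    fix A assume A: "A \<in> null_sets M"
    then have [measurable]: "A \<in> sets M" by auto
    have "AE x in M. x \<notin> A" using A by (simp add: AE_not_in)
    then have "AE x in M. T x \<notin> A" by (rule AE_T)
    then have *: "AE x in M. ennreal (f x) * indicator (T -` A \<inter> space M) x = 0"
      by eventually_elim (auto simp: indicator_def)
    have "emeasure N A = (\<integral>\<^sup>+x. ennreal (f x) * indicator (T -` A \<inter> space M) x \<partial>M)"
      unfolding N_def by (subst emeasure_distr) (auto simp: emeasure_density)
    also have "\<dots> = 0" using nn_integral_cong_AE[OF *] by simp
    finally show "A \<in> null_sets N" using A sN by auto
  qed
  moreover have "emeasure N (space M) < \<infinity>"
  proof -
    have "emeasure N (space M) = (\<integral>\<^sup>+x. ennreal (f x) \<partial>M)"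
      unfolding N_def
      by (subst emeasure_distr)
         (auto simp: emeasure_density measurable_space[OF T_measurable] intro!: nn_integral_cong split: split_indicator)
    also have "\<dots> < \<infinity>" using f by (simp add: nn_integral_eq_integral)
    finally show ?thesis .
  qed
  ultimately obtain h where ih: "integrable M h" and hn: "\<And>x. 0 \<le> h x" and N2: "density M (\<lambda>x. ennreal (h x)) = N"
    using Radon_Nikodym_integrable[OF _ sN] by blast
  have [measurable]: "h \<in> borel_measurable M" using ih by auto
  have "(\<integral>x. f x * g (T x) \<partial>M) = (\<integral>x. h x * g x \<partial>M)" if [measurable]: "g \<in> borel_measurable M" for g :: "'a \<Rightarrow> real"
  proof -
    have "(\<integral>x. h x * g x \<partial>M) = (\<integral>x. g x \<partial>N)"
      unfolding N2[symmetric] by (subst integral_density) (auto simp: hn)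
    also have "\<dots> = (\<integral>x. g (T x) \<partial>(density M (\<lambda>x. ennreal (f x))))"
      unfolding N_def by (subst integral_distr) auto
    also have "\<dots> = (\<integral>x. f x * g (T x) \<partial>M)"
      by (subst integral_density) (auto simp: f)
    finally show ?thesis by simp
  qed
  then show ?thesis using ih by (auto simp: is_transfer_def)
qed

lemma ex_transfer:
  assumes f: "integrable M f"
  shows "\<exists>h. is_transfer M T f h"
proof -
  obtain h1 where h1: "is_transfer M T (\<lambda>x. max 0 (f x)) h1"
    using ex_transfer_nonneg[of "\<lambda>x. max 0 (f x)"] f by auto
  obtain h2 where h2: "is_transfer M T (\<lambda>x. max 0 (- f x)) h2"
    using ex_transfer_nonneg[of "\<lambda>x. max 0 (- f x)"] f by auto
  have "is_transfer M T f (\<lambda>x. h1 x - h2 x)"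
    unfolding is_transfer_def
  proof (intro conjI ballI impI)
    show "integrable M (\<lambda>x. h1 x - h2 x)" using h1 h2 by (auto simp: is_transfer_def)
    fix g :: "'a \<Rightarrow> real" assume g [measurable]: "g \<in> borel_measurable M" and "\<exists>C. AE x in M. \<bar>g x\<bar> \<le> C"
    then obtain C where C: "AE x in M. \<bar>g x\<bar> \<le> C" by auto
    have C': "AE x in M. \<bar>g (T x)\<bar> \<le> C" using AE_T[OF C] .
    have "(\<integral>x. f x * g (T x) \<partial>M) = (\<integral>x. max 0 (f x) * g (T x) - max 0 (- f x) * g (T x) \<partial>M)"
      by (intro Bochner_Integration.integral_cong) (auto simp: max_def)
    also have "\<dots> = (\<integral>x. max 0 (f x) * g (T x) \<partial>M) - (\<integral>x. max 0 (- f x) * g (T x) \<partial>M)"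
      by (intro Bochner_Integration.integral_diff integrable_mult_AE_bounded[OF _ _ C'])
         (use f in auto)
    also have "\<dots> = (\<integral>x. h1 x * g x \<partial>M) - (\<integral>x. h2 x * g x \<partial>M)"
      using is_transferD[OF h1 g C] is_transferD[OF h2 g C] by simp
    also have "\<dots> = (\<integral>x. h1 x * g x - h2 x * g x \<partial>M)"
      using h1 h2 unfolding is_transfer_def
      by (intro Bochner_Integration.integral_diff[symmetric] integrable_mult_AE_bounded[OF _ _ C]) auto
    finally show "(\<integral>x. f x * g (T x) \<partial>M) = (\<integral>x. (h1 x - h2 x) * g x \<partial>M)"
      by (simp add: algebra_simps)
  qed
  then show ?thesis by auto
qed

lemma transfer_op_is_transfer: "integrable M f \<Longrightarrow> is_transfer M T f (L f)"
  unfolding transfer_op_def using ex_transfer by (rule someI_ex)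

lemma integrable_L: "integrable M f \<Longrightarrow> integrable M (L f)"
  using transfer_op_is_transfer by (auto simp: is_transfer_def)

lemma integrable_Ln: "integrable M f \<Longrightarrow> integrable M ((L ^^ k) f)"
  by (induction k) (auto intro: integrable_L)

lemma L_dual:
  assumes "integrable M f" "g \<in> borel_measurable M" "\<And>x. \<bar>g x\<bar> \<le> C"
  shows "(\<integral>x. f x * g (T x) \<partial>M) = (\<integral>x. L f x * g x \<partial>M)"
  using assms(3) by (intro is_transferD[OF transfer_op_is_transfer[OF assms(1)] assms(2), of C]) auto

lemma Ln_dual:
  assumes "integrable M f" "g \<in> borel_measurable M" "\<And>x. \<bar>g x\<bar> \<le> C"
  shows "(\<integral>x. f x * g ((T ^^ k) x) \<partial>M) = (\<integral>x. (L ^^ k) f x * g x \<partial>M)"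
  using assms(2,3)
proof (induction k arbitrary: g)
  case (Suc k)
  have "(\<integral>x. f x * g ((T ^^ Suc k) x) \<partial>M) = (\<integral>x. f x * (g \<circ> T) ((T ^^ k) x) \<partial>M)" by simp
  also have "\<dots> = (\<integral>x. (L ^^ k) f x * (g \<circ> T) x \<partial>M)"
    using Suc.prems by (intro Suc.IH) (auto intro!: measurable_comp[OF T_measurable])
  also have "\<dots> = (\<integral>x. L ((L ^^ k) f) x * g x \<partial>M)"
    using L_dual[OF integrable_Ln[OF assms(1)] Suc.prems] by simp
  finally show ?case by simp
qed simp

lemma integral_L: "integrable M f \<Longrightarrow> (\<integral>x. L f x \<partial>M) = (\<integral>x. f x \<partial>M)"
  using L_dual[of f "\<lambda>_. 1" 1] by simp

lemma integral_Ln: "integrable M f \<Longrightarrow> (\<integral>x. (L ^^ k) f x \<partial>M) = (\<integral>x. f x \<partial>M)"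
  using Ln_dual[of f "\<lambda>_. 1" 1 k] by simp

text \<open>Tested against the indicator of the set where \<open>L f\<close> is negative, duality
  gives an integral that is both nonnegative and nonpositive, so this set is null.\<close>

lemma L_nonneg:
  assumes f: "integrable M f" "AE x in M. 0 \<le> f x"
  shows "AE x in M. 0 \<le> L f x"
proof -
  define g where "g x = (indicator {x\<in>space M. L f x < 0} x :: real)" for x
  have [measurable]: "L f \<in> borel_measurable M" using integrable_L[OF f(1)] by auto
  have [measurable]: "g \<in> borel_measurable M" unfolding g_def by measurable
  have "0 \<le> (\<integral>x. f x * g (T x) \<partial>M)"
    using f(2) by (intro integral_nonneg_AE) (auto simp: g_def)
  also have "\<dots> = (\<integral>x. L f x * g x \<partial>M)" using f by (intro L_dual[where C=1]) (auto simp: g_def indicator_def)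
  finally have 1: "(\<integral>x. - (L f x * g x) \<partial>M) \<le> 0" by simp
  have i: "integrable M (\<lambda>x. - (L f x * g x))"
    using integrable_mult_AE_bounded[OF integrable_L[OF f(1)], of g 1] by (auto simp: g_def indicator_def)
  have n: "0 \<le> - (L f x * g x)" for x by (auto simp: g_def indicator_def)
  have "(\<integral>x. - (L f x * g x) \<partial>M) = 0" using Bochner_Integration.integral_nonneg[of M "\<lambda>x. - (L f x * g x)"] n 1 by (simp only: order_antisym)
  then have "AE x in M. - (L f x * g x) = 0"
    using i n by (subst (asm) integral_nonneg_eq_0_iff_AE) auto
  then show ?thesis
    by (rule AE_mp) (auto simp: g_def indicator_def)
qed

lemma Ln_nonneg:
  assumes f: "integrable M f" "AE x in M. 0 \<le> f x"
  shows "AE x in M. 0 \<le> (L ^^ k) f x"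
proof (induction k)
  case (Suc k)
  show ?case using L_nonneg[OF integrable_Ln[OF f(1)] Suc] by simp
qed (use f in simp)

end

text \<open>Absolute continuity of the integral along sets that are not nested. Dominated
  convergence is applied to the excess of \<open>\<bar>w x\<bar>\<close> over a level
  \<open>K\<close>; what lies below the level contributes at most \<open>K\<close> times the measure
  of the set.\<close>

lemma integral_small_sets:
  fixes w :: "'a \<Rightarrow> real"
  assumes w: "integrable M w" and A [measurable]: "\<And>n. A n \<in> sets M"
    and A0: "(\<lambda>n. emeasure M (A n)) \<longlonglongrightarrow> 0"
  shows "(\<lambda>n. \<integral>x. \<bar>w x\<bar> * indicator (A n) x \<partial>M) \<longlonglongrightarrow> 0"
proof (rule LIMSEQ_I)
  fix e :: real assume e: "e > 0"
  have [measurable]: "w \<in> borel_measurable M" using w by auto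
  have "(\<lambda>K. \<integral>x. max 0 (\<bar>w x\<bar> - real K) \<partial>M) \<longlonglongrightarrow> (\<integral>x. 0 \<partial>M)"
  proof (rule integral_dominated_convergence[where w="\<lambda>x. \<bar>w x\<bar>"])
    show "AE x in M. (\<lambda>K. max 0 (\<bar>w x\<bar> - real K)) \<longlonglongrightarrow> 0"
    proof (rule AE_I2, rule tendsto_eventually)
      fix x
      obtain K0 :: nat where "\<bar>w x\<bar> \<le> real K0" using real_arch_simple by blast
      then have "\<forall>K\<ge>K0. max 0 (\<bar>w x\<bar> - real K) = 0" by auto
      then show "\<forall>\<^sub>F K in sequentially. max 0 (\<bar>w x\<bar> - real K) = 0" using eventually_sequentially by blast
    qed
  qed (use w in auto)
  then have "(\<lambda>K. \<integral>x. max 0 (\<bar>w x\<bar> - real K) \<partial>M) \<longlonglongrightarrow> 0" by simp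
  from LIMSEQ_D[OF this, of "e/2"] e obtain K where K: "\<bar>\<integral>x. max 0 (\<bar>w x\<bar> - real K) \<partial>M\<bar> < e/2" by auto
  have "eventually (\<lambda>n. emeasure M (A n) < ennreal (e / (2 * (real K + 1)))) sequentially"
    using A0 e by (intro order_tendstoD) auto
  then obtain n0 where n0: "\<And>n. n \<ge> n0 \<Longrightarrow> emeasure M (A n) < ennreal (e / (2 * (real K + 1)))"
    by (auto simp: eventually_sequentially)
  show "\<exists>n0. \<forall>n\<ge>n0. norm ((\<integral>x. \<bar>w x\<bar> * indicator (A n) x \<partial>M) - 0) < e"
  proof (intro exI allI impI)
    fix n assume n: "n \<ge> n0"
    have fin: "emeasure M (A n) < \<infinity>" using order_less_trans[OF n0[OF n] ennreal_less_top] by simp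
    have m: "measure M (A n) < e / (2 * (real K + 1))"
      using n0[OF n] fin e by (simp add: emeasure_eq_ennreal_measure less_top[symmetric] ennreal_less_iff)
    have i1: "integrable M (\<lambda>x. max 0 (\<bar>w x\<bar> - real K))"
      by (rule Bochner_Integration.integrable_bound[OF w]) (auto simp: max_def)
    have i2: "integrable M (\<lambda>x. real K * indicator (A n) x)" using fin by auto
    have i3: "integrable M (\<lambda>x. \<bar>w x\<bar> * indicator (A n) x)"
      by (rule Bochner_Integration.integrable_bound[OF w]) (auto simp: indicator_def)
    have "(\<integral>x. \<bar>w x\<bar> * indicator (A n) x \<partial>M) \<le> (\<integral>x. max 0 (\<bar>w x\<bar> - real K) + real K * indicator (A n) x \<partial>M)"
      using i1 i2 i3 by (intro integral_mono) (auto simp: indicator_def)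
    also have "\<dots> = (\<integral>x. max 0 (\<bar>w x\<bar> - real K) \<partial>M) + real K * measure M (A n)"
      using i1 i2 fin by (simp add: Bochner_Integration.integral_add)
    also have "real K * measure M (A n) \<le> (real K + 1) * measure M (A n)"
      by (intro mult_right_mono) auto
    also have "\<dots> < e / 2"
      using m e by (simp add: field_simps)
    finally show "norm ((\<integral>x. \<bar>w x\<bar> * indicator (A n) x \<partial>M) - 0) < e"
      using K by simp
  qed
qed

section \<open>Recurrence and the filling scheme\<close>

locale cempt_system = sigma_finite_measure M for M :: "'a measure" +
  fixes T :: "'a \<Rightarrow> 'a"
  assumes cempt: "cempt M T"

sublocale cempt_system \<subseteq> mp_system
  using cempt by unfold_locales (auto simp: cempt_def)

context cempt_system
begin

text \<open>If the points that never visit \<open>H\<close> had positive measure, mass started there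
  would have all its images \<open>(L ^^ Suc k) u\<close> equal to 0 on \<open>H\<close>. Their sum
  diverges almost everywhere by conservativity and ergodicity, so \<open>H\<close> would be
  null.\<close>

lemma recurrence:
  assumes H [measurable]: "H \<in> sets M" and Hp: "emeasure M H > 0"
  shows "AE x in M. \<exists>k. (T ^^ Suc k) x \<in> H"
proof (rule ccontr)
  assume neg: "\<not> ?thesis"
  define A where "A = {x\<in>space M. \<forall>k. (T ^^ Suc k) x \<notin> H}"
  have [measurable]: "A \<in> sets M" unfolding A_def by measurable
  have "emeasure M A \<noteq> 0"
    using neg by (subst (asm) AE_iff_measurable[of A]) (auto simp: A_def)
  \<comment> \<open>The indicator of \<open>A\<close> may fail to be integrable; a subset of
    positive finite measure takes its place.\<close>
  have "\<exists>i\<in>sets M. i \<subseteq> A \<and> emeasure M i > 0 \<and> emeasure M i < \<infinity>"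
  proof (cases "emeasure M A = \<infinity>")
    case True
    obtain Z where "Z \<in> sets M" "Z \<subseteq> A" "emeasure M Z < \<infinity>" "ennreal 0 < emeasure M Z"
      using approx_PInf_emeasure_with_finite[OF \<open>A \<in> sets M\<close> True, of 0] by blast
    then show ?thesis by auto
  next
    case False
    then show ?thesis using \<open>emeasure M A \<noteq> 0\<close> \<open>A \<in> sets M\<close>
      by (intro bexI[of _ A]) (simp_all add: zero_less_iff_neq_zero less_top)
  qed
  then obtain A' where A' [measurable]: "A' \<in> sets M" and A'': "A' \<subseteq> A" "emeasure M A' > 0" "emeasure M A' < \<infinity>"
    by blast
  define u where "u x = (indicator A' x :: real)" for x
  have iu: "integrable M u" unfolding u_def using A'' by auto
  have pu: "0 < (\<integral>x. u x \<partial>M)" using A'' by (simp add: u_def measure_def enn2real_positive_iff)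
  have "AE x in M. x \<in> H \<longrightarrow> (L ^^ Suc k) u x = 0" for k
  proof -
    have [measurable]: "(L ^^ Suc k) u \<in> borel_measurable M" using integrable_Ln[OF iu, of "Suc k"] by (rule borel_measurable_integrable)
    have nn: "AE x in M. 0 \<le> (L ^^ Suc k) u x" by (intro Ln_nonneg iu) (auto simp: u_def)
    have "0 = (\<integral>x. u x * indicator H ((T ^^ Suc k) x) \<partial>M)"
      using A'' by (subst Bochner_Integration.integral_cong[where g="\<lambda>_. 0"]) (auto simp: u_def A_def indicator_def)
    also have "\<dots> = (\<integral>x. (L ^^ Suc k) u x * indicator H x \<partial>M)"
      using iu by (intro Ln_dual[where C=1]) (auto simp: indicator_def)
    finally have "(\<integral>x. (L ^^ Suc k) u x * indicator H x \<partial>M) = 0" by simp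
    moreover have "integrable M (\<lambda>x. (L ^^ Suc k) u x * indicator H x)"
      by (intro integrable_mult_AE_bounded[where C=1] integrable_Ln[OF iu]) (auto simp: indicator_def)
    ultimately have "AE x in M. (L ^^ Suc k) u x * indicator H x = 0"
      using nn by (subst (asm) integral_nonneg_eq_0_iff_AE) auto
    then show ?thesis by (rule AE_mp) (auto simp: indicator_def)
  qed
  then have z: "AE x in M. \<forall>k. x \<in> H \<longrightarrow> (L ^^ Suc k) u x = 0" by (subst AE_all_countable) blast
  have inf: "AE x in M. filterlim (\<lambda>n. \<Sum>k<n. (L ^^ k) u x) at_top sequentially"
  proof -
    have "AE x in M. 0 \<le> u x" by (simp add: u_def)
    with iu pu cempt show ?thesis unfolding cempt_def by blast
  qed
  from z inf have "AE x in M. x \<notin> H"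
  proof eventually_elim
    case (elim x)
    show ?case
    proof
      assume "x \<in> H"
      then have "(\<Sum>k<Suc n. (L ^^ k) u x) = u x" for n
        using elim(1) by (subst sum.lessThan_Suc_shift) simp
      moreover from elim(2) have "filterlim (\<lambda>n. \<Sum>k<Suc n. (L ^^ k) u x) at_top sequentially"
        by (subst filterlim_sequentially_Suc)
      ultimately have "filterlim (\<lambda>n::nat. u x) at_top sequentially" by simp
      then have "eventually (\<lambda>n::nat. u x + 1 \<le> u x) sequentially" unfolding filterlim_at_top by blast
      then show False by simp
    qed
  qed
  then have "H \<in> null_sets M" by (simp add: AE_iff_null_sets)
  then show False using Hp by auto
qed

text \<open>
  The positive part is transported while it fills up the negative part. On the set \<open>H\<close> where the
  negative part is never filled up, all arriving mass is absorbed, and by recurrence all mass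
  arrives there.
\<close>

primrec filling :: "('a \<Rightarrow> real) \<Rightarrow> nat \<Rightarrow> 'a \<Rightarrow> real" where
  "filling g 0 = g"
| "filling g (Suc k) = (\<lambda>x. L (\<lambda>y. max 0 (filling g k y)) x - max 0 (- filling g k x))"

lemma integrable_filling: "integrable M g \<Longrightarrow> integrable M (filling g k)"
  by (induction k) (auto intro!: integrable_L)

lemma integral_filling:
  assumes "integrable M g" shows "(\<integral>x. filling g k x \<partial>M) = (\<integral>x. g x \<partial>M)"
proof (induction k)
  case (Suc k)
  note i = integrable_filling[OF assms, of k]
  have "(\<integral>x. filling g (Suc k) x \<partial>M) = (\<integral>x. max 0 (filling g k x) \<partial>M) - (\<integral>x. max 0 (- filling g k x) \<partial>M)"
    using i by (simp add: Bochner_Integration.integral_diff integrable_L integral_L)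
  also have "\<dots> = (\<integral>x. max 0 (filling g k x) - max 0 (- filling g k x) \<partial>M)"
    using i by (intro Bochner_Integration.integral_diff[symmetric]) auto
  also have "\<dots> = (\<integral>x. filling g k x \<partial>M)" by (intro Bochner_Integration.integral_cong) auto
  finally show ?case using Suc by simp
qed simp

lemma filling_pos_le:
  assumes g: "integrable M g"
  shows "AE x in M. max 0 (filling g (Suc k) x) \<le> L (\<lambda>y. max 0 (filling g k y)) x
     \<and> max 0 (- filling g (Suc k) x) \<le> max 0 (- filling g k x)"
  using L_nonneg[of "\<lambda>y. max 0 (filling g k y)"] integrable_filling[OF g, of k]
  by (auto elim!: eventually_mono)

text \<open>Positive and negative parts have equal integrals at every stage, so it is enough that
  one of them vanishes. If the negative part decreases to 0 almost everywhere, dominated convergence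
  does it. Otherwise the set \<open>H\<close> where it stays positive has positive measure, and the
  positive part vanishes because its mass is absorbed on reaching \<open>H\<close>.\<close>

lemma filling_tendsto_0:
  assumes g: "integrable M g" and g0: "(\<integral>x. g x \<partial>M) = 0"
  shows "(\<lambda>k. \<integral>x. \<bar>filling g k x\<bar> \<partial>M) \<longlonglongrightarrow> 0"
proof -
  let ?p = "\<lambda>k x. max 0 (filling g k x)" and ?m = "\<lambda>k x. max 0 (- filling g k x)"
  note i [intro] = integrable_filling[OF g]
  have [measurable]: "filling g k \<in> borel_measurable M" for k using i by blast
  have ip: "integrable M (?p k)" and im: "integrable M (?m k)" for k using i[of k] by auto
  have eq: "(\<integral>x. ?p k x \<partial>M) = (\<integral>x. ?m k x \<partial>M)" for k
  proof -
    have "(\<integral>x. ?p k x \<partial>M) - (\<integral>x. ?m k x \<partial>M) = (\<integral>x. ?p k x - ?m k x \<partial>M)"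
      by (intro Bochner_Integration.integral_diff[symmetric] ip im)
    also have "\<dots> = (\<integral>x. filling g k x \<partial>M)" by (intro Bochner_Integration.integral_cong) auto
    finally show ?thesis using integral_filling[OF g] g0 by simp
  qed
  have abs: "(\<integral>x. \<bar>filling g k x\<bar> \<partial>M) = (\<integral>x. ?p k x \<partial>M) + (\<integral>x. ?m k x \<partial>M)" for k
  proof -
    have "(\<integral>x. \<bar>filling g k x\<bar> \<partial>M) = (\<integral>x. ?p k x + ?m k x \<partial>M)"
      by (intro Bochner_Integration.integral_cong) auto
    then show ?thesis using Bochner_Integration.integral_add[OF ip im] by simp
  qed
  have lim: "(\<lambda>k. \<integral>x. ?p k x \<partial>M) \<longlonglongrightarrow> 0"
  proof -
    define h where "h x = (INF k. ?m k x)" for x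
    have bb: "bdd_below (range (\<lambda>k. ?m k x))" for x by (rule bdd_belowI[of _ 0]) auto
    have hle: "h x \<le> ?m k x" for k x unfolding h_def by (rule cINF_lower[OF bb]) simp
    have h0: "0 \<le> h x" for x unfolding h_def by (rule cINF_greatest) auto
    have [measurable]: "h \<in> borel_measurable M" unfolding h_def
      by (rule borel_measurable_cINF) (auto simp: bb)
    define H where "H = {x\<in>space M. h x > 0}"
    have Hm [measurable]: "H \<in> sets M" unfolding H_def by measurable
    have dec: "AE x in M. \<forall>k. ?m (Suc k) x \<le> ?m k x"
      unfolding AE_all_countable using filling_pos_le[OF g] by auto
    show ?thesis
    proof (cases "emeasure M H = 0")
      case True
      then have "AE x in M. x \<notin> H" using Hm by (intro AE_not_in) (auto simp: null_sets_def)
      then have z: "AE x in M. h x = 0" by (rule AE_mp) (use h0 in \<open>auto simp: H_def less_le\<close>)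
      have "(\<lambda>k. \<integral>x. ?m k x \<partial>M) \<longlonglongrightarrow> (\<integral>x. 0 \<partial>M)"
      proof (rule integral_dominated_convergence[where w="?m 0"])
        show "AE x in M. (\<lambda>k. ?m k x) \<longlonglongrightarrow> 0"
          using z dec
        proof eventually_elim
          case (elim x)
          have "(\<lambda>k. ?m k x) \<longlonglongrightarrow> (INF k. ?m k x)"
            using elim by (intro LIMSEQ_decseq_INF bb decseq_SucI) auto
          then show ?case using elim by (simp add: h_def)
        qed
        show "AE x in M. norm (?m k x) \<le> ?m 0 x" for k
          using dec
        proof eventually_elim
          case (elim x)
          then have "decseq (\<lambda>k. ?m k x)" by (intro decseq_SucI) simp
          from decseqD[OF this le0, of k] have "?m k x \<le> ?m 0 x" .
          then show ?case by (simp only: real_norm_def abs_of_nonneg max.cobounded1)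
        qed
      qed (use im im[of 0] in auto)
      then show ?thesis by (simp add: eq)
    next
      case False
      \<comment> \<open>The indicator that the orbit avoids \<open>H\<close> at times 1 to
        \<open>k\<close>. The negative part is positive on \<open>H\<close> at every stage, so the
        positive part is 0 there, and the factor \<open>indicator (- H)\<close> can be inserted
        before each use of duality.\<close>
      define K where "K k x = (indicator {x. \<forall>j<k. (T ^^ Suc j) x \<notin> H} x :: real)" for k x
      have mK [measurable]: "K k \<in> borel_measurable M" for k unfolding K_def by measurable
      have KS: "K (Suc k) x = indicator (- H) (T x) * K k (T x)" for k x
        by (auto simp: K_def indicator_def funpow_swap1 less_Suc_eq_0_disj)
      have step: "(\<integral>x. ?p (Suc k) x * K l x \<partial>M) \<le> (\<integral>x. ?p k x * K (Suc l) x \<partial>M)" for k l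
      proof -
        have iL: "integrable M (L (?p k))" by (intro integrable_L ip)
        have "(\<integral>x. ?p (Suc k) x * K l x \<partial>M) \<le> (\<integral>x. L (?p k) x * (indicator (- H) x * K l x) \<partial>M)"
        proof (rule integral_mono_AE)
          show "integrable M (\<lambda>x. ?p (Suc k) x * K l x)"
            by (intro integrable_mult_AE_bounded[where C=1] ip) (auto simp: K_def indicator_def)
          show "integrable M (\<lambda>x. L (?p k) x * (indicator (- H) x * K l x))"
            by (intro integrable_mult_AE_bounded[where C=1] iL) (auto simp: K_def indicator_def)
          show "AE x in M. ?p (Suc k) x * K l x \<le> L (?p k) x * (indicator (- H) x * K l x)"
            using filling_pos_le[OF g, of k] AE_space[of M]
          proof eventually_elim
            case (elim x)
            show ?case
            proof (cases "x \<in> H")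
              case True
              then have "0 < ?m (Suc k) x" using hle[of x "Suc k"] unfolding H_def by (metis (mono_tags, lifting) mem_Collect_eq less_le_trans)
              then have "?p (Suc k) x = 0" by (auto simp: max_def split: if_splits)
              then show ?thesis using True by simp
            qed (use elim in \<open>auto simp: K_def indicator_def\<close>)
          qed
        qed
        also have "\<dots> = (\<integral>x. ?p k x * (indicator (- H) (T x) * K l (T x)) \<partial>M)"
          by (intro L_dual[symmetric, where C=1] ip) (auto simp: K_def indicator_def)
        finally show ?thesis by (simp add: KS)
      qed
      have "(\<integral>x. ?p k x * K l x \<partial>M) \<le> (\<integral>x. ?p 0 x * K (k + l) x \<partial>M)" for k l
      proof (induction k arbitrary: l)
        case (Suc k)
        show ?case using order_trans[OF step Suc.IH[of "Suc l"]] by simp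
      qed simp
      from this[of _ 0] have le: "(\<integral>x. ?p k x \<partial>M) \<le> (\<integral>x. ?p 0 x * K k x \<partial>M)" for k
        by (simp add: K_def)
      have "(\<lambda>k. \<integral>x. ?p 0 x * K k x \<partial>M) \<longlonglongrightarrow> (\<integral>x. 0 \<partial>M)"
      proof (rule integral_dominated_convergence[where w="?p 0"])
        show "AE x in M. (\<lambda>k. ?p 0 x * K k x) \<longlonglongrightarrow> 0"
          using recurrence[OF Hm] False
        proof (auto simp: zero_less_iff_neq_zero elim!: eventually_mono)
          fix x k assume k: "T ((T ^^ k) x) \<in> H"
          have "\<forall>\<^sub>F n in sequentially. K n x = 0"
            using eventually_gt_at_top[of k] by eventually_elim (use k in \<open>auto simp: K_def indicator_def\<close>)
          then show "(\<lambda>k. max 0 (g x) * K k x) \<longlonglongrightarrow> 0"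
            by (intro tendsto_eventually) (auto elim: eventually_mono)
        qed
      qed (use ip[of 0] g in \<open>auto simp: K_def indicator_def\<close>)
      then have "(\<lambda>k. \<integral>x. ?p 0 x * K k x \<partial>M) \<longlonglongrightarrow> 0" by simp
      then show ?thesis
        by (rule tendsto_0_le[where K=1]) (use order_trans[OF le abs_ge_self] in \<open>auto intro!: always_eventually\<close>)
    qed
  qed
  have "(\<lambda>k. (\<integral>x. ?p k x \<partial>M) + (\<integral>x. ?p k x \<partial>M)) \<longlonglongrightarrow> 0 + 0"
    by (intro tendsto_add lim)
  then show ?thesis by (simp add: abs eq)
qed

text \<open>Replacing \<open>filling g k\<close> by \<open>filling g (Suc k)\<close> transports the
  positive part by \<open>L\<close> and so changes the integral by a term of the form in
  \<open>inv\<close>. After finitely many such replacements the L1 norm is small, and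
  \<open>Qb\<close> then bounds the integral itself.\<close>

lemma asymptotically_invariant_imp_constant:
  assumes Qm [measurable]: "\<And>n. Q n \<in> borel_measurable M" and Qb: "\<And>n x. \<bar>Q n x\<bar> \<le> 1"
    and inv: "\<And>w. integrable M w \<Longrightarrow> (\<lambda>n. \<integral>x. w x * (Q n x - Q n (T x)) \<partial>M) \<longlonglongrightarrow> 0"
    and g: "integrable M g" and g0: "(\<integral>x. g x \<partial>M) = 0"
  shows "(\<lambda>n. \<integral>x. g x * Q n x \<partial>M) \<longlonglongrightarrow> (0::real)"
proof -
  note i = integrable_filling[OF g]
  have iQ: "integrable M w \<Longrightarrow> integrable M (\<lambda>x. w x * Q n x)" 
       "integrable M w \<Longrightarrow> integrable M (\<lambda>x. w x * Q n (T x))" for w n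
    using Qb by (auto intro!: integrable_mult_AE_bounded[where C=1])
  have step: "(\<lambda>n. (\<integral>x. filling g k x * Q n x \<partial>M) - (\<integral>x. filling g (Suc k) x * Q n x \<partial>M)) \<longlonglongrightarrow> 0" for k
  proof -
    let ?p = "\<lambda>x. max 0 (filling g k x)" and ?m = "\<lambda>x. max 0 (- filling g k x)"
    have ip: "integrable M ?p" and im: "integrable M ?m" using i[of k] by auto
    have "(\<integral>x. filling g k x * Q n x \<partial>M) - (\<integral>x. filling g (Suc k) x * Q n x \<partial>M) = (\<integral>x. ?p x * (Q n x - Q n (T x)) \<partial>M)" for n
    proof -
      have 1: "(\<integral>x. filling g (Suc k) x * Q n x \<partial>M) = (\<integral>x. L ?p x * Q n x \<partial>M) - (\<integral>x. ?m x * Q n x \<partial>M)"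
        using iQ(1)[OF integrable_L[OF ip], of n] iQ(1)[OF im, of n]
        by (simp add: left_diff_distrib Bochner_Integration.integral_diff)
      have 2: "(\<integral>x. L ?p x * Q n x \<partial>M) = (\<integral>x. ?p x * Q n (T x) \<partial>M)"
        using Qb by (intro L_dual[symmetric] ip) auto
      have "(\<integral>x. filling g k x * Q n x \<partial>M) = (\<integral>x. ?p x * Q n x - ?m x * Q n x \<partial>M)"
        by (intro Bochner_Integration.integral_cong) (auto simp: max_def)
      also have "\<dots> = (\<integral>x. ?p x * Q n x \<partial>M) - (\<integral>x. ?m x * Q n x \<partial>M)"
        by (intro Bochner_Integration.integral_diff iQ ip im)
      finally have 3: "(\<integral>x. filling g k x * Q n x \<partial>M) = \<dots>" .
      have "(\<integral>x. ?p x * (Q n x - Q n (T x)) \<partial>M) = (\<integral>x. ?p x * Q n x - ?p x * Q n (T x) \<partial>M)"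
        by (simp add: algebra_simps)
      also have "\<dots> = (\<integral>x. ?p x * Q n x \<partial>M) - (\<integral>x. ?p x * Q n (T x) \<partial>M)"
        by (intro Bochner_Integration.integral_diff iQ ip)
      finally show ?thesis using 1 2 3 by simp
    qed
    then show ?thesis using inv[OF ip] by simp
  qed
  have tel: "(\<lambda>n. (\<integral>x. g x * Q n x \<partial>M) - (\<integral>x. filling g k x * Q n x \<partial>M)) \<longlonglongrightarrow> 0" for k
  proof (induction k)
    case (Suc k)
    from tendsto_add[OF Suc step[of k]] show ?case by simp
  qed simp
  show ?thesis
  proof (rule LIMSEQ_I)
    fix e :: real assume e: "e > 0"
    from LIMSEQ_D[OF filling_tendsto_0[OF g g0], of "e/2"] e
    obtain k where "norm ((\<integral>x. \<bar>filling g k x\<bar> \<partial>M) - 0) < e/2" by (meson half_gt_zero order_refl)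
    then have k: "(\<integral>x. \<bar>filling g k x\<bar> \<partial>M) < e/2" by simp
    from LIMSEQ_D[OF tel[of k], of "e/2"] e obtain n0 where
      n0: "\<And>n. n \<ge> n0 \<Longrightarrow> \<bar>(\<integral>x. g x * Q n x \<partial>M) - (\<integral>x. filling g k x * Q n x \<partial>M)\<bar> < e/2" by auto
    have bd: "\<bar>\<integral>x. filling g k x * Q n x \<partial>M\<bar> \<le> (\<integral>x. \<bar>filling g k x\<bar> \<partial>M)" for n
    proof -
      have "\<bar>\<integral>x. filling g k x * Q n x \<partial>M\<bar> \<le> (\<integral>x. \<bar>filling g k x * Q n x\<bar> \<partial>M)"
        by (rule integral_abs_bound)
      also have "\<dots> \<le> (\<integral>x. \<bar>filling g k x\<bar> \<partial>M)"
        using i[of k] integrable_abs[OF iQ(1)[OF i[of k], of n]] Qb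
        by (intro integral_mono) (auto simp: abs_mult intro: mult_left_le)
      finally show ?thesis .
    qed
    have "\<bar>\<integral>x. g x * Q n x \<partial>M\<bar> < e" if "n \<ge> n0" for n
      using n0[OF that] k bd[of n] unfolding abs_less_iff abs_le_iff by linarith
    then show "\<exists>n0. \<forall>n\<ge>n0. norm ((\<integral>x. g x * Q n x \<partial>M) - 0) < e"
      by auto
  qed
qed

end

section \<open>Abel means of regularly varying sequences\<close>

abbreviation exp1 :: "real measure" where
  "exp1 \<equiv> density lborel (exponential_density 1)"

lemma prob_space_exp1: "prob_space exp1"
  by (rule prob_space_exponential_density) simp

lemma AE_exp1_pos: "AE x in exp1. 0 < x"
proof -
  have "AE x in lborel. x \<noteq> (0::real)" by (rule AE_lborel_singleton)
  then show ?thesis by (subst AE_density) (auto simp: exponential_density_def elim!: eventually_mono)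
qed

lemma exp1_powr:
  assumes "0 \<le> b"
  shows "integrable exp1 (\<lambda>x. x powr b)" "(\<integral>x. x powr b \<partial>exp1) = Gamma (1 + b)"
proof -
  have "has_bochner_integral exp1 (\<lambda>x. x powr b) (Gamma (1 + b))"
  proof (rule has_bochner_integral_nn_integral)
    have "(\<integral>\<^sup>+x. ennreal (x powr b) \<partial>exp1) = (\<integral>\<^sup>+x. ennreal (indicator {0..} x * x powr ((1 + b) - 1) / exp x) \<partial>lborel)"
      by (subst nn_integral_density)
         (auto simp: exponential_density_def exp_minus divide_simps ennreal_mult'[symmetric] mult.commute indicator_def intro!: nn_integral_cong)
    also have "\<dots> = ennreal (Gamma (1 + b))"
      using assms by (subst Gamma_conv_nn_integral_real[symmetric]) (auto simp: nn_integral_completion)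
    finally show "(\<integral>\<^sup>+x. ennreal (x powr b) \<partial>exp1) = ennreal (Gamma (1 + b))" .
    show "0 \<le> Gamma (1 + b)" using assms by (intro Gamma_real_nonneg) auto
  qed auto
  then show "integrable exp1 (\<lambda>x. x powr b)" "(\<integral>x. x powr b \<partial>exp1) = Gamma (1 + b)"
    by (auto simp: has_bochner_integral_iff)
qed

lemma measure_exp1_lessThan:
  assumes "0 \<le> a" shows "measure exp1 {..<a} = 1 - exp (- a)"
proof -
  have "AE x in exp1. x \<noteq> a"
    using AE_lborel_singleton[of a] by (subst AE_density) (auto elim!: eventually_mono)
  then have "emeasure exp1 {..<a} = emeasure exp1 {..a}"
    by (intro emeasure_eq_AE) (auto elim!: eventually_mono)
  also have "\<dots> = ennreal (1 - exp (- a))"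
    using assms by (subst emeasure_erlang_density) (auto simp: erlang_CDF_0)
  finally show ?thesis using assms by (simp add: measure_def)
qed

text \<open>If \<open>x\<close> is exponential, the integer part of \<open>S * x\<close> is
  geometric: it equals \<open>n\<close> with probability
  \<open>(1 - exp (- (1 / S))) * exp (- (1 / S) * real n)\<close>. Abel means thus become
  expectations, to which dominated convergence applies.\<close>

lemma exp1_floor_sums:
  fixes c :: "nat \<Rightarrow> real"
  assumes c: "\<And>n. 0 \<le> c n" and S: "0 < S" and i: "integrable exp1 (\<lambda>x. c (nat \<lfloor>S * x\<rfloor>))"
  shows "(\<lambda>n. (1 - exp (- (1 / S))) * (exp (- (1 / S) * real n) * c n)) sums (\<integral>x. c (nat \<lfloor>S * x\<rfloor>) \<partial>exp1)"
proof -
  interpret prob_space exp1 by (rule prob_space_exp1)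
  define N where "N x = nat \<lfloor>S * x\<rfloor>" for x
  have [measurable]: "N \<in> measurable exp1 (count_space UNIV)" unfolding N_def by measurable
  define p where "p n = (1 - exp (- (1 / S))) * (exp (- (1 / S) * real n) * c n)" for n
  have p0: "0 \<le> p n" for n using c S by (auto simp: p_def)
  have N_iff: "N x < n \<longleftrightarrow> x < real n / S" if "n > 0" for x n
  proof -
    have "N x < n \<longleftrightarrow> \<lfloor>S * x\<rfloor> < int n" using that by (auto simp: N_def)
    also have "\<dots> \<longleftrightarrow> S * x < real n" by (simp add: floor_less_iff)
    finally show ?thesis using S by (simp add: field_simps)
  qed
  have PN: "measure exp1 {x. N x = n} = (1 - exp (- (1 / S))) * exp (- (1 / S) * real n)" for n
  proof (cases "n = 0")
    case True
    then have "{x. N x = n} = {..<1 / S}" using N_iff[of 1] by auto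
    then show ?thesis using True S measure_exp1_lessThan[of "1/S"] by simp
  next
    case False
    have "N x = n \<longleftrightarrow> N x < Suc n \<and> \<not> N x < n" for x by auto
    then have "{x. N x = n} = {..<real (Suc n) / S} - {..<real n / S}"
      using False by (auto simp only: N_iff)
    also have "measure exp1 \<dots> = (1 - exp (- (real (Suc n) / S))) - (1 - exp (- (real n / S)))"
      using S by (subst finite_measure_Diff) (auto simp: measure_exp1_lessThan divide_right_mono)
    also have "real (Suc n) / S = 1 / S + real n / S" by (simp add: add_divide_distrib)
    also have "exp (- (1 / S + real n / S)) = exp (- (1 / S)) * exp (- (real n / S))"
      by (simp add: exp_add[symmetric])
    finally show ?thesis by (simp add: algebra_simps)
  qed
  have "ennreal (\<integral>x. c (N x) \<partial>exp1) = (\<integral>\<^sup>+x. ennreal (c (N x)) \<partial>exp1)"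
    using i c by (intro nn_integral_eq_integral[symmetric]) (auto simp: N_def)
  also have "\<dots> = (\<integral>\<^sup>+x. (\<Sum>n. ennreal (c n) * indicator {x. N x = n} x) \<partial>exp1)"
  proof (intro nn_integral_cong)
    fix x
    have "(\<Sum>n. ennreal (c n) * indicator {x. N x = n} x) = (\<Sum>n\<in>{N x}. ennreal (c n) * indicator {x. N x = n} x)"
      by (intro suminf_finite) auto
    then show "ennreal (c (N x)) = (\<Sum>n. ennreal (c n) * indicator {x. N x = n} x)" by simp
  qed
  also have "\<dots> = (\<Sum>n. (\<integral>\<^sup>+x. ennreal (c n) * indicator {x. N x = n} x \<partial>exp1))"
    by (intro nn_integral_suminf) (auto intro!: borel_measurable_times_ennreal simp: measurable_sets)
  also have "\<dots> = (\<Sum>n. ennreal (p n))"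
  proof (intro suminf_cong)
    fix n
    have m: "{x. N x = n} \<in> sets exp1" using measurable_sets[OF \<open>N \<in> measurable exp1 (count_space UNIV)\<close>, of "{n}"]
      by (simp add: vimage_def)
    then show "(\<integral>\<^sup>+x. ennreal (c n) * indicator {x. N x = n} x \<partial>exp1) = ennreal (p n)"
      using c by (subst nn_integral_cmult_indicator) (auto simp: emeasure_eq_measure PN p_def ennreal_mult'[symmetric] mult_ac)
  qed
  finally have *: "ennreal (\<integral>x. c (N x) \<partial>exp1) = (\<Sum>n. ennreal (p n))" .
  have sm: "summable p" using p0 by (rule summable_suminf_not_top) (simp add: *[symmetric])
  have "(\<Sum>n. p n) = (\<integral>x. c (N x) \<partial>exp1)"
    using * p0 c sm by (subst (asm) suminf_ennreal2) (auto simp: suminf_nonneg)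
  then have "p sums (\<integral>x. c (N x) \<partial>exp1)" using sm by (simp add: sums_iff)
  then show ?thesis unfolding p_def[abs_def] N_def .
qed

lemma dyadic_above:
  fixes x :: real assumes "1 \<le> x" shows "\<exists>k. x \<le> 2 ^ k \<and> 2 ^ k \<le> 2 * x"
proof -
  obtain k0 where "x < 2 ^ k0" using real_arch_pow[of 2 x] by auto
  then have ex: "\<exists>k. x \<le> 2 ^ k" by (auto intro: less_imp_le)
  define k where "k = (LEAST k. x \<le> 2 ^ k)"
  have k: "x \<le> 2 ^ k" unfolding k_def using ex by (rule LeastI_ex)
  show ?thesis
  proof (cases k)
    case 0
    then show ?thesis using assms k by (intro exI[of _ 0]) simp
  next
    case (Suc j)
    then have "\<not> x \<le> 2 ^ j" using not_less_Least[of j "\<lambda>k. x \<le> 2 ^ k"] by (simp add: k_def)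
    then show ?thesis using k Suc by (intro exI[of _ k]) auto
  qed
qed

section \<open>The Abelian theorem and the generalized inverse for monotone sequences\<close>

locale regular_growth =
  fixes c :: "nat \<Rightarrow> real" and \<alpha> :: real
  assumes c_mono: "mono c" and c_nonneg: "\<And>n. 0 \<le> c n" and c_top: "filterlim c at_top sequentially"
    and \<alpha>: "0 < \<alpha>" "\<alpha> \<le> 1"
    and c_rv: "regularly_varying c \<alpha>"
begin

lemma step_c_mono: "s \<le> t \<Longrightarrow> step_ext c s \<le> step_ext c t"
  unfolding step_ext_def by (intro monoD[OF c_mono] nat_mono floor_mono)

lemma step_c_nonneg: "0 \<le> step_ext c s" by (simp add: step_ext_def c_nonneg)

lemma step_c_top: "filterlim (step_ext c) at_top at_top"
proof -
  have "filterlim (\<lambda>s::real. nat \<lfloor>s\<rfloor>) sequentially at_top"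
    by (intro filterlim_compose[OF filterlim_nat_sequentially filterlim_floor_sequentially])
  from filterlim_compose[OF c_top this] show ?thesis by (simp add: step_ext_def[abs_def])
qed

lemma doubling: "\<forall>\<^sub>F s in at_top. step_ext c (2 * s) \<le> 4 * step_ext c s"
proof -
  have "((\<lambda>s. step_ext c (2 * s) / step_ext c s) \<longlongrightarrow> 2 powr \<alpha>) at_top"
    using c_rv by (simp add: regularly_varying_def)
  \<comment> \<open>The constant 4 is chosen because its \<open>k\<close>-th power is
    \<open>(2 ^ k)\<^sup>2\<close>, which turns into the quadratic bound of the next lemma.\<close>
  moreover have "2 powr \<alpha> < (4::real)"
    using \<alpha> powr_mono[of \<alpha> 1 2] by simp
  ultimately have "\<forall>\<^sub>F s in at_top. step_ext c (2 * s) / step_ext c s < 4"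
    by (rule order_tendstoD)
  moreover have "\<forall>\<^sub>F s in at_top. 0 < step_ext c s" using step_c_top by (simp add: filterlim_at_top_dense)
  ultimately show ?thesis by eventually_elim (simp add: field_simps)
qed

text \<open>A crude Potter bound, obtained by iterating the doubling estimate up to a power of 2
  between \<open>x\<close> and \<open>2 * x\<close>. The factor \<open>1 + 4 * x\<^sup>2\<close>
  does not depend on \<open>s\<close> and is integrable for the exponential law.\<close>

lemma potter: "\<forall>\<^sub>F s in at_top. \<forall>x\<ge>0. step_ext c (s * x) \<le> (1 + 4 * x\<^sup>2) * step_ext c s"
proof -
  from doubling obtain s0 where s0: "\<And>s. s \<ge> s0 \<Longrightarrow> step_ext c (2 * s) \<le> 4 * step_ext c s"
    by (auto simp: eventually_at_top_linorder)
  show ?thesis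
    using eventually_ge_at_top[of "max s0 1"]
  proof eventually_elim
    case (elim s)
    then have s: "s \<ge> s0" "s > 0" by auto
    have pw: "step_ext c (2 ^ k * s) \<le> 4 ^ k * step_ext c s" for k
    proof (induction k)
      case (Suc k)
      have "1 * s \<le> 2 ^ k * s" using s by (intro mult_right_mono) auto
      then have "s0 \<le> 2 ^ k * s" using s by linarith
      from s0[OF this] Suc show ?case by (simp add: mult.assoc)
    qed simp
    show ?case
    proof (intro allI impI)
      fix x :: real assume x: "0 \<le> x"
      show "step_ext c (s * x) \<le> (1 + 4 * x\<^sup>2) * step_ext c s"
      proof (cases "x \<le> 1")
        case True
        have "s * x \<le> s * 1" using s True by (intro mult_left_mono) auto
        then have "step_ext c (s * x) \<le> 1 * step_ext c s" using step_c_mono by simp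
        also have "\<dots> \<le> (1 + 4 * x\<^sup>2) * step_ext c s" by (intro mult_right_mono step_c_nonneg) auto
        finally show ?thesis .
      next
        case False
        then obtain k where k: "x \<le> 2 ^ k" "2 ^ k \<le> 2 * x" using dyadic_above[of x] by auto
        have "step_ext c (s * x) \<le> step_ext c (2 ^ k * s)"
          using s k by (intro step_c_mono) (simp add: mult.commute)
        also have "\<dots> \<le> 4 ^ k * step_ext c s" by (rule pw)
        also have "(4::real) ^ k = (2 ^ k)\<^sup>2" by (simp add: power_mult[symmetric] mult.commute[of k] power_mult)
        also have "\<dots> * step_ext c s \<le> (2 * x)\<^sup>2 * step_ext c s"
          using k x by (intro mult_right_mono power_mono step_c_nonneg) auto
        also have "\<dots> \<le> (1 + 4 * x\<^sup>2) * step_ext c s" by (intro mult_right_mono step_c_nonneg) (auto simp: power_mult_distrib)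
        finally show ?thesis .
      qed
    qed
  qed
qed

text \<open>The quotient is the exponential expectation of
  \<open>step_ext c (S m * x) / step_ext c (S m)\<close>. The integrand tends to
  \<open>x powr \<alpha>\<close> by regular variation, is dominated by the Potter bound, and
  \<open>x powr \<alpha>\<close> has expectation \<open>Gamma (1 + \<alpha>)\<close>.\<close>

lemma abelian:
  assumes S: "filterlim S at_top sequentially"
  shows "\<forall>\<^sub>F m in sequentially. summable (\<lambda>n. exp (- (1 / S m) * real n) * c n)"
    and "(\<lambda>m. (1 - exp (- (1 / S m))) * (\<Sum>n. exp (- (1 / S m) * real n) * c n) / step_ext c (S m)) \<longlonglongrightarrow> Gamma (1 + \<alpha>)"
proof -
  have ev1: "\<forall>\<^sub>F m in sequentially. 0 < S m" using S by (simp add: filterlim_at_top_dense)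
  have ev2: "\<forall>\<^sub>F m in sequentially. 0 < step_ext c (S m)"
    using filterlim_compose[OF step_c_top S] by (simp add: filterlim_at_top_dense)
  have ev3: "\<forall>\<^sub>F m in sequentially. \<forall>x\<ge>0. step_ext c (S m * x) \<le> (1 + 4 * x\<^sup>2) * step_ext c (S m)"
    using filterlim_iff[THEN iffD1, OF S] potter by blast
  have [measurable]: "(\<lambda>x. step_ext c (S m * x)) \<in> borel_measurable exp1" for m
    unfolding step_ext_def by measurable
  have dom: "integrable exp1 (\<lambda>x. 1 + 4 * x powr 2)"
    using exp1_powr(1)[of 2] prob_space.finite_measure[OF prob_space_exp1]
    by (intro Bochner_Integration.integrable_add) (auto simp: finite_measure.integrable_const)
  have ev4: "\<forall>\<^sub>F m in sequentially. AE x in exp1. norm (step_ext c (S m * x) / step_ext c (S m)) \<le> 1 + 4 * x powr 2"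
    using ev2 ev3
  proof eventually_elim
    case (elim m)
    show ?case using AE_exp1_pos
    proof eventually_elim
      case (elim x)
      have "step_ext c (S m * x) \<le> (1 + 4 * x powr 2) * step_ext c (S m)"
        using \<open>\<forall>x\<ge>0. _ x\<close> elim by simp
      then show ?case using step_c_nonneg \<open>0 < step_ext c (S m)\<close> by (simp add: divide_le_eq)
    qed
  qed
  have int: "\<forall>\<^sub>F m in sequentially. integrable exp1 (\<lambda>x. step_ext c (S m * x))"
    using ev2 ev4
  proof eventually_elim
    case (elim m)
    have "integrable exp1 (\<lambda>x. step_ext c (S m * x) / step_ext c (S m))"
      by (rule Bochner_Integration.integrable_bound[OF dom]) (use elim in \<open>auto elim!: eventually_mono\<close>)
    from integrable_mult_right[of "step_ext c (S m)", OF this] show ?case using elim by simp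
  qed
  have sums: "\<forall>\<^sub>F m in sequentially. (\<lambda>n. (1 - exp (- (1 / S m))) * (exp (- (1 / S m) * real n) * c n)) sums (\<integral>x. step_ext c (S m * x) \<partial>exp1)"
    using ev1 int unfolding step_ext_def by eventually_elim (rule exp1_floor_sums[OF c_nonneg])
  have ne: "(1 - exp (- (1 / S m))) \<noteq> 0" if "S m > 0" for m using that by simp
  show sm: "\<forall>\<^sub>F m in sequentially. summable (\<lambda>n. exp (- (1 / S m) * real n) * c n)"
    using ev1 sums
  proof eventually_elim
    case (elim m)
    then show ?case using ne[of m] by (auto dest!: sums_summable simp: summable_cmult_iff)
  qed
  have "(\<lambda>m. \<integral>x. step_ext c (S m * x) / step_ext c (S m) \<partial>exp1) \<longlonglongrightarrow> (\<integral>x. x powr \<alpha> \<partial>exp1)"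
  proof -
    \<comment> \<open>The domination holds from some index on, while dominated convergence wants it
      at every index; hence the shift by \<open>m0\<close>.\<close>
    obtain m0 where m0: "\<And>m. m \<ge> m0 \<Longrightarrow> AE x in exp1. norm (step_ext c (S m * x) / step_ext c (S m)) \<le> 1 + 4 * x powr 2"
      using ev4 by (auto simp: eventually_sequentially)
    have "(\<lambda>m. \<integral>x. step_ext c (S (m + m0) * x) / step_ext c (S (m + m0)) \<partial>exp1) \<longlonglongrightarrow> (\<integral>x. x powr \<alpha> \<partial>exp1)"
    proof (rule integral_dominated_convergence[where w="\<lambda>x. 1 + 4 * x powr 2"])
      show "AE x in exp1. (\<lambda>m. step_ext c (S (m + m0) * x) / step_ext c (S (m + m0))) \<longlonglongrightarrow> x powr \<alpha>"
        using AE_exp1_pos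
      proof eventually_elim
        case (elim x)
        have "((\<lambda>s. step_ext c (x * s) / step_ext c s) \<longlongrightarrow> x powr \<alpha>) at_top"
          using c_rv elim by (simp add: regularly_varying_def)
        from filterlim_compose[OF this S] have "(\<lambda>m. step_ext c (S m * x) / step_ext c (S m)) \<longlonglongrightarrow> x powr \<alpha>"
          by (simp add: mult.commute)
        then show ?case by (rule LIMSEQ_ignore_initial_segment)
      qed
      show "AE x in exp1. norm (step_ext c (S (m + m0) * x) / step_ext c (S (m + m0))) \<le> 1 + 4 * x powr 2" for m
        by (rule m0) simp
    qed (use dom in auto)
    then show ?thesis by (rule LIMSEQ_offset)
  qed
  then have lim: "(\<lambda>m. (\<integral>x. step_ext c (S m * x) \<partial>exp1) / step_ext c (S m)) \<longlonglongrightarrow> Gamma (1 + \<alpha>)"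
    using exp1_powr(2)[of \<alpha>] \<alpha> by simp
  have "\<forall>\<^sub>F m in sequentially. (\<integral>x. step_ext c (S m * x) \<partial>exp1) / step_ext c (S m)
     = (1 - exp (- (1 / S m))) * (\<Sum>n. exp (- (1 / S m) * real n) * c n) / step_ext c (S m)"
    using sums sm
  proof eventually_elim
    case (elim m)
    have "(\<integral>x. step_ext c (S m * x) \<partial>exp1) = (1 - exp (- (1 / S m))) * (\<Sum>n. exp (- (1 / S m) * real n) * c n)"
      using sums_unique2[OF elim(1) sums_mult[OF summable_sums[OF elim(2)]]] .
    then show ?case by simp
  qed
  from Lim_transform_eventually[OF lim this]
  show "(\<lambda>m. (1 - exp (- (1 / S m))) * (\<Sum>n. exp (- (1 / S m) * real n) * c n) / step_ext c (S m)) \<longlonglongrightarrow> Gamma (1 + \<alpha>)" .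
qed

text \<open>For \<open>\<eta> < 1\<close> and large \<open>m\<close> one has
  \<open>\<eta> * real m \<le> real (m - 1)\<close>, so the ratio is eventually above any number
  below \<open>\<eta> powr \<alpha>\<close>, and this tends to 1 with \<open>\<eta>\<close>. Serves
  to absorb the last jump of the generalized inverse, where
  \<open>a (m - 1) \<le> y < a m\<close>.\<close>

lemma pred_ratio: "(\<lambda>m. c (m - 1) / c m) \<longlonglongrightarrow> 1"
proof (rule order_tendstoI)
  have pos: "\<forall>\<^sub>F m in sequentially. 0 < c m" using c_top by (simp add: filterlim_at_top_dense)
  fix y :: real
  {
    assume y: "y < 1"
    have "((\<lambda>\<eta>::real. \<eta> powr \<alpha>) \<longlongrightarrow> 1 powr \<alpha>) (at_left 1)" by (intro tendsto_intros) auto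
    then have "\<forall>\<^sub>F \<eta> in at_left (1::real). y < \<eta> powr \<alpha>" using y by (intro order_tendstoD) auto
    moreover have "\<forall>\<^sub>F \<eta> in at_left (1::real). \<eta> \<in> {0<..<1}" by (rule eventually_at_leftI[of 0]) auto
    ultimately have "\<forall>\<^sub>F \<eta> in at_left (1::real). y < \<eta> powr \<alpha> \<and> \<eta> \<in> {0<..<1}" by eventually_elim auto
    then obtain \<eta> where \<eta>: "y < \<eta> powr \<alpha>" "0 < \<eta>" "\<eta> < 1"
      using eventually_happens[of _ "at_left (1::real)"] by (auto simp: trivial_limit_at_left_real)
    have "((\<lambda>s. step_ext c (\<eta> * s) / step_ext c s) \<longlongrightarrow> \<eta> powr \<alpha>) at_top"
      using c_rv \<eta> by (simp add: regularly_varying_def)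
    from filterlim_compose[OF this filterlim_real_sequentially]
    have "\<forall>\<^sub>F m in sequentially. y < step_ext c (\<eta> * real m) / step_ext c (real m)"
      using \<eta> by (intro order_tendstoD) auto
    moreover have "\<forall>\<^sub>F m in sequentially. real m \<ge> 1 / (1 - \<eta>)"
      using filterlim_real_sequentially by (auto simp: filterlim_at_top)
    ultimately show "\<forall>\<^sub>F m in sequentially. y < c (m - 1) / c m"
      using pos
    proof eventually_elim
      case (elim m)
      have "1 \<le> real m * (1 - \<eta>)" using elim(2) \<eta> by (simp add: field_simps)
      then have "\<eta> * real m \<le> real m - 1" by (simp add: algebra_simps)
      moreover have "1 \<le> m" using \<open>1 \<le> real m * (1 - \<eta>)\<close> by (cases m) auto
      ultimately have "\<eta> * real m \<le> real (m - 1)" by (simp add: of_nat_diff)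
      from step_c_mono[OF this] have "step_ext c (\<eta> * real m) \<le> c (m - 1)" by (simp add: step_ext_def)
      then have "step_ext c (\<eta> * real m) / c m \<le> c (m - 1) / c m" using elim(3) by (intro divide_right_mono) auto
      with elim(1) show ?case by (simp add: step_ext_def)
    qed
  }
  assume y: "1 < y"
  show "\<forall>\<^sub>F m in sequentially. c (m - 1) / c m < y"
    using pos
  proof eventually_elim
    case (elim m)
    have "c (m - 1) \<le> c m" by (intro monoD[OF c_mono]) auto
    then have "c (m - 1) / c m \<le> 1" using elim by simp
    then show ?case using y by simp
  qed
qed

end

text \<open>A step function changes its value only at integers, so the infimum is attained, at the
  least index where the sequence exceeds \<open>y\<close>.\<close>

lemma left_inverse_eq:
  assumes "\<exists>m. y < a m" shows "left_inverse a y = real (LEAST m. y < a m)"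
  unfolding left_inverse_def
proof (rule cInf_eq_minimum)
  show "real (LEAST m. y < a m) \<in> {s. 0 \<le> s \<and> y < step_ext a s}"
    using LeastI_ex[OF assms] by (simp add: step_ext_def)
  fix s assume s: "s \<in> {s. 0 \<le> s \<and> y < step_ext a s}"
  then have "(LEAST m. y < a m) \<le> nat \<lfloor>s\<rfloor>" by (intro Least_le) (auto simp: step_ext_def)
  then have "real (LEAST m. y < a m) \<le> real (nat \<lfloor>s\<rfloor>)" by simp
  also have "\<dots> \<le> s" using s by (intro of_nat_floor) simp
  finally show "real (LEAST m. y < a m) \<le> s" .
qed

context regular_growth
begin

text \<open>With \<open>m n\<close> the least index at which \<open>a\<close> exceeds
  \<open>1 / b n\<close>, the quantity \<open>1 / (b n * a (m n))\<close> lies between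
  \<open>a (m n - 1) / a (m n)\<close> and 1. As \<open>a\<close> may oscillate, its predecessor
  ratio is taken from that of \<open>c\<close> through \<open>ac\<close>.\<close>

lemma scaling_limits:
  assumes ac: "(\<lambda>n. a n / c n) \<longlonglongrightarrow> 1" and b: "\<And>n. 0 < b n" "b \<longlonglongrightarrow> 0"
  shows "filterlim (\<lambda>n. left_inverse a (1 / b n)) at_top sequentially"
    and "(\<lambda>n. b n * step_ext c (left_inverse a (1 / b n))) \<longlonglongrightarrow> 1"
proof -
  have pos: "\<forall>\<^sub>F m in sequentially. 0 < c m" using c_top by (simp add: filterlim_at_top_dense)
  have ca: "(\<lambda>n. c n / a n) \<longlonglongrightarrow> 1" using tendsto_inverse[OF ac] by simp
  have "\<forall>\<^sub>F m in sequentially. a m / c m > 1/2" using ac by (intro order_tendstoD) auto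
  with pos have ev: "\<forall>\<^sub>F m in sequentially. a m \<ge> 1/2 * c m" by eventually_elim (simp add: field_simps)
  have "filterlim (\<lambda>m. 1/2 * c m) at_top sequentially"
    by (rule filterlim_tendsto_pos_mult_at_top[OF tendsto_const _ c_top]) simp
  then have atop: "filterlim a at_top sequentially" by (rule filterlim_at_top_mono) (rule ev)
  have apos: "\<forall>\<^sub>F m in sequentially. 0 < a m" using atop by (simp add: filterlim_at_top_dense)
  have ex: "\<exists>m. y < a m" for y using atop by (auto simp: filterlim_at_top_dense eventually_sequentially)
  define m where "m n = (LEAST m. 1 / b n < a m)" for n
  have m1: "1 / b n < a (m n)" for n unfolding m_def using ex by (rule LeastI_ex)
  have m2: "a k \<le> 1 / b n" if "k < m n" for k n using not_less_Least[of k "\<lambda>m. 1 / b n < a m"] that by (auto simp: m_def)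
  have li: "left_inverse a (1 / b n) = real (m n)" for n unfolding m_def by (rule left_inverse_eq[OF ex])
  have binf: "filterlim (\<lambda>n. 1 / b n) at_top sequentially"
    using filterlim_inverse_at_top[OF b(2)] b(1) by (simp add: inverse_eq_divide)
  have mtop: "filterlim m sequentially sequentially"
    unfolding filterlim_at_top
  proof
    fix K
    have "\<forall>\<^sub>F n in sequentially. 1 / b n \<ge> Max (a ` {..K})" using binf unfolding filterlim_at_top by blast
    then show "\<forall>\<^sub>F n in sequentially. K \<le> m n"
    proof eventually_elim
      case (elim n)
      show ?case
      proof (rule ccontr)
        assume "\<not> ?thesis"
        then have "a (m n) \<le> Max (a ` {..K})" by (intro Max_ge) auto
        then show False using m1[of n] elim by linarith
      qed
    qed
  qed
  show "filterlim (\<lambda>n. left_inverse a (1 / b n)) at_top sequentially"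
    unfolding li by (rule filterlim_compose[OF filterlim_real_sequentially mtop])
  have predr: "(\<lambda>m. a (m - 1) / a m) \<longlonglongrightarrow> 1"
  proof -
    have f: "filterlim (\<lambda>m::nat. m - 1) sequentially sequentially" by (rule filterlim_minus_const_nat_at_top)
    have "(\<lambda>m. (a (m - 1) / c (m - 1)) * (c (m - 1) / c m) * (c m / a m)) \<longlonglongrightarrow> 1 * 1 * 1"
      by (intro tendsto_mult pred_ratio ca filterlim_compose[OF ac f])
    moreover have "\<forall>\<^sub>F m in sequentially. (a (m - 1) / c (m - 1)) * (c (m - 1) / c m) * (c m / a m) = a (m - 1) / a m"
      using pos eventually_compose_filterlim[OF pos f] by eventually_elim simp
    ultimately show ?thesis using Lim_transform_eventually by fastforce
  qed
  have 1: "(\<lambda>n. 1 / (b n * a (m n))) \<longlonglongrightarrow> 1"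
  proof (rule tendsto_sandwich)
    have m1top: "\<forall>\<^sub>F n in sequentially. 1 \<le> m n" using mtop by (auto simp: filterlim_at_top)
    have ap: "\<forall>\<^sub>F n in sequentially. 0 < a (m n)" using eventually_compose_filterlim[OF apos mtop] .
    show "\<forall>\<^sub>F n in sequentially. a (m n - 1) / a (m n) \<le> 1 / (b n * a (m n))"
      using m1top ap
    proof eventually_elim
      case (elim n)
      then have "a (m n - 1) \<le> 1 / b n" by (intro m2) auto
      then show ?case using elim b(1)[of n] by (simp add: field_simps)
    qed
    show "\<forall>\<^sub>F n in sequentially. 1 / (b n * a (m n)) \<le> 1"
      using ap
    proof eventually_elim
      case (elim n)
      then show ?case using elim b(1)[of n] m1[of n] by (simp add: field_simps)
    qed
    show "(\<lambda>n. a (m n - 1) / a (m n)) \<longlonglongrightarrow> 1" by (rule filterlim_compose[OF predr mtop])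
  qed simp
  have "(\<lambda>n. inverse (1 / (b n * a (m n))) * (c (m n) / a (m n))) \<longlonglongrightarrow> inverse 1 * 1"
    by (intro tendsto_mult tendsto_inverse 1 filterlim_compose[OF ca mtop]) simp
  moreover have "\<forall>\<^sub>F n in sequentially. inverse (1 / (b n * a (m n))) * (c (m n) / a (m n)) = b n * step_ext c (left_inverse a (1 / b n))"
    using eventually_compose_filterlim[OF apos mtop] by eventually_elim (simp add: li step_ext_def)
  ultimately show "(\<lambda>n. b n * step_ext c (left_inverse a (1 / b n))) \<longlonglongrightarrow> 1"
    using Lim_transform_eventually by fastforce
qed

text \<open>The Abelian theorem is applied along \<open>(1 / s) * left_inverse a (1 / b n)\<close>,
  whose reciprocal is \<open>s * scaling a (b n)\<close>. Regular variation then trades the factor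
  \<open>1 / s\<close> inside \<open>step_ext c\<close> for
  \<open>(1 / s) powr \<alpha>\<close>.\<close>

lemma laplace_scaling:
  assumes ac: "(\<lambda>n. a n / c n) \<longlonglongrightarrow> 1" and b: "\<And>n. 0 < b n" "b \<longlonglongrightarrow> 0" and s: "0 < s"
  shows "\<forall>\<^sub>F n in sequentially. 0 < scaling a (b n)"
    and "(\<lambda>n. scaling a (b n)) \<longlonglongrightarrow> 0"
    and "\<forall>\<^sub>F n in sequentially. summable (\<lambda>k. exp (- (s * scaling a (b n)) * real k) * c k)"
    and "(\<lambda>n. b n * ((1 - exp (- (s * scaling a (b n)))) * (\<Sum>k. exp (- (s * scaling a (b n)) * real k) * c k)))
      \<longlonglongrightarrow> Gamma (1 + \<alpha>) / s powr \<alpha>"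
proof -
  let ?S = "\<lambda>n. left_inverse a (1 / b n)"
  note top = scaling_limits(1)[OF ac b] and lim = scaling_limits(2)[OF ac b]
  have ev: "\<forall>\<^sub>F n in sequentially. 0 < ?S n" using top by (simp add: filterlim_at_top_dense)
  then show "\<forall>\<^sub>F n in sequentially. 0 < scaling a (b n)" by (auto simp: scaling_def)
  show "(\<lambda>n. scaling a (b n)) \<longlonglongrightarrow> 0"
    unfolding scaling_def using top by (rule tendsto_divide_0[OF tendsto_const filterlim_at_top_imp_at_infinity])
  have top': "filterlim (\<lambda>n. (1 / s) * ?S n) at_top sequentially"
    using s by (intro filterlim_tendsto_pos_mult_at_top[OF tendsto_const _ top]) auto
  have e: "1 / ((1 / s) * ?S n) = s * scaling a (b n)" for n by (simp add: scaling_def)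
  note ab = abelian[OF top', unfolded e]
  show "\<forall>\<^sub>F n in sequentially. summable (\<lambda>k. exp (- (s * scaling a (b n)) * real k) * c k)" by (rule ab(1))
  have "((\<lambda>t. step_ext c (1 / s * t) / step_ext c t) \<longlongrightarrow> (1 / s) powr \<alpha>) at_top"
    using c_rv[unfolded regularly_varying_def, rule_format, of "1 / s"] s by simp
  from tendsto_mult[OF tendsto_mult[OF ab(2) filterlim_compose[OF this top]] lim]
  have "(\<lambda>n. (1 - exp (- (s * scaling a (b n)))) * (\<Sum>k. exp (- (s * scaling a (b n)) * real k) * c k) / step_ext c (1 / s * ?S n)
    * (step_ext c (1 / s * ?S n) / step_ext c (?S n)) * (b n * step_ext c (?S n))) \<longlonglongrightarrow> Gamma (1 + \<alpha>) * (1 / s) powr \<alpha> * 1" .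
  moreover have "\<forall>\<^sub>F n in sequentially. 0 < step_ext c (?S n)" "\<forall>\<^sub>F n in sequentially. 0 < step_ext c (1 / s * ?S n)"
    using filterlim_compose[OF step_c_top top] filterlim_compose[OF step_c_top top'] by (simp_all add: filterlim_at_top_dense)
  then have "\<forall>\<^sub>F n in sequentially. (1 - exp (- (s * scaling a (b n)))) * (\<Sum>k. exp (- (s * scaling a (b n)) * real k) * c k) / step_ext c (1 / s * ?S n)
    * (step_ext c (1 / s * ?S n) / step_ext c (?S n)) * (b n * step_ext c (?S n))
    = b n * ((1 - exp (- (s * scaling a (b n)))) * (\<Sum>k. exp (- (s * scaling a (b n)) * real k) * c k))"
    by eventually_elim (simp add: mult_ac)
  ultimately have "(\<lambda>n. b n * ((1 - exp (- (s * scaling a (b n)))) * (\<Sum>k. exp (- (s * scaling a (b n)) * real k) * c k)))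
      \<longlonglongrightarrow> Gamma (1 + \<alpha>) * (1 / s) powr \<alpha> * 1" by (rule Lim_transform_eventually)
  then show "(\<lambda>n. b n * ((1 - exp (- (s * scaling a (b n)))) * (\<Sum>k. exp (- (s * scaling a (b n)) * real k) * c k)))
      \<longlonglongrightarrow> Gamma (1 + \<alpha>) / s powr \<alpha>" using s by (simp add: powr_divide)
qed

end

text \<open>Carries regular variation over from the given sequence \<open>a\<close> to the monotone
  sequence \<open>c\<close> that replaces it.\<close>

lemma regularly_varying_equiv:
  assumes ac: "(\<lambda>n. a n / c n) \<longlonglongrightarrow> 1" and a: "regularly_varying a \<alpha>" and c: "\<forall>\<^sub>F n in sequentially. c n \<noteq> 0"
  shows "regularly_varying c \<alpha>"
  unfolding regularly_varying_def
proof (intro allI impI)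
  fix l :: real assume l: "0 < l"
  have fl: "filterlim (\<lambda>s::real. nat \<lfloor>s\<rfloor>) sequentially at_top"
    by (intro filterlim_compose[OF filterlim_nat_sequentially filterlim_floor_sequentially])
  have fll: "filterlim (\<lambda>s::real. l * s) at_top at_top"
    using l by (intro filterlim_tendsto_pos_mult_at_top[OF tendsto_const _ filterlim_ident])
  have ac': "((\<lambda>s. step_ext a s / step_ext c s) \<longlongrightarrow> 1) at_top"
    using filterlim_compose[OF ac fl] by (simp add: step_ext_def)
  have ca': "((\<lambda>s. inverse (step_ext a (l * s) / step_ext c (l * s))) \<longlongrightarrow> inverse 1) at_top"
    by (intro tendsto_inverse filterlim_compose[OF ac' fll]) simp
  have lim: "((\<lambda>s. inverse (step_ext a (l * s) / step_ext c (l * s)) * (step_ext a (l * s) / step_ext a s) * (step_ext a s / step_ext c s))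
      \<longlongrightarrow> inverse 1 * l powr \<alpha> * 1) at_top"
    using a l by (intro tendsto_mult ca' ac') (auto simp: regularly_varying_def)
  have "\<forall>\<^sub>F n in sequentially. a n / c n > 1/2" using ac by (intro order_tendstoD) auto
  with c have an: "\<forall>\<^sub>F n in sequentially. a n \<noteq> 0 \<and> c n \<noteq> 0" by eventually_elim auto
  have an': "\<forall>\<^sub>F s in at_top. step_ext a s \<noteq> 0 \<and> step_ext c s \<noteq> 0"
    unfolding step_ext_def by (rule eventually_compose_filterlim[OF an fl])
  have "\<forall>\<^sub>F s in at_top. inverse (step_ext a (l * s) / step_ext c (l * s)) * (step_ext a (l * s) / step_ext a s) * (step_ext a s / step_ext c s)
     = step_ext c (l * s) / step_ext c s"
    using an' eventually_compose_filterlim[OF an' fll] by eventually_elim (auto simp: field_simps)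
  from Lim_transform_eventually[OF lim this]
  show "((\<lambda>s. step_ext c (l * s) / step_ext c s) \<longlongrightarrow> l powr \<alpha>) at_top" by simp
qed

section \<open>Coding point configurations by sequences\<close>

text \<open>Where \<open>t\<close> takes negative values it is not a measurable map into
  \<open>nonneg_borel\<close>, and renewal sequences are nonnegative only almost surely, so
  \<open>emeasure_distr\<close> does not apply. The set function in the definition of
  \<open>distr\<close> is nevertheless countably additive, and points outside the half-line are
  simply not counted.\<close>

lemma emeasure_dirac_sum:
  assumes "A \<in> sets nonneg_borel"
  shows "emeasure (dirac_sum I t) A = emeasure (count_space I) {i \<in> I. t i \<in> A}"
proof -
  have eq: "t -` B \<inter> I = {i \<in> I. t i \<in> B}" for B by auto
  show ?thesis
  proof (rule emeasure_measure_of[OF _ _ _ _ assms[folded sets_distr[of "count_space I" nonneg_borel t], folded dirac_sum_def], THEN trans])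
    show "dirac_sum I t = measure_of (space nonneg_borel) (sets nonneg_borel)
        (\<lambda>A. emeasure (count_space I) (t -` A \<inter> space (count_space I)))"
      by (simp add: dirac_sum_def distr_def)
    show "sets nonneg_borel \<subseteq> Pow (space nonneg_borel)" by (rule sets.space_closed)
    show "positive (sets (dirac_sum I t)) (\<lambda>A. emeasure (count_space I) (t -` A \<inter> space (count_space I)))"
      by (simp add: positive_def)
    show "countably_additive (sets (dirac_sum I t)) (\<lambda>A. emeasure (count_space I) (t -` A \<inter> space (count_space I)))"
      unfolding countably_additive_def
    proof (intro allI impI)
      fix A :: "nat \<Rightarrow> real set" assume "disjoint_family A"
      then have "disjoint_family (\<lambda>n. t -` A n \<inter> I)" by (fastforce simp: disjoint_family_on_def)
      then have "(\<Sum>n. emeasure (count_space I) (t -` A n \<inter> I)) = emeasure (count_space I) (\<Union>n. t -` A n \<inter> I)"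
        by (intro suminf_emeasure) auto
      then show "(\<Sum>n. emeasure (count_space I) (t -` A n \<inter> space (count_space I)))
          = emeasure (count_space I) (t -` (\<Union>n. A n) \<inter> space (count_space I))"
        by (simp add: vimage_UN)
    qed
  qed (simp add: eq)
qed

lemma sets_dirac_sum [simp]: "sets (dirac_sum I t) = sets nonneg_borel"
  by (simp add: dirac_sum_def)

lemma dirac_sum_point_configsI:
  assumes "\<And>b. 0 \<le> b \<Longrightarrow> finite {i \<in> I. 0 \<le> t i \<and> t i \<le> b}"
  shows "dirac_sum I t \<in> point_configs"
  unfolding point_configs_def
proof (intro CollectI conjI ballI impI)
  fix A assume A: "A \<in> sets nonneg_borel"
  show "emeasure (dirac_sum I t) A \<in> range ennreal_of_enat"
    unfolding emeasure_dirac_sum[OF A]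
    by (cases "finite {i \<in> I. t i \<in> A}")
       (auto simp: emeasure_count_space intro: image_eqI[of _ _ "enat (card {i \<in> I. t i \<in> A})"] image_eqI[of _ _ "\<infinity>"])
  assume "bounded A"
  then obtain b where b: "\<And>x. x \<in> A \<Longrightarrow> \<bar>x\<bar> \<le> b" by (auto simp: bounded_iff)
  have "A \<subseteq> {0..}" using sets.sets_into_space[OF A] by (simp add: space_restrict_space)
  then have "{i \<in> I. t i \<in> A} \<subseteq> {i \<in> I. 0 \<le> t i \<and> t i \<le> max b 0}" using b by fastforce
  then have "finite {i \<in> I. t i \<in> A}" using assms[of "max b 0"] finite_subset by auto
  then show "emeasure (dirac_sum I t) A < \<infinity>"
    unfolding emeasure_dirac_sum[OF A] by (subst emeasure_count_space) (auto simp: of_nat_less_top)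
qed simp

lemma sets_nonneg_borel_Icc: "{0..t} \<in> sets nonneg_borel"
  by (auto simp: sets_restrict_space_iff)

lemma point_configs_Icc_finite:
  assumes "N \<in> point_configs" shows "emeasure N {0..t} < \<infinity>"
proof -
  have "bounded {0..t}" by (rule bounded_closed_interval)
  then show ?thesis using assms sets_nonneg_borel_Icc unfolding point_configs_def by blast
qed

text \<open>Turns bounded finiteness into a countable condition on counting functions, which makes
  \<open>config\<close> measurable.\<close>

lemma dirac_sum_point_configs_iff:
  "dirac_sum UNIV t \<in> point_configs \<longleftrightarrow> (\<forall>m::nat. emeasure (dirac_sum UNIV t) {0..real m} < \<infinity>)"
proof
  assume "dirac_sum UNIV t \<in> point_configs"
  then show "\<forall>m::nat. emeasure (dirac_sum UNIV t) {0..real m} < \<infinity>"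
    using point_configs_Icc_finite by blast
next
  assume *: "\<forall>m::nat. emeasure (dirac_sum UNIV t) {0..real m} < \<infinity>"
  show "dirac_sum UNIV t \<in> point_configs"
  proof (rule dirac_sum_point_configsI)
    fix b :: real
    obtain m :: nat where m: "b \<le> real m" using real_arch_simple by blast
    have "finite {i. t i \<in> {0..real m}}"
      using *[rule_format, of m] unfolding emeasure_dirac_sum[OF sets_nonneg_borel_Icc]
      by (subst (asm) emeasure_count_space) (auto split: if_splits)
    then show "finite {i \<in> UNIV. 0 \<le> t i \<and> t i \<le> b}" by (rule rev_finite_subset) (use m in auto)
  qed
qed

text \<open>Convergence to 0 expresses that the points do not accumulate, so that the coded measure
  is boundedly finite. This is not a closed condition in the cube.\<close>

definition decr_seqs :: "(nat \<Rightarrow> real) set" where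
  "decr_seqs = {z. (\<forall>k. 0 \<le> z k \<and> z k \<le> 1) \<and> decseq z \<and> z \<longlonglongrightarrow> 0}"

text \<open>
  A configuration with points \<open>t\<^sub>0 \<le> t\<^sub>1 \<le> \<dots>\<close> is coded by \<open>z\<^sub>k = exp (- t\<^sub>k)\<close>, missing points
  (at infinity) being coded by 0. This makes the coding space a subset of a compact one.
\<close>

definition decode :: "(nat \<Rightarrow> real) \<Rightarrow> real measure" where
  "decode z = dirac_sum {k. 0 < z k} (\<lambda>k. - ln (z k))"

lemma minus_ln_le_iff: "0 < x \<Longrightarrow> - ln x \<le> b \<longleftrightarrow> exp (- b) \<le> (x::real)"
  by (metis exp_le_cancel_iff exp_ln minus_le_iff)

lemma decode_point_configs:
  assumes "z \<in> decr_seqs" shows "decode z \<in> point_configs"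
  unfolding decode_def
proof (rule dirac_sum_point_configsI)
  fix b :: real
  have "z \<longlonglongrightarrow> 0" using assms by (simp add: decr_seqs_def)
  then have "\<forall>\<^sub>F k in sequentially. z k < exp (- b)" by (rule order_tendstoD) simp
  then obtain k0 where "\<And>k. k \<ge> k0 \<Longrightarrow> z k < exp (- b)" by (auto simp: eventually_sequentially)
  then have "{k \<in> {k. 0 < z k}. 0 \<le> - ln (z k) \<and> - ln (z k) \<le> b} \<subseteq> {..<k0}"
    by (auto simp: minus_ln_le_iff not_less) (meson not_le leI)
  then show "finite {k \<in> {k. 0 < z k}. 0 \<le> - ln (z k) \<and> - ln (z k) \<le> b}" by (rule finite_subset) simp
qed

text \<open>A test function vanishing beyond \<open>b\<close> sees only points with
  \<open>z k \<ge> exp (- b)\<close>, and by monotonicity these have index below \<open>k0\<close>.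
  Cutting off at \<open>exp (- b - 1)\<close> keeps the argument of \<open>ln\<close> away from 0,
  so that each summand is continuous in \<open>z k\<close>; the extra 1 puts the cut-off points at
  \<open>b + 1\<close>, where \<open>f\<close> vanishes.\<close>

lemma integral_decode:
  fixes f :: "real \<Rightarrow> real"
  assumes z: "z \<in> decr_seqs" and f: "continuous_on {0..} f" "\<And>x. x > b \<Longrightarrow> f x = 0" and b: "0 \<le> b"
    and k0: "z k0 < exp (- b - 1)"
  shows "(\<integral>x. f x \<partial>decode z) = (\<Sum>k<k0. f (- ln (max (z k) (exp (- b - 1)))))"
proof -
  let ?I = "{k. 0 < z k}"
  have z1: "0 \<le> z k" "z k \<le> 1" for k using z by (auto simp: decr_seqs_def)
  have zd: "z k \<le> z k0" if "k0 \<le> k" for k using z that by (auto simp: decr_seqs_def decseq_def)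
  have f0: "f (- ln (z k)) = 0" if "0 < z k" "z k \<le> exp (- b - 1)" for k
  proof (rule f(2))
    have "ln (z k) \<le> ln (exp (- b - 1))" using that by (subst ln_le_cancel_iff) auto
    then show "b < - ln (z k)" by simp
  qed
  have f1: "f (- ln (max (z k) (exp (- b - 1)))) = (if 0 < z k then f (- ln (z k)) else 0)" for k
    using f0[of k] f(2)[of "b + 1"] z1[of k] by (auto simp: max_def not_le add.commute)
  have "(\<lambda>k. - ln (z k)) \<in> measurable (count_space ?I) nonneg_borel"
    using z1 by (auto simp: space_restrict_space)
  moreover have "f \<in> borel_measurable nonneg_borel" by (rule borel_measurable_continuous_on_restrict[OF f(1)])
  ultimately have "(\<integral>x. f x \<partial>decode z) = (\<integral>k. f (- ln (z k)) \<partial>count_space ?I)"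
    unfolding decode_def dirac_sum_def by (rule integral_distr)
  also have "\<dots> = (\<Sum>k | k \<in> ?I \<and> f (- ln (z k)) \<noteq> 0. f (- ln (z k)))"
    and "{k. k \<in> ?I \<and> f (- ln (z k)) \<noteq> 0} \<subseteq> {..<k0}"
  proof -
    show sub: "{k. k \<in> ?I \<and> f (- ln (z k)) \<noteq> 0} \<subseteq> {..<k0}"
    proof
      fix k assume k: "k \<in> {k. k \<in> ?I \<and> f (- ln (z k)) \<noteq> 0}"
      then have "\<not> z k \<le> exp (- b - 1)" using f0[of k] by auto
      then show "k \<in> {..<k0}" using zd[of k] k0 by (force simp: not_less)
    qed
    show "(\<integral>k. f (- ln (z k)) \<partial>count_space ?I) = (\<Sum>k | k \<in> ?I \<and> f (- ln (z k)) \<noteq> 0. f (- ln (z k)))"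
      by (rule lebesgue_integral_count_space_finite_support, rule finite_subset[OF sub]) simp
  qed
  note this(1)
  also have "(\<Sum>k | k \<in> ?I \<and> f (- ln (z k)) \<noteq> 0. f (- ln (z k))) = (\<Sum>k<k0. f (- ln (max (z k) (exp (- b - 1)))))"
    using \<open>{k. k \<in> ?I \<and> f (- ln (z k)) \<noteq> 0} \<subseteq> {..<k0}\<close>
    by (intro sum.mono_neutral_cong_left) (auto simp: f1)
  finally show ?thesis .
qed

text \<open>The condition \<open>z k0 < exp (- b - 1)\<close> is open, so near a given code the same
  \<open>k0\<close> works and the integral is one and the same finite sum of continuous functions of
  coordinates.\<close>

lemma continuous_on_integral_decode:
  assumes f: "f \<in> vague_test"
  shows "continuous_on decr_seqs (\<lambda>z. \<integral>x. f x \<partial>decode z)"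
proof -
  obtain b0 where fc: "continuous_on {0..} f" and b0: "\<And>x. x > b0 \<Longrightarrow> f x = 0"
    using f by (auto simp: vague_test_def)
  define b where "b = max b0 0"
  have b: "0 \<le> b" "\<And>x. x > b \<Longrightarrow> f x = 0" using b0 by (auto simp: b_def)
  let ?F = "\<lambda>k z. f (- ln (max (z k) (exp (- b - 1))))"
  have Fc: "continuous_on decr_seqs (?F k)" for k
  proof (rule continuous_on_compose2[OF fc])
    show "continuous_on decr_seqs (\<lambda>z. - ln (max (z k) (exp (- b - 1))))"
      by (intro continuous_intros continuous_on_product_coordinates[THEN continuous_on_subset])
         (auto simp: max_def)
    show "(\<lambda>z. - ln (max (z k) (exp (- b - 1)))) ` decr_seqs \<subseteq> {0..}"
    proof (rule image_subsetI)
      fix z :: "nat \<Rightarrow> real" assume "z \<in> decr_seqs"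
      then have "max (z k) (exp (- b - 1)) \<le> 1" using b by (auto simp: decr_seqs_def)
      then have "ln (max (z k) (exp (- b - 1))) \<le> 0" by (subst ln_le_zero_iff) (auto simp: less_max_iff_disj)
      then show "- ln (max (z k) (exp (- b - 1))) \<in> {0..}" by simp
    qed
  qed
  show ?thesis
    unfolding continuous_on_def
  proof
    fix z assume z: "z \<in> decr_seqs"
    then have "z \<longlonglongrightarrow> 0" by (simp add: decr_seqs_def)
    then have "\<forall>\<^sub>F k in sequentially. z k < exp (- b - 1)" by (rule order_tendstoD) simp
    then obtain k0 where k0: "z k0 < exp (- b - 1)" by (auto simp: eventually_sequentially)
    have "continuous_on decr_seqs (\<lambda>z. \<Sum>k<k0. ?F k z)" by (intro continuous_on_sum Fc)
    then have "((\<lambda>z. \<Sum>k<k0. ?F k z) \<longlongrightarrow> (\<Sum>k<k0. ?F k z)) (at z within decr_seqs)"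
      using z by (simp add: continuous_on_def)
    moreover have "((\<lambda>z. z k0) \<longlongrightarrow> z k0) (at z within decr_seqs)"
      using z continuous_on_subset[OF continuous_on_product_coordinates[of k0], of decr_seqs]
      by (auto simp: continuous_on_def)
    then have "\<forall>\<^sub>F z in at z within decr_seqs. z k0 < exp (- b - 1)" using k0 by (rule order_tendstoD)
    then have "\<forall>\<^sub>F z in at z within decr_seqs. (\<Sum>k<k0. ?F k z) = (\<integral>x. f x \<partial>decode z)"
      using eventually_at_filter[of "\<lambda>z. z \<in> decr_seqs" z decr_seqs]
      by (auto simp: eventually_at_filter integral_decode[OF _ fc b(2) b(1)] elim!: eventually_mono)
    ultimately have "((\<lambda>z. \<integral>x. f x \<partial>decode z) \<longlongrightarrow> (\<Sum>k<k0. ?F k z)) (at z within decr_seqs)"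
      by (rule Lim_transform_eventually)
    then show "((\<lambda>z. \<integral>x. f x \<partial>decode z) \<longlongrightarrow> (\<integral>x. f x \<partial>decode z)) (at z within decr_seqs)"
      using integral_decode[OF z fc b(2) b(1) k0] by simp
  qed
qed

lemma continuous_map_decode: "continuous_map (top_of_set decr_seqs) vague_topology decode"
  unfolding vague_topology_def
proof (rule continuous_on_generated_topo)
  fix U assume "U \<in> {{N \<in> point_configs. (\<integral>x. f x \<partial>N) \<in> V} | f V. f \<in> vague_test \<and> open V}"
  then obtain f V where U: "U = {N \<in> point_configs. (\<integral>x. f x \<partial>N) \<in> V}" and f: "f \<in> vague_test" and V: "open V" by auto
  have "decode -` U \<inter> topspace (top_of_set decr_seqs) = decr_seqs \<inter> (\<lambda>z. \<integral>x. f x \<partial>decode z) -` V"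
    using decode_point_configs by (auto simp: U)
  then show "openin (top_of_set decr_seqs) (decode -` U \<inter> topspace (top_of_set decr_seqs))"
    using continuous_openin_preimage_gen[OF continuous_on_integral_decode[OF f] V] by simp
next
  have "decode ` topspace (top_of_set decr_seqs) \<subseteq> point_configs" using decode_point_configs by auto
  then show "decode ` topspace (top_of_set decr_seqs) \<subseteq> \<Union> {{N \<in> point_configs. (\<integral>x. f x \<partial>N) \<in> V} | f V. f \<in> vague_test \<and> open V}"
    using topspace_vague_topology unfolding vague_topology_def topology_generated_by_topspace by simp
qed

lemma point_configs_eqI:
  assumes N: "N \<in> point_configs" and N': "N' \<in> point_configs"
    and eq: "\<And>t. 0 \<le> t \<Longrightarrow> emeasure N {0..t} = emeasure N' {0..t}"
  shows "N = N'"
proof -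
  have s: "sets N = sets nonneg_borel" "sets N' = sets nonneg_borel" using N N' by (auto simp: point_configs_def)
  have sp: "space N = {0..}" "space N' = {0..}"
    using sets_eq_imp_space_eq[OF s(1)] sets_eq_imp_space_eq[OF s(2)] by (auto simp: space_restrict_space)
  have id: "(\<lambda>x. x) \<in> measurable nonneg_borel borel" by (rule measurable_restrict_space1) simp
  then have idN: "(\<lambda>x. x) \<in> measurable N borel" "(\<lambda>x. x) \<in> measurable N' borel"
    using s by (simp_all cong: measurable_cong_sets)
  have emu: "emeasure (distr N borel (\<lambda>x. x)) {..a} = (if a < 0 then 0 else emeasure N {0..a})"
       "emeasure (distr N' borel (\<lambda>x. x)) {..a} = (if a < 0 then 0 else emeasure N' {0..a})" for a
  proof -
    have "{..a} \<inter> {0..} = (if a < 0 then {} else {0..a})" by auto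
    then show "emeasure (distr N borel (\<lambda>x. x)) {..a} = (if a < 0 then 0 else emeasure N {0..a})"
       "emeasure (distr N' borel (\<lambda>x. x)) {..a} = (if a < 0 then 0 else emeasure N' {0..a})"
      by (auto simp: emeasure_distr[OF idN(1)] emeasure_distr[OF idN(2)] sp)
  qed
  have "distr N borel (\<lambda>x. x) = distr N' borel (\<lambda>x. x)"
  proof (rule measure_eqI_generator_eq[where E="range atMost" and \<Omega>=UNIV and A="\<lambda>i::nat. {..real i}"])
    show "Int_stable (range atMost :: real set set)" by (auto simp: Int_stable_def)
    show "(\<Union>i. {..real i}) = UNIV" using real_arch_simple by auto
    show "emeasure (distr N borel (\<lambda>x. x)) {..real i} \<noteq> \<infinity>" for i
      using point_configs_Icc_finite[OF N, of "real i"] unfolding emu by (simp add: less_top[symmetric])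
    show "sets (distr N borel (\<lambda>x. x)) = sigma_sets UNIV (range atMost)"
       "sets (distr N' borel (\<lambda>x. x)) = sigma_sets UNIV (range atMost)"
      by (simp_all add: borel_eq_atMost)
  qed (auto simp: emu eq)
  then have *: "emeasure (distr N borel (\<lambda>x. x)) A = emeasure (distr N' borel (\<lambda>x. x)) A" for A by simp
  show ?thesis
  proof (rule measure_eqI)
    fix A assume "A \<in> sets N"
    then have "A \<in> sets borel" "A \<subseteq> {0..}" unfolding s by (auto simp: sets_restrict_space_iff)
    then show "emeasure N A = emeasure N' A"
      using *[of A] idN by (simp add: emeasure_distr sp Int_absorb2)
  qed (simp add: s)
qed

text \<open>
  Since every configuration has an ordered code, Borel measurability for the vague topology reduces
  to that of the counting functions on the intervals \<open>{0..t}\<close>, without second countability.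
\<close>

definition encode :: "real measure \<Rightarrow> nat \<Rightarrow> real" where
  "encode N k = Sup (insert 0 {exp (- t) | t. 0 \<le> t \<and> of_nat (Suc k) \<le> emeasure N {0..t}})"

lemma emeasure_Icc_mono:
  assumes "N \<in> point_configs" "s \<le> t" shows "emeasure N {0..s} \<le> emeasure N {0..t}"
proof (rule emeasure_mono)
  have "sets N = sets nonneg_borel" using assms by (simp add: point_configs_def)
  then show "{0..t} \<in> sets N" using sets_nonneg_borel_Icc by (simp only:)
qed (use assms in auto)

lemma bdd_encode: "bdd_above (insert 0 {exp (- t) | t::real. 0 \<le> t \<and> P t})"
  by (rule bdd_aboveI[of _ 1]) auto

lemma encode_bounds: "0 \<le> encode N k" "encode N k \<le> 1"
  unfolding encode_def by (auto intro!: cSup_upper bdd_encode cSup_least)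

text \<open>The supremum is attained: by continuity from above, fewer than \<open>Suc k\<close>
  points in \<open>{0..t}\<close> means fewer than \<open>Suc k\<close> points in a slightly longer
  interval, which keeps the supremum strictly below \<open>exp (- t)\<close>. Level sets of the code
  are thereby level sets of counting functions.\<close>

lemma encode_ge_iff:
  assumes N: "N \<in> point_configs" and t: "0 \<le> t"
  shows "exp (- t) \<le> encode N k \<longleftrightarrow> of_nat (Suc k) \<le> emeasure N {0..t}"
proof
  assume "of_nat (Suc k) \<le> emeasure N {0..t}"
  then show "exp (- t) \<le> encode N k" unfolding encode_def using t by (intro cSup_upper bdd_encode) auto
next
  assume ge: "exp (- t) \<le> encode N k"
  show "of_nat (Suc k) \<le> emeasure N {0..t}"
  proof (rule ccontr)
    assume "\<not> ?thesis"
    then have lt: "emeasure N {0..t} < of_nat (Suc k)" by simp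
    have "sets N = sets nonneg_borel" using N by (simp add: point_configs_def)
    then have s: "{0..u} \<in> sets N" for u using sets_nonneg_borel_Icc by (simp only:)
    have "(\<lambda>m. emeasure N {0..t + 1 / Suc m}) \<longlonglongrightarrow> emeasure N (\<Inter>m. {0..t + 1 / Suc m})"
    proof (rule Lim_emeasure_decseq)
      show "decseq (\<lambda>m. {0..t + 1 / Suc m})"
      proof (unfold decseq_def, intro allI impI)
        fix m n :: nat assume "m \<le> n"
        then have "1 / real (Suc n) \<le> 1 / real (Suc m)" by (intro divide_left_mono) auto
        then show "{0..t + 1 / Suc n} \<subseteq> {0..t + 1 / Suc m}" by auto
      qed
      show "emeasure N {0..t + 1 / Suc m} \<noteq> \<infinity>" for m
        using point_configs_Icc_finite[OF N, of "t + 1 / Suc m"] by (simp add: less_top[symmetric])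
    qed (use s in auto)
    also have "(\<Inter>m. {0..t + 1 / Suc m}) = {0..t}"
    proof (auto)
      fix x assume x: "\<forall>m. x \<le> t + 1 / (1 + real m)"
      have "(\<lambda>m. t + 1 / real (Suc m)) \<longlonglongrightarrow> t + 0" by (intro tendsto_intros LIMSEQ_Suc[OF lim_1_over_n])
      then show "x \<le> t" using x by (intro LIMSEQ_le_const[of _ t x]) (auto simp: add.commute)
    next
      fix x m assume "x \<le> t"
      also have "t \<le> t + 1 / (1 + real m)" by simp
      finally show "x \<le> t + 1 / (1 + real m)" .
    qed
    finally have "\<forall>\<^sub>F m in sequentially. emeasure N {0..t + 1 / Suc m} < of_nat (Suc k)"
      using lt by (rule order_tendstoD)
    then obtain m where m: "emeasure N {0..t + 1 / Suc m} < of_nat (Suc k)" by (auto simp: eventually_sequentially)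
    have "encode N k \<le> exp (- (t + 1 / Suc m))"
      unfolding encode_def
    proof (rule cSup_least)
      fix x assume "x \<in> insert 0 {exp (- t) |t. 0 \<le> t \<and> of_nat (Suc k) \<le> emeasure N {0..t}}"
      then consider "x = 0" | u where "x = exp (- u)" "of_nat (Suc k) \<le> emeasure N {0..u}" by auto
      then show "x \<le> exp (- (t + 1 / Suc m))"
      proof cases
        case 2
        then have "\<not> u \<le> t + 1 / Suc m" using emeasure_Icc_mono[OF N, of u "t + 1 / Suc m"] m by auto
        then show ?thesis using 2 by simp
      qed simp
    qed simp
    also have "\<dots> < exp (- t)" by simp
    finally show False using ge by simp
  qed
qed

lemma encode_decr_seqs:
  assumes N: "N \<in> point_configs" shows "encode N \<in> decr_seqs"
proof -
  have dec: "decseq (encode N)"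
  proof (rule decseq_SucI)
    fix k
    have le: "of_nat (Suc k) \<le> (of_nat (Suc (Suc k)) :: ennreal)" by (intro of_nat_mono) simp
    show "encode N (Suc k) \<le> encode N k"
      unfolding encode_def by (intro cSup_subset_mono bdd_encode) (auto simp del: of_nat_Suc intro: order_trans[OF le])
  qed
  have "encode N \<longlonglongrightarrow> 0"
  proof (rule order_tendstoI)
    fix e :: real assume "0 < e"
    define t where "t = max 0 (- ln e)"
    have t: "0 \<le> t" "exp (- t) \<le> e" using \<open>0 < e\<close> minus_ln_le_iff[of e t] by (auto simp: t_def)
    have "emeasure N {0..t} < \<infinity>" by (rule point_configs_Icc_finite[OF N])
    then obtain K :: nat where K: "emeasure N {0..t} < of_nat K"
      using ennreal_Ex_less_of_nat[of "emeasure N {0..t}"] by (auto simp: infinity_ennreal_def)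
    have "encode N k < e" if "k \<ge> K" for k
    proof -
      have "\<not> of_nat (Suc k) \<le> emeasure N {0..t}"
        using K that order_trans[of "of_nat K" "of_nat (Suc k)" "emeasure N {0..t}"] by (auto simp: of_nat_mono not_le[symmetric] simp del: of_nat_Suc)
      then have "encode N k < exp (- t)" using encode_ge_iff[OF N t(1), of k] by simp
      then show ?thesis using t by simp
    qed
    then show "\<forall>\<^sub>F k in sequentially. encode N k < e" using eventually_sequentially by blast
  next
    fix e :: real assume "e < 0"
    then show "\<forall>\<^sub>F k in sequentially. e < encode N k"
      by (intro always_eventually allI) (meson encode_bounds(1) less_le_trans)
  qed
  then show ?thesis using dec encode_bounds by (auto simp: decr_seqs_def)
qed

lemma emeasure_decode_Icc:
  assumes z: "z \<in> decr_seqs" and t: "0 \<le> t"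
  shows "emeasure (decode z) {0..t} = emeasure (count_space UNIV) {k. exp (- t) \<le> z k}"
proof -
  have z1: "0 \<le> z k" "z k \<le> 1" for k using z by (auto simp: decr_seqs_def)
  have "0 < z k \<and> - ln (z k) \<in> {0..t} \<longleftrightarrow> exp (- t) \<le> z k" for k
    using z1[of k] minus_ln_le_iff[of "z k" t] less_le_trans[OF exp_gt_zero[of "- t"], of "z k"] by auto
  then have "{k \<in> {k. 0 < z k}. - ln (z k) \<in> {0..t}} = {k. exp (- t) \<le> z k}" by auto
  then show ?thesis
    unfolding decode_def emeasure_dirac_sum[OF sets_nonneg_borel_Icc]
    by (simp add: emeasure_count_space less_le_trans[OF exp_gt_zero[of "- t"]] subset_eq)
qed

lemma decode_encode:
  assumes N: "N \<in> point_configs" shows "decode (encode N) = N"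
proof (rule point_configs_eqI)
  show "decode (encode N) \<in> point_configs" by (intro decode_point_configs encode_decr_seqs N)
  fix t :: real assume t: "0 \<le> t"
  have "emeasure N {0..t} \<in> range ennreal_of_enat" "emeasure N {0..t} < \<infinity>"
    using N sets_nonneg_borel_Icc point_configs_Icc_finite[OF N] by (auto simp: point_configs_def)
  then obtain e where "emeasure N {0..t} = ennreal_of_enat e" "ennreal_of_enat e < \<infinity>" by auto
  then obtain m where m: "emeasure N {0..t} = of_nat m" by (cases e) auto
  \<comment> \<open>Integrality of the counts enters here: a configuration with \<open>m\<close>
    points in \<open>{0..t}\<close> has exactly \<open>m\<close> code entries at least
    \<open>exp (- t)\<close>.\<close>
  have "{k. exp (- t) \<le> encode N k} = {..<m}"
    unfolding encode_ge_iff[OF N t] m by (auto simp: Suc_le_eq simp del: of_nat_Suc)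
  then show "emeasure (decode (encode N)) {0..t} = emeasure N {0..t}"
    using m by (simp add: emeasure_decode_Icc[OF encode_decr_seqs[OF N] t])
qed (rule N)

section \<open>Measurability into the Borel sets of the vague topology\<close>

lemma vague_opens_subset: "{U. openin vague_topology U} \<subseteq> Pow point_configs"
  using openin_subset[of vague_topology] unfolding topspace_vague_topology by auto

lemma space_vague_borel: "space vague_borel = point_configs"
  unfolding vague_borel_def by (rule space_measure_of[OF vague_opens_subset])

lemma sets_vague_borel: "sets vague_borel = sigma_sets point_configs {U. openin vague_topology U}"
  unfolding vague_borel_def by (rule sets_measure_of[OF vague_opens_subset])

text \<open>Continuity of \<open>decode\<close> makes the codes of an open set \<open>U\<close>
  relatively open, hence the trace of an open set \<open>V\<close> of the product. The preimage of
  \<open>U\<close> under \<open>c\<close> is then that of \<open>V\<close> under the code of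
  \<open>c\<close>, which is measurable because each coordinate is.\<close>

lemma measurable_vague_borelI:
  assumes c: "\<And>x. x \<in> space \<Omega> \<Longrightarrow> c x \<in> point_configs"
    and m: "\<And>t. 0 \<le> t \<Longrightarrow> (\<lambda>x. emeasure (c x) {0..t}) \<in> borel_measurable \<Omega>"
  shows "c \<in> measurable \<Omega> vague_borel"
  unfolding vague_borel_def
proof (rule measurable_measure_of)
  show "{U. openin vague_topology U} \<subseteq> Pow point_configs" by (rule vague_opens_subset)
  show "c \<in> space \<Omega> \<rightarrow> point_configs" using c by auto
  have "(\<lambda>x. encode (c x) k) \<in> borel_measurable \<Omega>" for k
    unfolding borel_measurable_iff_ge
  proof
    fix a :: real
    consider "a \<le> 0" | "a > 1" | t where "0 \<le> t" "a = exp (- t)"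
    proof (cases "a \<le> 0 \<or> a > 1")
      case False
      then have "0 \<le> - ln a" "a = exp (- (- ln a))" by auto
      then show ?thesis using that by blast
    qed (use that in auto)
    then show "{w \<in> space \<Omega>. a \<le> encode (c w) k} \<in> sets \<Omega>"
    proof cases
      case 1
      have "a \<le> encode (c w) k" for w using 1 encode_bounds(1)[of "c w" k] by linarith
      then show ?thesis by simp
    next
      case 2
      have "\<not> a \<le> encode (c w) k" for w using 2 encode_bounds(2)[of "c w" k] by linarith
      then show ?thesis by simp
    next
      case 3
      have "{w \<in> space \<Omega>. a \<le> encode (c w) k} = {w \<in> space \<Omega>. of_nat (Suc k) \<le> emeasure (c w) {0..t}}"
        using encode_ge_iff[OF c 3(1)] 3 by auto
      also have "\<dots> \<in> sets \<Omega>" using m[OF 3(1)] by measurable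
      finally show ?thesis .
    qed
  qed
  then have em: "(\<lambda>x. encode (c x)) \<in> borel_measurable \<Omega>"
    by (rule measurable_coordinatewise_then_product)
  fix U assume "U \<in> {U. openin vague_topology U}"
  then have "openin vague_topology U" by simp
  then have "openin (top_of_set decr_seqs) {z \<in> topspace (top_of_set decr_seqs). decode z \<in> U}"
    by (rule openin_continuous_map_preimage[OF continuous_map_decode])
  also have "{z \<in> topspace (top_of_set decr_seqs). decode z \<in> U} = decr_seqs \<inter> decode -` U" by auto
  finally have "openin (top_of_set decr_seqs) (decr_seqs \<inter> decode -` U)" .
  then obtain V where V: "open V" "decr_seqs \<inter> decode -` U = decr_seqs \<inter> V" unfolding openin_open by blast
  have "c -` U \<inter> space \<Omega> = (\<lambda>x. encode (c x)) -` V \<inter> space \<Omega>"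
  proof (intro set_eqI)
    fix x
    show "x \<in> c -` U \<inter> space \<Omega> \<longleftrightarrow> x \<in> (\<lambda>x. encode (c x)) -` V \<inter> space \<Omega>"
    proof (cases "x \<in> space \<Omega>")
      case True
      note * = encode_decr_seqs[OF c[OF True]] decode_encode[OF c[OF True]]
      have "encode (c x) \<in> decr_seqs \<inter> decode -` U \<longleftrightarrow> encode (c x) \<in> decr_seqs \<inter> V" using V(2) by simp
      then show ?thesis using * True by simp
    qed simp
  qed
  also have "\<dots> \<in> sets \<Omega>" using em V(1) by (intro measurable_sets[OF em]) auto
  finally show "c -` U \<inter> space \<Omega> \<in> sets \<Omega>" .
qed

lemma continuous_map_borel_measurable_vague:
  assumes "continuous_map vague_topology euclideanreal \<phi>" shows "\<phi> \<in> borel_measurable vague_borel"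
proof (rule borel_measurableI)
  fix S :: "real set" assume "open S"
  then have "openin vague_topology {N \<in> topspace vague_topology. \<phi> N \<in> S}" using assms by (auto simp: continuous_map_def)
  moreover have "\<phi> -` S \<inter> space vague_borel = {N \<in> topspace vague_topology. \<phi> N \<in> S}"
    by (auto simp: space_vague_borel topspace_vague_topology)
  ultimately show "\<phi> -` S \<inter> space vague_borel \<in> sets vague_borel"
    unfolding sets_vague_borel by (auto intro: sigma_sets.Basic)
qed

lemma emeasure_dirac_sum_measurable:
  assumes t: "\<And>k::nat. (\<lambda>x. t x k) \<in> borel_measurable \<Omega>"
  shows "(\<lambda>x. emeasure (dirac_sum UNIV (t x)) {0..b}) \<in> borel_measurable \<Omega>"
proof -
  have "emeasure (dirac_sum UNIV (t x)) {0..b} = (\<Sum>k. indicator {0..b} (t x k))" for x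
  proof -
    have "emeasure (dirac_sum UNIV (t x)) {0..b} = (\<integral>\<^sup>+k. indicator {k. t x k \<in> {0..b}} k \<partial>count_space UNIV)"
      unfolding emeasure_dirac_sum[OF sets_nonneg_borel_Icc] by (subst nn_integral_indicator) auto
    also have "\<dots> = (\<Sum>k. indicator {0..b} (t x k))"
      unfolding nn_integral_count_space_nat by (intro suminf_cong) (simp add: indicator_def)
    finally show ?thesis .
  qed
  moreover have "(\<lambda>x. \<Sum>k. indicator {0..b} (t x k) :: ennreal) \<in> borel_measurable \<Omega>"
    using t by measurable
  ultimately show ?thesis by simp
qed

lemma config_point_configs: "config t \<in> point_configs"
proof -
  have "null_measure nonneg_borel \<in> point_configs"
    by (auto simp: point_configs_def intro!: image_eqI[of _ _ 0])
  then show ?thesis by (simp add: config_def)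
qed

lemma config_measurable:
  assumes t: "\<And>k::nat. (\<lambda>x. t x k) \<in> borel_measurable \<Omega>"
  shows "(\<lambda>x. config (t x)) \<in> measurable \<Omega> vague_borel"
proof (rule measurable_vague_borelI[OF config_point_configs])
  fix b :: real
  note [measurable] = emeasure_dirac_sum_measurable[of t, OF t]
  have "emeasure (config (t x)) {0..b} = (if \<forall>m::nat. emeasure (dirac_sum UNIV (t x)) {0..real m} < \<infinity>
     then emeasure (dirac_sum UNIV (t x)) {0..b} else 0)" for x
    by (simp add: config_def dirac_sum_point_configs_iff)
  moreover have "(\<lambda>x. if \<forall>m::nat. emeasure (dirac_sum UNIV (t x)) {0..real m} < \<infinity>
     then emeasure (dirac_sum UNIV (t x)) {0..b} else 0) \<in> borel_measurable \<Omega>"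
    by measurable
  ultimately show "(\<lambda>x. emeasure (config (t x)) {0..b}) \<in> borel_measurable \<Omega>" by simp
qed

lemma config_eq_decode:
  assumes "(\<lambda>k. exp (- t k)) \<in> decr_seqs"
  shows "config t = decode (\<lambda>k. exp (- t k))"
proof -
  have "dirac_sum UNIV t = decode (\<lambda>k. exp (- t k))" by (simp add: decode_def)
  then show ?thesis using decode_point_configs[OF assms] by (simp add: config_def)
qed

section \<open>Weak convergence on the coding space\<close>

abbreviation unit_cube :: "(nat \<Rightarrow> real) set" where
  "unit_cube \<equiv> PiE UNIV (\<lambda>_. {0..1})"

lemma compact_unit_cube: "compact unit_cube"
proof -
  have "compactin (product_topology (\<lambda>i. euclidean) UNIV) unit_cube"
    by (subst compactin_PiE) auto
  then show ?thesis unfolding euclidean_product_topology by simp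
qed

lemma decr_seqs_subset_cube: "decr_seqs \<subseteq> unit_cube"
  by (auto simp: decr_seqs_def PiE_iff)

definition monomial :: "(nat \<Rightarrow> nat) \<Rightarrow> nat \<Rightarrow> (nat \<Rightarrow> real) \<Rightarrow> real" where
  "monomial e d z = (\<Prod>k<d. z k ^ e k)"

lemma continuous_on_monomial: "continuous_on A (monomial e d)"
  unfolding monomial_def[abs_def]
  by (intro continuous_intros continuous_on_product_coordinates[THEN continuous_on_subset]) auto

lemma monomial_mult:
  "\<exists>e'' d''. \<forall>z. monomial e d z * monomial e' d' z = monomial e'' d'' z"
proof (intro exI allI)
  fix z :: "nat \<Rightarrow> real"
  let ?D = "max d d'"
  have 1: "monomial e d z = (\<Prod>k<max d d'. z k ^ (if k < d then e k else 0))" for e and d d' :: nat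
    unfolding monomial_def by (intro prod.mono_neutral_cong_left) auto
  show "monomial e d z * monomial e' d' z = monomial (\<lambda>k. (if k < d then e k else 0) + (if k < d' then e' k else 0)) ?D z"
    unfolding 1[of e d d'] 1[of e' d' d] max.commute[of d' d]
    by (simp add: monomial_def power_add prod.distrib)
qed

text \<open>Adding one monomial at a time lets the convergence of moments pass to polynomials by
  induction; closure under products is what Stone-Weierstrass asks for.\<close>

inductive polynomial :: "((nat \<Rightarrow> real) \<Rightarrow> real) \<Rightarrow> bool" where
  zero: "polynomial (\<lambda>z. 0)"
| add: "polynomial f \<Longrightarrow> polynomial (\<lambda>z. f z + c * monomial e d z)"

lemma polynomial_cmonom: "polynomial (\<lambda>z. c * monomial e d z)"
  using polynomial.add[OF polynomial.zero, of c e d] by simp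

lemma polynomial_const: "polynomial (\<lambda>z. c)"
  using polynomial_cmonom[of c "\<lambda>_. 0" 0] by (simp add: monomial_def)

lemma polynomial_add: "polynomial g \<Longrightarrow> polynomial f \<Longrightarrow> polynomial (\<lambda>z. f z + g z)"
proof (induction rule: polynomial.induct)
  case (add g c e d)
  show ?case using polynomial.add[OF add.IH[OF add.prems], of c e d] by (simp add: add_ac)
qed simp

lemma polynomial_mult_monom: "polynomial f \<Longrightarrow> polynomial (\<lambda>z. f z * (c' * monomial e' d' z))"
proof (induction rule: polynomial.induct)
  case (add f c e d)
  obtain e'' d'' where *: "\<And>z. monomial e d z * monomial e' d' z = monomial e'' d'' z"
    using monomial_mult by blast
  have "(\<lambda>z. (f z + c * monomial e d z) * (c' * monomial e' d' z))
      = (\<lambda>z. f z * (c' * monomial e' d' z) + (c * c') * monomial e'' d'' z)"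
    by (simp add: *[symmetric] algebra_simps)
  then show ?case using polynomial.add[OF add.IH] by simp
qed (simp add: polynomial.zero)

lemma polynomial_mult: "polynomial g \<Longrightarrow> polynomial f \<Longrightarrow> polynomial (\<lambda>z. f z * g z)"
proof (induction rule: polynomial.induct)
  case (add g c e d)
  have "polynomial (\<lambda>z. f z * g z + f z * (c * monomial e d z))"
    by (intro polynomial_add polynomial_mult_monom add)
  then show ?case by (simp add: distrib_left)
qed (simp add: polynomial.zero)

lemma polynomial_approximation:
  assumes "continuous_on unit_cube F" "0 < \<epsilon>"
  shows "\<exists>g. polynomial g \<and> (\<forall>z\<in>unit_cube. \<bar>F z - g z\<bar> < \<epsilon>)"
proof (rule Stone_Weierstrass_HOL[OF compact_unit_cube, of polynomial])
  fix f assume "polynomial f" then show "continuous_on unit_cube f"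
    by (induction rule: polynomial.induct) (auto intro!: continuous_intros continuous_on_monomial)
next
  fix x y :: "nat \<Rightarrow> real" assume "x \<in> unit_cube \<and> y \<in> unit_cube \<and> x \<noteq> y"
  then obtain k where k: "x k \<noteq> y k" by (metis ext)
  have m: "monomial (\<lambda>i. if i = k then 1 else 0) (Suc k) z = z k" for z
    unfolding monomial_def by (subst prod.lessThan_Suc) simp
  show "\<exists>f. polynomial f \<and> f x \<noteq> f y"
    using polynomial_cmonom[of 1 "\<lambda>i. if i = k then 1 else 0" "Suc k"] k by (auto simp: m)
qed (use assms polynomial_const polynomial_add polynomial_mult in auto)

text \<open>The laws are kept on the whole product space, so that compactness of the cube can be
  used, although the functions of interest are defined on \<open>decr_seqs\<close> only.\<close>

locale cube_law = prob_space \<mu> for \<mu> :: "(nat \<Rightarrow> real) measure" +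
  assumes sets_law: "sets \<mu> = sets borel" and AE_decr: "AE z in \<mu>. z \<in> decr_seqs"
begin

lemma measurable_law: "f \<in> borel_measurable borel \<Longrightarrow> f \<in> borel_measurable \<mu>"
  using measurable_cong_sets[OF sets_law refl] by blast

lemma integrable_law:
  fixes f :: "(nat \<Rightarrow> real) \<Rightarrow> real"
  assumes "f \<in> borel_measurable borel" "\<And>z. z \<in> unit_cube \<Longrightarrow> \<bar>f z\<bar> \<le> C"
  shows "integrable \<mu> f"
proof (rule integrable_const_bound[where B=C])
  show "AE z in \<mu>. norm (f z) \<le> C"
    using AE_decr by eventually_elim (use assms(2) decr_seqs_subset_cube in auto)
qed (rule measurable_law[OF assms(1)])

lemma integrable_continuous:
  assumes "continuous_on UNIV f" shows "integrable \<mu> (f :: _ \<Rightarrow> real)"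
proof -
  have "compact (f ` unit_cube)"
    using assms compact_unit_cube by (intro compact_continuous_image) (auto intro: continuous_on_subset)
  then have "bounded (f ` unit_cube)" by (rule compact_imp_bounded)
  then obtain C where "\<forall>y\<in>f ` unit_cube. norm y \<le> C" unfolding bounded_iff by blast
  then show ?thesis using assms by (intro integrable_law[of f C] borel_measurable_continuous_onI) auto
qed

lemma polynomial_continuous: "polynomial f \<Longrightarrow> continuous_on UNIV f"
  by (induction rule: polynomial.induct) (auto intro!: continuous_intros continuous_on_monomial)

end

text \<open>A decreasing nonnegative sequence tends to 0 as soon as each bound
  \<open>inverse (real (Suc m))\<close> is undercut once, and this is a countable condition on
  coordinates.\<close>

lemma decr_seqs_borel: "decr_seqs \<in> sets borel"
proof -
  have "decr_seqs = {z. (\<forall>k. 0 \<le> z k \<and> z k \<le> 1) \<and> (\<forall>k. z (Suc k) \<le> z k) \<and> (\<forall>m. \<exists>k. z k < inverse (real (Suc m)))}"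
  proof (intro set_eqI iffI; clarsimp simp: decr_seqs_def)
    fix z :: "nat \<Rightarrow> real" assume z: "\<forall>k. 0 \<le> z k \<and> z k \<le> 1" "decseq z" "z \<longlonglongrightarrow> 0"
    have "\<exists>k. z k < inverse (1 + real m)" for m
    proof -
      have "\<forall>\<^sub>F k in sequentially. z k < inverse (1 + real m)" using z(3) by (rule order_tendstoD) simp
      then show ?thesis by (auto simp: eventually_sequentially)
    qed
    then show "(\<forall>k. z (Suc k) \<le> z k) \<and> (\<forall>m. \<exists>k. z k < inverse (1 + real m))"
      using z(2) by (auto simp: decseq_Suc_iff)
  next
    fix z :: "nat \<Rightarrow> real" assume z: "\<forall>k. 0 \<le> z k \<and> z k \<le> 1" "\<forall>k. z (Suc k) \<le> z k" "\<forall>m. \<exists>k. z k < inverse (1 + real m)"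
    have d: "decseq z" using z by (simp add: decseq_Suc_iff)
    moreover have "z \<longlonglongrightarrow> 0"
    proof (rule LIMSEQ_I)
      fix r :: real assume "r > 0"
      then obtain m where "inverse (real (Suc m)) < r" using reals_Archimedean by blast
      moreover obtain k where "z k < inverse (1 + real m)" using z(3) by blast
      ultimately have "z k < r" by simp
      then have "\<forall>n\<ge>k. norm (z n - 0) < r" using d z(1) by (auto simp: decseq_def intro: le_less_trans)
      then show "\<exists>no. \<forall>n\<ge>no. norm (z n - 0) < r" by blast
    qed
    ultimately show "decseq z \<and> z \<longlonglongrightarrow> 0" by simp
  qed
  moreover have [measurable]: "(\<lambda>z::nat \<Rightarrow> real. z k) \<in> borel_measurable borel" for k
    by (rule measurable_product_coordinates)
  have [measurable]: "Measurable.pred borel (\<lambda>z::nat \<Rightarrow> real. z (Suc k) \<le> z k)" for k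
    using borel_measurable_le[OF measurable_product_coordinates[of "Suc k"] measurable_product_coordinates[of k]]
    by (simp add: pred_def)
  have [measurable]: "Measurable.pred borel (\<lambda>z::nat \<Rightarrow> real. z k < inverse (real (Suc m)))" for k m
    using borel_measurable_less[OF measurable_product_coordinates[of k] measurable_const[of "inverse (real (Suc m))"]]
    by (simp add: pred_def)
  have "Measurable.pred borel (\<lambda>z::nat\<Rightarrow>real. (\<forall>k. 0 \<le> z k \<and> z k \<le> 1) \<and> (\<forall>k. z (Suc k) \<le> z k) \<and> (\<forall>m. \<exists>k. z k < inverse (real (Suc m))))"
    by measurable
  ultimately show ?thesis by (simp add: pred_def)
qed

text \<open>Infimal convolution approximates a function that is only continuous on \<open>G\<close> from below by Lipschitz functions.\<close>

definition inf_conv :: "'a::metric_space set \<Rightarrow> ('a \<Rightarrow> real) \<Rightarrow> nat \<Rightarrow> 'a \<Rightarrow> real" where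
  "inf_conv G \<psi> m z = (INF z'\<in>G. \<psi> z' + real m * dist z z')"

context
  fixes G :: "'a::metric_space set" and \<psi> :: "'a \<Rightarrow> real" and C :: real
  assumes G: "G \<noteq> {}" and bd: "\<And>z. z \<in> G \<Longrightarrow> \<bar>\<psi> z\<bar> \<le> C"
begin

lemma inf_conv_bdd: "bdd_below ((\<lambda>z'. \<psi> z' + real m * dist z z') ` G)"
proof (rule bdd_belowI2[where m="- C"])
  fix z' assume "z' \<in> G"
  then show "- C \<le> \<psi> z' + real m * dist z z'" using bd[of z'] by (auto simp: abs_le_iff intro: add_increasing2)
qed

lemma inf_conv_le: "z' \<in> G \<Longrightarrow> inf_conv G \<psi> m z \<le> \<psi> z' + real m * dist z z'"
  unfolding inf_conv_def by (rule cINF_lower[OF inf_conv_bdd])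

lemma inf_conv_ge: "- C \<le> inf_conv G \<psi> m z"
  unfolding inf_conv_def
proof (rule cINF_greatest[OF G])
  fix z' assume "z' \<in> G"
  then show "- C \<le> \<psi> z' + real m * dist z z'" using bd[of z'] by (auto simp: abs_le_iff intro: add_increasing2)
qed

lemma inf_conv_le_self: "z \<in> G \<Longrightarrow> inf_conv G \<psi> m z \<le> \<psi> z"
  using inf_conv_le[of z m z] by simp

lemma inf_conv_lipschitz: "inf_conv G \<psi> m z \<le> inf_conv G \<psi> m w + real m * dist z w"
proof -
  have "inf_conv G \<psi> m z - real m * dist z w \<le> inf_conv G \<psi> m w"
    unfolding inf_conv_def[of _ _ _ w]
  proof (rule cINF_greatest[OF G])
    fix z' assume "z' \<in> G"
    have "real m * dist z z' \<le> real m * (dist z w + dist w z')" by (intro mult_left_mono dist_triangle) auto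
    then show "inf_conv G \<psi> m z - real m * dist z w \<le> \<psi> z' + real m * dist w z'"
      using inf_conv_le[OF \<open>z' \<in> G\<close>, of m z] by (simp add: distrib_left)
  qed
  then show ?thesis by simp
qed

lemma continuous_on_inf_conv: "continuous_on UNIV (inf_conv G \<psi> m)"
proof (rule continuous_on_iff[THEN iffD2], intro ballI allI impI)
  fix z and e :: real assume "0 < e"
  show "\<exists>d>0. \<forall>w\<in>UNIV. dist w z < d \<longrightarrow> dist (inf_conv G \<psi> m w) (inf_conv G \<psi> m z) < e"
  proof (intro exI[of _ "e / (real m + 1)"] conjI ballI impI)
    fix w assume "dist w z < e / (real m + 1)"
    then have "(real m + 1) * dist w z < e" by (simp add: field_simps)
    moreover have "real m * dist w z \<le> (real m + 1) * dist w z" by (intro mult_right_mono) auto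
    ultimately have "real m * dist w z < e" by linarith
    moreover have "\<bar>inf_conv G \<psi> m w - inf_conv G \<psi> m z\<bar> \<le> real m * dist w z"
      using inf_conv_lipschitz[of m w z] inf_conv_lipschitz[of m z w] by (simp add: abs_le_iff dist_commute)
    ultimately show "dist (inf_conv G \<psi> m w) (inf_conv G \<psi> m z) < e" by (simp add: dist_real_def)
  qed (use \<open>0 < e\<close> in auto)
qed

text \<open>Competitors at distance at least \<open>d\<close> pay
  \<open>real m * d \<ge> 2 * C\<close>, more than \<open>\<psi>\<close> can save; nearer ones
  change \<open>\<psi>\<close> by less than \<open>e / 2\<close>.\<close>

lemma inf_conv_tendsto:
  assumes c: "continuous_on G \<psi>" and z: "z \<in> G"
  shows "(\<lambda>m. inf_conv G \<psi> m z) \<longlonglongrightarrow> \<psi> z"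
proof (rule LIMSEQ_I)
  fix e :: real assume e: "0 < e"
  obtain d where d: "d > 0" "\<And>w. w \<in> G \<Longrightarrow> dist w z < d \<Longrightarrow> dist (\<psi> w) (\<psi> z) < e / 2"
    using c z e unfolding continuous_on_iff by (meson half_gt_zero)
  obtain m0 :: nat where m0: "2 * C / d \<le> real m0" using real_arch_simple by blast
  show "\<exists>m0. \<forall>m\<ge>m0. norm (inf_conv G \<psi> m z - \<psi> z) < e"
  proof (intro exI[of _ m0] allI impI)
    fix m assume m: "m0 \<le> m"
    have "\<psi> z - e / 2 \<le> inf_conv G \<psi> m z"
      unfolding inf_conv_def
    proof (rule cINF_greatest[OF G])
      fix w assume w: "w \<in> G"
      show "\<psi> z - e / 2 \<le> \<psi> w + real m * dist z w"
      proof (cases "dist w z < d")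
        case True
        have "0 \<le> real m * dist z w" by simp
        then show ?thesis using d(2)[OF w True] unfolding dist_real_def by linarith
      next
        case False
        have "2 * C \<le> real m0 * d" using m0 d(1) by (simp add: field_simps)
        also have "\<dots> \<le> real m * dist z w" using False m d(1) by (intro mult_mono) (auto simp: dist_commute)
        finally have "2 * C \<le> real m * dist z w" .
        then show ?thesis using bd[OF w] bd[OF z] e unfolding abs_le_iff by linarith
      qed
    qed
    then show "norm (inf_conv G \<psi> m z - \<psi> z) < e" using inf_conv_le_self[OF z, of m] e by (simp add: abs_less_iff)
  qed
qed

end

lemma zero_decr_seqs: "(\<lambda>_. 0) \<in> decr_seqs"
  by (auto simp: decr_seqs_def decseq_def)

text \<open>A portmanteau argument. The infimal convolutions are continuous on the whole product,
  lie below \<open>\<psi>\<close> on the codes and converge to it there. That the limit law is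
  carried by the codes takes the place of tightness.\<close>

lemma cube_laws_converge_lower:
  fixes \<mu> :: "nat \<Rightarrow> (nat \<Rightarrow> real) measure" and \<psi> :: "(nat \<Rightarrow> real) \<Rightarrow> real"
  assumes \<mu>: "\<And>n. cube_law (\<mu> n)" and \<mu>': "cube_law \<mu>'"
    and conv: "\<And>F :: (nat \<Rightarrow> real) \<Rightarrow> real. continuous_on UNIV F \<Longrightarrow> (\<lambda>n. \<integral>z. F z \<partial>\<mu> n) \<longlonglongrightarrow> (\<integral>z. F z \<partial>\<mu>')"
    and c: "continuous_on decr_seqs \<psi>" and bd: "\<And>z. z \<in> decr_seqs \<Longrightarrow> \<bar>\<psi> z\<bar> \<le> C"
    and y: "y < (\<integral>z. (if z \<in> decr_seqs then \<psi> z else 0) \<partial>\<mu>')"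
  shows "\<forall>\<^sub>F n in sequentially. y < (\<integral>z. (if z \<in> decr_seqs then \<psi> z else 0) \<partial>\<mu> n)"
proof -
  let ?\<psi> = "\<lambda>z. if z \<in> decr_seqs then \<psi> z else 0"
  interpret l: cube_law \<mu>' by fact
  interpret ln: cube_law "\<mu> n" for n by fact
  have ne: "decr_seqs \<noteq> {}" using zero_decr_seqs by blast
  have "(\<lambda>z. indicator decr_seqs z *\<^sub>R \<psi> z) \<in> borel_measurable borel"
    by (rule borel_measurable_continuous_on_indicator[OF _ c]) (simp add: decr_seqs_borel)
  also have "(\<lambda>z. indicator decr_seqs z *\<^sub>R \<psi> z) = ?\<psi>" by auto
  finally have m: "?\<psi> \<in> borel_measurable borel" .
  have C0: "0 \<le> C" using bd[OF zero_decr_seqs] by linarith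
  have b: "\<bar>?\<psi> z\<bar> \<le> C" for z using bd C0 by auto
  have i: "integrable \<mu>' ?\<psi>" "integrable (\<mu> n) ?\<psi>" for n
    using l.integrable_law[OF m b] ln.integrable_law[OF m b] by auto
  have "(\<lambda>m. \<integral>z. inf_conv decr_seqs \<psi> m z \<partial>\<mu>') \<longlonglongrightarrow> (\<integral>z. ?\<psi> z \<partial>\<mu>')"
  proof (rule integral_dominated_convergence[where w="\<lambda>_. C"])
    show "?\<psi> \<in> borel_measurable \<mu>'" by (rule l.measurable_law[OF m])
    show "inf_conv decr_seqs \<psi> i \<in> borel_measurable \<mu>'" for i
      by (intro l.measurable_law borel_measurable_continuous_onI continuous_on_inf_conv[OF ne bd])
    show "AE z in \<mu>'. (\<lambda>i. inf_conv decr_seqs \<psi> i z) \<longlonglongrightarrow> ?\<psi> z"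
      using l.AE_decr by eventually_elim (simp add: inf_conv_tendsto[OF ne bd c])
    show "AE z in \<mu>'. norm (inf_conv decr_seqs \<psi> i z) \<le> C" for i
      using l.AE_decr
    proof eventually_elim
      case (elim z)
      show ?case using inf_conv_ge[where G=decr_seqs and \<psi>=\<psi> and C=C and m=i and z=z, OF ne bd] inf_conv_le_self[where G=decr_seqs and \<psi>=\<psi> and C=C and m=i and z=z, OF ne bd elim] bd[OF elim]
        by (simp add: abs_le_iff)
    qed
  qed simp
  then have "\<forall>\<^sub>F m in sequentially. y < (\<integral>z. inf_conv decr_seqs \<psi> m z \<partial>\<mu>')" using y by (rule order_tendstoD)
  then obtain m where m': "y < (\<integral>z. inf_conv decr_seqs \<psi> m z \<partial>\<mu>')" by (auto simp: eventually_sequentially)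
  have "\<forall>\<^sub>F n in sequentially. y < (\<integral>z. inf_conv decr_seqs \<psi> m z \<partial>\<mu> n)"
    by (rule order_tendstoD(1)[OF conv m']) (rule continuous_on_inf_conv[OF ne bd])
  then show ?thesis
  proof eventually_elim
    case (elim n)
    have "(\<integral>z. inf_conv decr_seqs \<psi> m z \<partial>\<mu> n) \<le> (\<integral>z. ?\<psi> z \<partial>\<mu> n)"
      using ln.AE_decr[of n]
      by (intro integral_mono_AE i ln.integrable_continuous[OF continuous_on_inf_conv[where \<psi>=\<psi> and C=C, OF ne bd]])
         (auto elim!: eventually_mono simp: inf_conv_le_self[where \<psi>=\<psi> and C=C, OF ne bd])
    with elim show ?case by simp
  qed
qed

text \<open>Moments determine the limits for polynomials, these by uniform approximation on the cube
  for continuous functions on the product, and the lower bound applied to \<open>\<psi>\<close> and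
  to its negative yields bounded functions continuous on the codes only.\<close>

lemma cube_laws_converge:
  fixes \<mu> :: "nat \<Rightarrow> (nat \<Rightarrow> real) measure" and \<psi> :: "(nat \<Rightarrow> real) \<Rightarrow> real"
  assumes \<mu>: "\<And>n. cube_law (\<mu> n)" and \<mu>': "cube_law \<mu>'"
    and mon: "\<And>e d. 0 < e d \<Longrightarrow> (\<lambda>n. \<integral>z. monomial e (Suc d) z \<partial>\<mu> n) \<longlonglongrightarrow> (\<integral>z. monomial e (Suc d) z \<partial>\<mu>')"
    and c: "continuous_on decr_seqs \<psi>" and bd: "\<And>z. z \<in> decr_seqs \<Longrightarrow> \<bar>\<psi> z\<bar> \<le> C"
  shows "(\<lambda>n. \<integral>z. (if z \<in> decr_seqs then \<psi> z else 0) \<partial>\<mu> n) \<longlonglongrightarrow> (\<integral>z. (if z \<in> decr_seqs then \<psi> z else 0) \<partial>\<mu>')"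
proof -
  interpret l: cube_law \<mu>' by fact
  interpret ln: cube_law "\<mu> n" for n by fact
  \<comment> \<open>A vanishing last exponent shortens the monomial, so every monomial reduces to
    one with positive last exponent or to the constant 1.\<close>
  have mon': "(\<lambda>n. \<integral>z. monomial e d z \<partial>\<mu> n) \<longlonglongrightarrow> (\<integral>z. monomial e d z \<partial>\<mu>')" for e d
  proof (induction d)
    case 0
    then show ?case by (simp add: monomial_def l.prob_space ln.prob_space)
  next
    case (Suc d)
    show ?case
    proof (cases "e d = 0")
      case True
      then have "monomial e (Suc d) = monomial e d" by (auto simp: monomial_def)
      then show ?thesis using Suc by simp
    qed (use mon in simp)
  qed
  have pol: "(\<lambda>n. \<integral>z. f z \<partial>\<mu> n) \<longlonglongrightarrow> (\<integral>z. f z \<partial>\<mu>')" if "polynomial f" for f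
    using that
  proof (induction rule: polynomial.induct)
    case (add f c e d)
    note i = l.integrable_continuous[OF l.polynomial_continuous[OF add(1)]] ln.integrable_continuous[OF l.polynomial_continuous[OF add(1)]]
      l.integrable_continuous[OF continuous_on_monomial] ln.integrable_continuous[OF continuous_on_monomial]
    show ?case using i by (simp add: Bochner_Integration.integral_add) (intro tendsto_intros add mon')
  qed simp
  have conv: "(\<lambda>n. \<integral>z. F z \<partial>\<mu> n) \<longlonglongrightarrow> (\<integral>z. F z \<partial>\<mu>')" if F: "continuous_on UNIV F" for F :: "(nat \<Rightarrow> real) \<Rightarrow> real"
  proof (rule LIMSEQ_I)
    fix \<epsilon> :: real assume \<epsilon>: "0 < \<epsilon>"
    obtain g where g: "polynomial g" "\<And>z. z \<in> unit_cube \<Longrightarrow> \<bar>F z - g z\<bar> < \<epsilon> / 3"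
      using polynomial_approximation[of F "\<epsilon>/3"] continuous_on_subset[OF F] \<epsilon> by auto
    have close: "\<bar>(\<integral>z. F z \<partial>\<kappa>) - (\<integral>z. g z \<partial>\<kappa>)\<bar> \<le> \<epsilon> / 3" if "cube_law \<kappa>" for \<kappa>
    proof -
      interpret k: cube_law \<kappa> by fact
      note i = k.integrable_continuous[OF F] k.integrable_continuous[OF l.polynomial_continuous[OF g(1)]]
      have "\<bar>(\<integral>z. F z \<partial>\<kappa>) - (\<integral>z. g z \<partial>\<kappa>)\<bar> = \<bar>\<integral>z. F z - g z \<partial>\<kappa>\<bar>"
        using i by simp
      also have "\<dots> \<le> (\<integral>z. \<bar>F z - g z\<bar> \<partial>\<kappa>)"
        using integral_norm_bound[of \<kappa> "\<lambda>z. F z - g z"] by simp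
      also have "\<dots> \<le> (\<integral>z. \<epsilon> / 3 \<partial>\<kappa>)"
        using i k.AE_decr decr_seqs_subset_cube
        by (intro integral_mono_AE) (auto simp del: le_divide_eq_numeral1 elim!: eventually_mono intro!: less_imp_le[OF g(2)])
      finally show ?thesis by (simp add: k.prob_space)
    qed
    from LIMSEQ_D[OF pol[OF g(1)], of "\<epsilon>/3"] \<epsilon>
    obtain n0 where n0: "\<And>n. n \<ge> n0 \<Longrightarrow> \<bar>(\<integral>z. g z \<partial>\<mu> n) - (\<integral>z. g z \<partial>\<mu>')\<bar> < \<epsilon> / 3" by auto
    have "\<bar>(\<integral>z. F z \<partial>\<mu> n) - (\<integral>z. F z \<partial>\<mu>')\<bar> < \<epsilon>" if "n \<ge> n0" for n
      using n0[OF that] close[OF \<mu>, of n] close[OF \<mu>'] unfolding abs_le_iff abs_less_iff by linarith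
    then show "\<exists>n0. \<forall>n\<ge>n0. norm ((\<integral>z. F z \<partial>\<mu> n) - (\<integral>z. F z \<partial>\<mu>')) < \<epsilon>" by auto
  qed
  let ?I = "\<lambda>\<kappa> \<psi>. \<integral>z. (if z \<in> decr_seqs then \<psi> z else (0::real)) \<partial>\<kappa>"
  have neg: "?I \<kappa> (\<lambda>z. - \<psi> z) = - ?I \<kappa> \<psi>" for \<kappa> :: "(nat \<Rightarrow> real) measure"
    by (subst integral_minus[symmetric]) (rule Bochner_Integration.integral_cong, auto)
  show ?thesis
  proof (rule order_tendstoI)
    fix y assume "y < ?I \<mu>' \<psi>"
    then show "\<forall>\<^sub>F n in sequentially. y < ?I (\<mu> n) \<psi>"
      by (intro cube_laws_converge_lower[where \<psi>=\<psi> and C=C, OF \<mu> \<mu>' conv c bd])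
  next
    fix y assume "?I \<mu>' \<psi> < y"
    then have "- y < ?I \<mu>' (\<lambda>z. - \<psi> z)" unfolding neg by simp
    then have "\<forall>\<^sub>F n in sequentially. - y < ?I (\<mu> n) (\<lambda>z. - \<psi> z)"
      by (intro cube_laws_converge_lower[OF \<mu> \<mu>' conv, of _ C] continuous_intros c) (use bd in auto)
    then show "\<forall>\<^sub>F n in sequentially. ?I (\<mu> n) \<psi> < y" unfolding neg by simp
  qed
qed

section \<open>Laplace transforms\<close>

lemma nonneg_law_UNIV: "nonneg_law \<rho> \<Longrightarrow> measure \<rho> UNIV = 1"
  using prob_space.prob_space[of \<rho>] real_distribution.space_eq_univ[of \<rho>]
  by (simp add: nonneg_law_def real_distribution_def)

lemma nonneg_law_AE: "nonneg_law \<rho> \<Longrightarrow> AE w in \<rho>. 0 \<le> w"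
  by (simp add: nonneg_law_def)

lemma nonneg_law_exp_integrable:
  assumes \<rho>: "nonneg_law \<rho>" and s: "0 \<le> s"
  shows "integrable \<rho> (\<lambda>w. exp (- s * w))"
proof -
  interpret real_distribution \<rho> using \<rho> by (simp add: nonneg_law_def)
  show ?thesis
  proof (rule integrable_const_bound[where B=1])
    show "AE w in \<rho>. norm (exp (- s * w)) \<le> 1"
      using \<rho> s unfolding nonneg_law_def by (auto elim!: eventually_mono)
  qed simp
qed

lemma laplace_0: "nonneg_law \<rho> \<Longrightarrow> laplace \<rho> 0 = 1"
  by (simp add: laplace_def nonneg_law_def real_distribution_def prob_space.prob_space)

lemma laplace_nonneg: "0 \<le> laplace \<rho> s"
  by (simp add: laplace_def integral_nonneg)

lemma laplace_le_1:
  assumes "nonneg_law \<rho>" "0 \<le> s" shows "laplace \<rho> s \<le> 1"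
proof -
  interpret real_distribution \<rho> using assms by (simp add: nonneg_law_def)
  have "laplace \<rho> s \<le> (\<integral>w. 1 \<partial>\<rho>)"
    unfolding laplace_def using assms
    by (intro integral_mono_AE nonneg_law_exp_integrable) (auto simp: nonneg_law_def elim!: eventually_mono)
  then show ?thesis using nonneg_law_UNIV[OF assms(1)] by simp
qed

lemma nn_integral_laplace:
  assumes "nonneg_law \<rho>" "0 \<le> s"
  shows "(\<integral>\<^sup>+w. ennreal (exp (- s * w)) \<partial>\<rho>) = ennreal (laplace \<rho> s)"
  unfolding laplace_def by (intro nn_integral_eq_integral nonneg_law_exp_integrable assms) auto

lemma laplace_tendsto_1:
  assumes \<rho>: "nonneg_law \<rho>" shows "(laplace \<rho> \<longlongrightarrow> 1) (at_right 0)"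
proof -
  interpret real_distribution \<rho> using \<rho> by (simp add: nonneg_law_def)
  have "((\<lambda>s. \<integral>w. exp (- s * w) \<partial>\<rho>) \<longlongrightarrow> (\<integral>w. exp (- 0 * w) \<partial>\<rho>)) (at_right 0)"
  proof (rule tendsto_at_right_sequentially[where b=1])
    fix S :: "nat \<Rightarrow> real" assume S: "\<And>n. 0 < S n" "S \<longlonglongrightarrow> 0"
    show "(\<lambda>n. \<integral>w. exp (- S n * w) \<partial>\<rho>) \<longlonglongrightarrow> (\<integral>w. exp (- 0 * w) \<partial>\<rho>)"
    proof (rule integral_dominated_convergence[where w="\<lambda>_. 1"])
      show "AE w in \<rho>. (\<lambda>n. exp (- S n * w)) \<longlonglongrightarrow> exp (- 0 * w)"
        by (intro AE_I2 tendsto_intros S)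
      show "AE w in \<rho>. norm (exp (- S n * w)) \<le> 1" for n
        using \<rho> less_imp_le[OF S(1)[of n]] unfolding nonneg_law_def by (auto elim!: eventually_mono)
    qed auto
  qed simp
  then show ?thesis using nonneg_law_UNIV[OF \<rho>] by (simp add: laplace_def[abs_def])
qed

text \<open>The exponential is unbounded on the negative axis; replacing \<open>w\<close> by
  \<open>max 0 w\<close> gives a bounded continuous integrand without changing the
  integrals.\<close>

lemma weak_conv_laplace:
  assumes \<rho>: "\<And>n. nonneg_law (\<rho> n)" and \<rho>': "nonneg_law \<rho>'" and w: "weak_conv_m \<rho> \<rho>'" and s: "0 \<le> s"
  shows "(\<lambda>n. laplace (\<rho> n) s) \<longlonglongrightarrow> laplace \<rho>' s"
proof -
  have rd: "real_distribution (\<rho> n)" "real_distribution \<rho>'" for n using \<rho> \<rho>' by (auto simp: nonneg_law_def)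
  have eq: "laplace \<kappa> s = (\<integral>w. exp (- s * max 0 w) \<partial>\<kappa>)" if "nonneg_law \<kappa>" for \<kappa>
  proof -
    interpret real_distribution \<kappa> using that by (simp add: nonneg_law_def)
    show ?thesis unfolding laplace_def using that unfolding nonneg_law_def
      by (intro integral_cong_AE) (auto elim!: eventually_mono simp: max_def)
  qed
  have "(\<lambda>n. \<integral>w. exp (- s * max 0 w) \<partial>\<rho> n) \<longlonglongrightarrow> (\<integral>w. exp (- s * max 0 w) \<partial>\<rho>')"
    using s by (intro weak_conv_imp_integral_bdd_continuous_conv[OF rd w, where B=1]) (auto intro!: continuous_intros)
  then show ?thesis by (simp add: eq[OF \<rho>] eq[OF \<rho>'])
qed

lemma weak_limit_nonneg_law:
  assumes \<rho>: "\<And>n. nonneg_law (\<rho> n)" and \<rho>': "real_distribution \<rho>'" and w: "weak_conv_m \<rho> \<rho>'"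
  shows "nonneg_law \<rho>'"
proof -
  interpret real_distribution \<rho>' by fact
  have rd: "real_distribution (\<rho> n)" for n using \<rho> by (auto simp: nonneg_law_def)
  \<comment> \<open>A bounded continuous function that is positive exactly on the negative
    numbers.\<close>
  let ?f = "\<lambda>x::real. min 1 (max 0 (- x))"
  have "(\<lambda>n. \<integral>x. ?f x \<partial>\<rho> n) \<longlonglongrightarrow> (\<integral>x. ?f x \<partial>\<rho>')"
    by (intro weak_conv_imp_integral_bdd_continuous_conv[OF rd \<rho>' w, where B=1]) (auto intro!: continuous_intros)
  moreover have "(\<integral>x. ?f x \<partial>\<rho> n) = 0" for n
  proof -
    interpret r: real_distribution "\<rho> n" using \<rho>[of n] by (simp add: nonneg_law_def)
    have "(\<integral>x. ?f x \<partial>\<rho> n) = (\<integral>x. 0 \<partial>\<rho> n)"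
      using \<rho>[of n] unfolding nonneg_law_def by (intro integral_cong_AE) (auto elim!: eventually_mono)
    then show ?thesis by simp
  qed
  ultimately have "(\<integral>x. ?f x \<partial>\<rho>') = 0" using LIMSEQ_unique[OF tendsto_const[of 0]] by simp
  moreover have "integrable \<rho>' ?f" by (rule integrable_const_bound[where B=1]) auto
  ultimately have "AE x in \<rho>'. ?f x = 0" by (subst (asm) integral_nonneg_eq_0_iff_AE) auto
  then have "AE x in \<rho>'. 0 \<le> x" by eventually_elim (auto simp: min_def max_def split: if_splits)
  then show ?thesis using \<rho>' by (simp add: nonneg_law_def)
qed

text \<open>Since \<open>exp (- s * w) \<le> 1 / 2\<close> beyond \<open>ln 2 / s\<close>, a Laplace
  transform close to 1 leaves little mass there. The left endpoint is -1 because the half-open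
  intervals of \<open>tight\<close> must contain a possible atom at 0.\<close>

lemma nonneg_law_tail:
  assumes \<rho>: "nonneg_law \<rho>" and s: "0 < s"
  shows "1 - 2 * (1 - laplace \<rho> s) \<le> measure \<rho> {-1<..ln 2 / s}"
proof -
  interpret real_distribution \<rho> using \<rho> by (simp add: nonneg_law_def)
  let ?b = "ln 2 / s"
  have "laplace \<rho> s \<le> (\<integral>x. 1 / 2 + 1 / 2 * indicator {-1<..?b} x \<partial>\<rho>)"
    unfolding laplace_def
  proof (rule integral_mono_AE)
    show "integrable \<rho> (\<lambda>w. exp (- s * w))" using s by (intro nonneg_law_exp_integrable[OF \<rho>]) simp
    show "AE w in \<rho>. exp (- s * w) \<le> 1 / 2 + 1 / 2 * indicator {-1<..?b} w"
      using nonneg_law_AE[OF \<rho>]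
    proof eventually_elim
      case (elim w)
      show ?case
      proof (cases "w \<le> ?b")
        case True
        then show ?thesis using elim s by simp
      next
        case False
        then have "ln 2 \<le> s * w" using s by (simp add: field_simps)
        then have "exp (- s * w) \<le> exp (- ln 2)" by simp
        also have "\<dots> = (1 / 2 :: real)" by (simp add: exp_minus)
        finally show ?thesis using False by (simp add: indicator_def)
      qed
    qed
  qed (auto simp: integrable_real_indicator emeasure_eq_measure)
  also have "\<dots> = 1 / 2 + 1 / 2 * measure \<rho> {-1<..?b}"
    using nonneg_law_UNIV[OF \<rho>] by (simp add: emeasure_eq_measure)
  finally show ?thesis by simp
qed

text \<open>Existence half of the continuity theorem. As \<open>\<Lambda>\<close> is close to 1 near
  0, one parameter \<open>s\<close> controls the tails of all but finitely many laws, so the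
  sequence is tight and Helly's theorem supplies a limit law.\<close>

lemma laplace_limit_exists:
  assumes \<rho>: "\<And>n. nonneg_law (\<rho> n)" and lim: "\<And>s. 0 < s \<Longrightarrow> (\<lambda>n. laplace (\<rho> n) s) \<longlonglongrightarrow> \<Lambda> s"
    and one: "(\<Lambda> \<longlongrightarrow> 1) (at_right 0)"
  shows "\<exists>\<rho>'. nonneg_law \<rho>' \<and> (\<forall>s>0. laplace \<rho>' s = \<Lambda> s)"
proof -
  have rd: "real_distribution (\<rho> n)" for n using \<rho> by (auto simp: nonneg_law_def)
  have "tight \<rho>"
    unfolding tight_def
  proof (intro conjI allI impI rd)
    fix \<epsilon> :: real assume \<epsilon>: "0 < \<epsilon>"
    have pick: "\<exists>s>0. 1 - \<epsilon> / 2 < L s" if "(L \<longlongrightarrow> 1) (at_right 0)" for L :: "real \<Rightarrow> real"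
    proof -
      have "\<forall>\<^sub>F s in at_right 0. 1 - \<epsilon> / 2 < L s \<and> 0 < s"
        using order_tendstoD(1)[OF that, of "1 - \<epsilon>/2"] \<epsilon> eventually_at_right_less[of 0] by (auto intro: eventually_conj)
      then show ?thesis using eventually_happens[of _ "at_right (0::real)"] by (auto simp: trivial_limit_at_right_real)
    qed
    obtain s where s: "0 < s" "1 - \<epsilon> / 2 < \<Lambda> s" using pick[OF one] by blast
    obtain n0 where n0: "\<And>n. n \<ge> n0 \<Longrightarrow> 1 - \<epsilon> / 2 < laplace (\<rho> n) s"
      using order_tendstoD(1)[OF lim[OF s(1)] s(2)] by (auto simp: eventually_sequentially)
    have "\<forall>n. \<exists>t>0. 1 - \<epsilon> / 2 < laplace (\<rho> n) t" using pick[OF laplace_tendsto_1[OF \<rho>]] by blast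
    then obtain t where t: "\<And>n. 0 < t n" "\<And>n. 1 - \<epsilon> / 2 < laplace (\<rho> n) (t n)" by metis
    \<comment> \<open>Takes in the cut-off for the common parameter \<open>s\<close> and those of
      the \<open>n0\<close> exceptional laws; the entry 1 guarantees \<open>-1 < b\<close>.\<close>
    define b where "b = Max (insert 1 (insert (ln 2 / s) ((\<lambda>n. ln 2 / t n) ` {..<n0})))"
    have "1 - \<epsilon> < measure (\<rho> n) {-1<..b}" for n
    proof -
      interpret r: real_distribution "\<rho> n" by (rule rd)
      obtain u where u: "0 < u" "1 - \<epsilon> / 2 < laplace (\<rho> n) u" "ln 2 / u \<le> b"
      proof (cases "n < n0")
        case True
        then have "ln 2 / t n \<le> b" unfolding b_def by (intro Max_ge) auto
        then show ?thesis using t[of n] by (intro that[of "t n"])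
      next
        case False
        have "ln 2 / s \<le> b" unfolding b_def by (intro Max_ge) auto
        then show ?thesis using s(1) n0[of n] False by (intro that[of s]) auto
      qed
      have "1 - \<epsilon> < 1 - 2 * (1 - laplace (\<rho> n) u)" using u(2) by simp
      also have "\<dots> \<le> measure (\<rho> n) {-1<..ln 2 / u}" by (rule nonneg_law_tail[OF \<rho> u(1)])
      also have "\<dots> \<le> measure (\<rho> n) {-1<..b}" using u(3) by (intro r.finite_measure_mono) auto
      finally show ?thesis .
    qed
    moreover have "-1 < b" unfolding b_def by (rule less_le_trans[of _ 1], simp, rule Max_ge) auto
    ultimately show "\<exists>a b. a < b \<and> (\<forall>n. 1 - \<epsilon> < measure (\<rho> n) {a<..b})" by blast
  qed
  from tight_imp_convergent_subsubsequence[OF this strict_mono_id] obtain r \<rho>'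
    where r: "strict_mono (r :: nat \<Rightarrow> nat)" "real_distribution \<rho>'" "weak_conv_m (\<rho> \<circ> id \<circ> r) \<rho>'" by blast
  have w: "weak_conv_m (\<lambda>n. \<rho> (r n)) \<rho>'" using r(3) by (simp add: comp_def)
  have nn: "nonneg_law \<rho>'" by (rule weak_limit_nonneg_law[OF \<rho> r(2) w])
  have "laplace \<rho>' s = \<Lambda> s" if "0 < s" for s
  proof (rule LIMSEQ_unique)
    show "(\<lambda>n. laplace (\<rho> (r n)) s) \<longlonglongrightarrow> laplace \<rho>' s"
      using that by (intro weak_conv_laplace[OF \<rho> nn w]) simp
    show "(\<lambda>n. laplace (\<rho> (r n)) s) \<longlonglongrightarrow> \<Lambda> s"
      using LIMSEQ_subseq_LIMSEQ[OF lim[OF that] r(1)] by (simp add: comp_def)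
  qed
  then show ?thesis using nn by blast
qed

section \<open>Renewal processes\<close>

text \<open>
  For \<open>z\<^sub>k = exp (- (w\<^sub>0 + \<dots> + w\<^sub>k))\<close> the monomial with exponents \<open>e\<close> is the product of the
  \<open>exp (- s\<^sub>j w\<^sub>j)\<close> with \<open>s\<close> the suffix sums of \<open>e\<close>. They are all positive once the last exponent is,
  so that Laplace transforms at 0, and hence tightness, never enter.
\<close>

primrec suffix_sums :: "nat \<Rightarrow> (nat \<Rightarrow> nat) \<Rightarrow> real list" where
  "suffix_sums 0 e = [real (e 0)]"
| "suffix_sums (Suc d) e = real (\<Sum>k\<le>Suc d. e k) # suffix_sums d (\<lambda>k. e (Suc k))"

lemma suffix_sums_pos: "0 < e d \<Longrightarrow> s \<in> set (suffix_sums d e) \<Longrightarrow> 0 < s"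
proof (induction d arbitrary: e)
  case (Suc d)
  have "0 < (\<Sum>k\<le>Suc d. e k)" using Suc.prems(1) by (intro sum_pos2[of _ "Suc d"]) auto
  then show ?case using Suc.prems Suc.IH[of "\<lambda>k. e (Suc k)"] by (auto simp del: sum.atMost_Suc of_nat_sum)
qed simp

lemma suffix_sums_Cons: "\<exists>s ss. suffix_sums d e = s # ss"
  by (cases d) auto

lemma monomial_Suc_shift:
  assumes "\<And>k. z (Suc k) = c * z' k" and "z 0 = c"
  shows "monomial e (Suc (Suc d)) z = c ^ (\<Sum>k\<le>Suc d. e k) * monomial (\<lambda>k. e (Suc k)) (Suc d) z'"
proof -
  have "monomial e (Suc (Suc d)) z = c ^ e 0 * (\<Prod>k<Suc d. c ^ e (Suc k) * z' k ^ e (Suc k))"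
    unfolding monomial_def by (subst prod.lessThan_Suc_shift) (simp add: assms power_mult_distrib)
  also have "\<dots> = c ^ (e 0 + (\<Sum>k<Suc d. e (Suc k))) * monomial (\<lambda>k. e (Suc k)) (Suc d) z'"
    by (simp add: prod.distrib power_add power_sum monomial_def mult_ac del: prod.lessThan_Suc sum.lessThan_Suc)
  also have "e 0 + (\<Sum>k<Suc d. e (Suc k)) = (\<Sum>k\<le>Suc d. e k)"
    by (simp only: sum.atMost_Suc_shift lessThan_Suc_atMost)
  finally show ?thesis .
qed

abbreviation iid :: "real measure \<Rightarrow> (nat \<Rightarrow> real) measure" where
  "iid \<rho> \<equiv> \<Pi>\<^sub>M i\<in>(UNIV :: nat set). \<rho>"

definition renewal_code :: "real \<times> (nat \<Rightarrow> real) \<Rightarrow> nat \<Rightarrow> real" where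
  "renewal_code p k = exp (- (fst p + (\<Sum>j<k. snd p j)))"

lemma renewal_code_Suc: "renewal_code (u, case_nat s w) (Suc k) = exp (- u) * renewal_code (s, w) k"
  by (simp add: renewal_code_def sum.lessThan_Suc_shift exp_add[symmetric] del: sum.lessThan_Suc)

lemma sequence_space_nonneg_law: "nonneg_law \<rho> \<Longrightarrow> sequence_space \<rho>"
  unfolding sequence_space_def product_prob_space_def product_sigma_finite_def product_prob_space_axioms_def nonneg_law_def
    real_distribution_def
  by (auto intro: prob_space_imp_sigma_finite)

lemma sets_nonneg_law: "nonneg_law \<rho> \<Longrightarrow> sets \<rho> = sets borel"
  using real_distribution.events_eq_borel by (auto simp: nonneg_law_def)

lemma prob_space_nonneg_law: "nonneg_law \<rho> \<Longrightarrow> prob_space \<rho>"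
  by (simp add: nonneg_law_def real_distribution_def)

lemma renewal_code_measurable:
  assumes \<sigma>: "nonneg_law \<sigma>" and \<rho>: "nonneg_law \<rho>"
  shows "(\<lambda>p. renewal_code p k) \<in> borel_measurable (\<sigma> \<Otimes>\<^sub>M iid \<rho>)"
proof -
  note [measurable_cong] = sets_nonneg_law[OF \<sigma>] sets_nonneg_law[OF \<rho>]
  have [measurable]: "(\<lambda>w. w j) \<in> borel_measurable (iid \<rho>)" for j
    using measurable_component_singleton[of j UNIV "\<lambda>_. \<rho>"] measurable_cong_sets[OF refl sets_nonneg_law[OF \<rho>]] by blast
  have [measurable]: "fst \<in> borel_measurable (\<sigma> \<Otimes>\<^sub>M iid \<rho>)"
    using measurable_fst measurable_cong_sets[OF refl sets_nonneg_law[OF \<sigma>]] by blast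
  show ?thesis unfolding renewal_code_def by measurable
qed

lemma monomial_renewal_measurable:
  assumes "nonneg_law \<sigma>" "nonneg_law \<rho>"
  shows "(\<lambda>p. monomial e d (renewal_code p)) \<in> borel_measurable (\<sigma> \<Otimes>\<^sub>M iid \<rho>)"
  unfolding monomial_def using renewal_code_measurable[OF assms] by measurable

text \<open>Stated for an arbitrary delay law because the induction changes it: by
  \<open>PiM_iter\<close> the first increment splits off and becomes the delay of the remaining
  process. Nonnegative integrals keep Fubini free of integrability conditions.\<close>

lemma renewal_monomial:
  assumes \<sigma>: "nonneg_law \<sigma>" and \<rho>: "nonneg_law \<rho>"
  shows "(\<integral>\<^sup>+p. ennreal (monomial e (Suc d) (renewal_code p)) \<partial>(\<sigma> \<Otimes>\<^sub>M iid \<rho>))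
    = ennreal (laplace \<sigma> (hd (suffix_sums d e)) * prod_list (map (laplace \<rho>) (tl (suffix_sums d e))))"
  using \<sigma>
proof (induction d arbitrary: e \<sigma>)
  case (0 e \<sigma>)
  interpret S: sequence_space \<rho> by (rule sequence_space_nonneg_law[OF \<rho>])
  have [measurable]: "(\<lambda>p. ennreal (monomial e (Suc 0) (renewal_code p))) \<in> borel_measurable (\<sigma> \<Otimes>\<^sub>M S.S)"
    using monomial_renewal_measurable[OF 0 \<rho>] by measurable
  have "(\<integral>\<^sup>+p. ennreal (monomial e (Suc 0) (renewal_code p)) \<partial>(\<sigma> \<Otimes>\<^sub>M S.S))
      = (\<integral>\<^sup>+u. \<integral>\<^sup>+w. ennreal (monomial e (Suc 0) (renewal_code (u, w))) \<partial>S.S \<partial>\<sigma>)"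
    by (intro S.P.nn_integral_fst[symmetric]) measurable
  also have "\<dots> = (\<integral>\<^sup>+u. ennreal (exp (- real (e 0) * u)) \<partial>\<sigma>)"
    by (simp add: monomial_def renewal_code_def exp_of_nat_mult[symmetric] S.P.emeasure_space_1)
  finally show ?case by (simp only: nn_integral_laplace[OF 0] of_nat_0_le_iff) simp
next
  case (Suc d e \<sigma>)
  interpret S: sequence_space \<rho> by (rule sequence_space_nonneg_law[OF \<rho>])
  let ?e = "\<lambda>k. e (Suc k)" and ?s = "real (\<Sum>k\<le>Suc d. e k)"
  let ?R = "ennreal (laplace \<rho> (hd (suffix_sums d ?e)) * prod_list (map (laplace \<rho>) (tl (suffix_sums d ?e))))"
  have m [measurable]: "(\<lambda>p. ennreal (monomial e (Suc (Suc d)) (renewal_code p))) \<in> borel_measurable (\<sigma> \<Otimes>\<^sub>M S.S)"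
    using monomial_renewal_measurable[OF Suc.prems \<rho>] by measurable
  have [measurable]: "(\<lambda>p. ennreal (monomial ?e (Suc d) (renewal_code p))) \<in> borel_measurable (\<rho> \<Otimes>\<^sub>M S.S)"
    using monomial_renewal_measurable[OF \<rho> \<rho>] by measurable
  have [measurable]: "(\<lambda>(s, w). case_nat s w) \<in> measurable (\<rho> \<Otimes>\<^sub>M S.S) S.S"
    by measurable
  have inner: "(\<integral>\<^sup>+w. ennreal (monomial e (Suc (Suc d)) (renewal_code (u, w))) \<partial>S.S) = ennreal (exp (- ?s * u)) * ?R"
    if u: "u \<in> space \<sigma>" for u
  proof -
    have mu: "(\<lambda>w. ennreal (monomial e (Suc (Suc d)) (renewal_code (u, w)))) \<in> borel_measurable S.S"
      using measurable_compose[OF measurable_Pair1'[OF u] m] .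
    have "(\<integral>\<^sup>+w. ennreal (monomial e (Suc (Suc d)) (renewal_code (u, w))) \<partial>S.S)
        = (\<integral>\<^sup>+w. ennreal (monomial e (Suc (Suc d)) (renewal_code (u, w))) \<partial>distr (\<rho> \<Otimes>\<^sub>M S.S) S.S (\<lambda>(s, w). case_nat s w))"
      by (simp only: S.PiM_iter)
    also have "\<dots> = (\<integral>\<^sup>+p. ennreal (monomial e (Suc (Suc d)) (renewal_code (u, case_nat (fst p) (snd p)))) \<partial>(\<rho> \<Otimes>\<^sub>M S.S))"
      using mu by (subst nn_integral_distr) (auto simp: case_prod_beta)
    also have "\<dots> = (\<integral>\<^sup>+p. ennreal (exp (- ?s * u)) * ennreal (monomial ?e (Suc d) (renewal_code p)) \<partial>(\<rho> \<Otimes>\<^sub>M S.S))"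
    proof (intro nn_integral_cong)
      fix p :: "real \<times> (nat \<Rightarrow> real)"
      have "monomial e (Suc (Suc d)) (renewal_code (u, case_nat (fst p) (snd p)))
          = exp (- u) ^ (\<Sum>k\<le>Suc d. e k) * monomial ?e (Suc d) (renewal_code p)"
        by (rule monomial_Suc_shift) (simp_all add: renewal_code_Suc, simp add: renewal_code_def)
      also have "exp (- u) ^ (\<Sum>k\<le>Suc d. e k) = exp (- ?s * u)"
        by (simp only: exp_of_nat_mult[symmetric]) (simp del: of_nat_sum sum.atMost_Suc)
      finally show "ennreal (monomial e (Suc (Suc d)) (renewal_code (u, case_nat (fst p) (snd p))))
          = ennreal (exp (- ?s * u)) * ennreal (monomial ?e (Suc d) (renewal_code p))"
        by (simp add: ennreal_mult')
    qed
    also have "\<dots> = ennreal (exp (- ?s * u)) * ?R"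
      by (subst nn_integral_cmult) (simp_all add: Suc.IH[OF \<rho>])
    finally show ?thesis .
  qed
  have "(\<integral>\<^sup>+p. ennreal (monomial e (Suc (Suc d)) (renewal_code p)) \<partial>(\<sigma> \<Otimes>\<^sub>M S.S))
      = (\<integral>\<^sup>+u. \<integral>\<^sup>+w. ennreal (monomial e (Suc (Suc d)) (renewal_code (u, w))) \<partial>S.S \<partial>\<sigma>)"
    by (intro S.P.nn_integral_fst[symmetric]) measurable
  also have "\<dots> = (\<integral>\<^sup>+u. ennreal (exp (- ?s * u)) * ?R \<partial>\<sigma>)"
    by (intro nn_integral_cong inner)
  also have "\<dots> = ennreal (laplace \<sigma> ?s) * ?R"
    using measurable_ident_sets[OF sets_nonneg_law[OF Suc.prems]]
    by (subst nn_integral_multc) (simp_all only: nn_integral_laplace[OF Suc.prems] of_nat_0_le_iff, measurable)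
  finally show ?case
    using suffix_sums_Cons[of d ?e] by (auto simp: ennreal_mult'[symmetric] laplace_nonneg)
qed

text \<open>The expectation of the \<open>k\<close>-th entry is at most
  \<open>laplace \<rho> 1 ^ k\<close>, which tends to 0 by \<open>lt\<close>. So the infimum of the
  entries has expectation 0, and as almost every code decreases, almost every code tends to
  0.\<close>

lemma renewal_code_AE:
  assumes \<sigma>: "nonneg_law \<sigma>" and \<rho>: "nonneg_law \<rho>" and lt: "laplace \<rho> 1 < 1"
  shows "AE p in \<sigma> \<Otimes>\<^sub>M iid \<rho>. renewal_code p \<in> decr_seqs"
proof -
  interpret S: sequence_space \<rho> by (rule sequence_space_nonneg_law[OF \<rho>])
  interpret s: prob_space \<sigma> by (rule prob_space_nonneg_law[OF \<sigma>])
  interpret P: pair_prob_space \<sigma> S.S ..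
  note rm [measurable] = renewal_code_measurable[OF \<sigma> \<rho>]
  note [measurable_cong] = sets_nonneg_law[OF \<sigma>] sets_nonneg_law[OF \<rho>]
  have cm [measurable]: "(\<lambda>w. w j) \<in> borel_measurable S.S" for j
    using measurable_component_singleton[of j UNIV "\<lambda>_. \<rho>"] measurable_cong_sets[OF refl sets_nonneg_law[OF \<rho>]] by blast
  have [measurable]: "fst \<in> borel_measurable (\<sigma> \<Otimes>\<^sub>M S.S)"
    using measurable_fst measurable_cong_sets[OF refl sets_nonneg_law[OF \<sigma>]] by blast
  have 1: "AE p in \<sigma> \<Otimes>\<^sub>M S.S. 0 \<le> fst p \<and> (\<forall>j. 0 \<le> snd p j)"
  proof (rule P.AE_pair_measure)
    have "AE w in S.S. 0 \<le> w j" for j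
      by (rule AE_PiM_component[of UNIV "\<lambda>_. \<rho>"]) (auto intro: prob_space_nonneg_law \<rho> nonneg_law_AE)
    then have "AE w in S.S. \<forall>j. 0 \<le> w j" by (simp add: AE_all_countable)
    with nonneg_law_AE[OF \<sigma>] show "AE x in \<sigma>. AE y in S.S. 0 \<le> fst (x, y) \<and> (\<forall>j. 0 \<le> snd (x, y) j)"
      by (auto elim!: eventually_mono)
  qed measurable
  have n: "(\<integral>\<^sup>+p. ennreal (renewal_code p k) \<partial>(\<sigma> \<Otimes>\<^sub>M S.S)) \<le> ennreal (laplace \<rho> 1 ^ k)" for k
  proof -
    \<comment> \<open>The \<open>k\<close>-th entry is the monomial with a single exponent 1 at
      position \<open>k\<close>, and all its suffix sums equal 1.\<close>
    let ?e = "\<lambda>k i. if i = k then 1 else (0::nat)"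
    have m: "monomial (?e k) (Suc k) z = z k" for z
      unfolding monomial_def by (subst prod.lessThan_Suc) simp
    have ss: "suffix_sums k (?e k) = replicate (Suc k) 1" for k
    proof (induction k)
      case (Suc k)
      have "(\<lambda>i. ?e (Suc k) (Suc i)) = ?e k" by auto
      moreover have "(\<Sum>i\<le>Suc k. ?e (Suc k) i) = 1" by simp
      ultimately show ?case using Suc by simp
    qed simp
    have "(\<integral>\<^sup>+p. ennreal (renewal_code p k) \<partial>(\<sigma> \<Otimes>\<^sub>M S.S)) = ennreal (laplace \<sigma> 1 * laplace \<rho> 1 ^ k)"
      using renewal_monomial[OF \<sigma> \<rho>, of "?e k" k] unfolding m ss by (simp add: prod_list_replicate)
    also have "\<dots> \<le> ennreal (1 * laplace \<rho> 1 ^ k)"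
      using laplace_le_1[OF \<sigma>, of 1] by (intro ennreal_leI mult_right_mono) (auto simp: laplace_nonneg)
    finally show ?thesis by simp
  qed
  have "(\<integral>\<^sup>+p. (INF k. ennreal (renewal_code p k)) \<partial>(\<sigma> \<Otimes>\<^sub>M S.S)) \<le> 0"
  proof (rule LIMSEQ_le_const)
    show "(\<lambda>k. ennreal (laplace \<rho> 1 ^ k)) \<longlonglongrightarrow> 0"
      using tendsto_ennrealI[OF LIMSEQ_realpow_zero[OF laplace_nonneg lt]] by simp
    have "(\<integral>\<^sup>+p. (INF k. ennreal (renewal_code p k)) \<partial>(\<sigma> \<Otimes>\<^sub>M S.S)) \<le> ennreal (laplace \<rho> 1 ^ k)" for k
      by (rule order_trans[OF nn_integral_mono n[of k]]) (auto intro: INF_lower)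
    then show "\<exists>N. \<forall>k\<ge>N. (\<integral>\<^sup>+p. (INF k. ennreal (renewal_code p k)) \<partial>(\<sigma> \<Otimes>\<^sub>M S.S)) \<le> ennreal (laplace \<rho> 1 ^ k)"
      by blast
  qed
  then have "AE p in \<sigma> \<Otimes>\<^sub>M S.S. (INF k. ennreal (renewal_code p k)) = 0"
    by (subst (asm) le_zero_eq, subst (asm) nn_integral_0_iff_AE) auto
  with 1 show ?thesis
  proof eventually_elim
    case (elim p)
    have dec: "decseq (renewal_code p)"
      using elim by (intro decseq_SucI) (simp add: renewal_code_def)
    have b: "0 \<le> renewal_code p k \<and> renewal_code p k \<le> 1" for k
    proof -
      have "0 \<le> fst p + (\<Sum>j<k. snd p j)" using elim by (intro add_nonneg_nonneg sum_nonneg) auto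
      then show ?thesis by (simp add: renewal_code_def)
    qed
    have "renewal_code p \<longlonglongrightarrow> 0"
    proof (rule LIMSEQ_I)
      fix r :: real assume r: "0 < r"
      have "(INF k. ennreal (renewal_code p k)) < ennreal r" using elim r by simp
      then obtain k where "ennreal (renewal_code p k) < ennreal r" unfolding INF_less_iff by auto
      then have "renewal_code p k < r" using b[of k] r by (simp add: ennreal_less_iff)
      then have "\<forall>n\<ge>k. norm (renewal_code p n - 0) < r" using dec b by (auto simp: decseq_def intro: le_less_trans)
      then show "\<exists>no. \<forall>n\<ge>no. norm (renewal_code p n - 0) < r" by blast
    qed
    then show ?case using dec b by (simp add: decr_seqs_def)
  qed
qed

lemma iid_component_measurable:
  assumes \<rho>: "nonneg_law \<rho>" shows "(\<lambda>w. w j) \<in> borel_measurable (iid \<rho>)"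
  using measurable_component_singleton[of j UNIV "\<lambda>_. \<rho>"] measurable_cong_sets[OF refl sets_nonneg_law[OF \<rho>]] by blast

lemma DRPP_measurable:
  assumes \<sigma>: "nonneg_law \<sigma>" and \<rho>: "nonneg_law \<rho>"
  shows "(\<lambda>(u, w). config (\<lambda>i. u + (\<Sum>j<i. w j))) \<in> measurable (\<sigma> \<Otimes>\<^sub>M iid \<rho>) vague_borel"
proof -
  note [measurable] = iid_component_measurable[OF \<rho>]
  have [measurable]: "fst \<in> borel_measurable (\<sigma> \<Otimes>\<^sub>M iid \<rho>)"
    using measurable_fst measurable_cong_sets[OF refl sets_nonneg_law[OF \<sigma>]] by blast
  show ?thesis unfolding case_prod_beta by (rule config_measurable) measurable
qed

text \<open>An undelayed renewal process is delayed by its own first increment, so that one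
  convergence criterion serves both limits.\<close>

lemma RPP_eq_DRPP:
  assumes \<rho>: "nonneg_law \<rho>" shows "RPP_law \<rho> = DRPP_law \<rho> \<rho>"
proof -
  interpret S: sequence_space \<rho> by (rule sequence_space_nonneg_law[OF \<rho>])
  note [measurable] = iid_component_measurable[OF \<rho>]
  have m: "(\<lambda>w. config (\<lambda>i. \<Sum>j\<le>i. w j)) \<in> measurable S.S vague_borel"
    by (rule config_measurable) measurable
  have "RPP_law \<rho> = distr (distr (\<rho> \<Otimes>\<^sub>M S.S) S.S (\<lambda>(s, w). case_nat s w)) vague_borel (\<lambda>w. config (\<lambda>i. \<Sum>j\<le>i. w j))"
    by (simp only: S.PiM_iter RPP_law_def)
  also have "\<dots> = distr (\<rho> \<Otimes>\<^sub>M S.S) vague_borel ((\<lambda>w. config (\<lambda>i. \<Sum>j\<le>i. w j)) \<circ> (\<lambda>(s, w). case_nat s w))"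
    by (rule distr_distr[OF m]) measurable
  also have "(\<lambda>w. config (\<lambda>i. \<Sum>j\<le>i. w j)) \<circ> (\<lambda>(s, w). case_nat s w) = (\<lambda>(u, w). config (\<lambda>i. u + (\<Sum>j<i. w j)))"
    by (auto simp: fun_eq_iff lessThan_Suc_atMost[symmetric] sum.lessThan_Suc_shift simp del: sum.lessThan_Suc)
  finally show ?thesis by (simp add: DRPP_law_def)
qed

text \<open>Rewrites integrals over configurations as integrals over codes, extended by 0 outside
  \<open>decr_seqs\<close>, which is the form that \<open>cube_laws_converge\<close> treats.\<close>

lemma integral_coded:
  assumes P: "prob_space P" and c: "c \<in> measurable P vague_borel" and Z: "\<And>k. (\<lambda>x. Z x k) \<in> borel_measurable P"
    and ae: "AE x in P. Z x \<in> decr_seqs \<and> c x = decode (Z x)"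
    and \<phi>: "continuous_map vague_topology euclideanreal \<phi>"
  shows "cube_law (distr P borel Z)" 
    and "(\<integral>N. \<phi> N \<partial>distr P vague_borel c) = (\<integral>z. (if z \<in> decr_seqs then (\<phi> \<circ> decode) z else 0) \<partial>distr P borel Z)"
    and "continuous_on decr_seqs (\<phi> \<circ> decode)"
proof -
  interpret prob_space P by fact
  have Zm [measurable]: "Z \<in> borel_measurable P" by (rule measurable_coordinatewise_then_product[OF Z])
  have "AE z in distr P borel Z. z \<in> decr_seqs"
    using ae decr_seqs_borel by (subst AE_distr_iff) auto
  then show "cube_law (distr P borel Z)"
    by (intro cube_law.intro cube_law_axioms.intro prob_space_distr Zm) auto
  have "continuous_map (top_of_set decr_seqs) euclideanreal (\<phi> \<circ> decode)"
    by (rule continuous_map_compose[OF continuous_map_decode \<phi>])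
  then show co: "continuous_on decr_seqs (\<phi> \<circ> decode)" by simp
  have "(\<lambda>z. indicator decr_seqs z *\<^sub>R (\<phi> \<circ> decode) z) \<in> borel_measurable borel"
    by (rule borel_measurable_continuous_on_indicator[OF _ co]) (simp add: decr_seqs_borel)
  also have "(\<lambda>z. indicator decr_seqs z *\<^sub>R (\<phi> \<circ> decode) z) = (\<lambda>z. if z \<in> decr_seqs then (\<phi> \<circ> decode) z else 0)" by auto
  finally have m [measurable]: "(\<lambda>z. if z \<in> decr_seqs then (\<phi> \<circ> decode) z else 0) \<in> borel_measurable borel" .
  note [measurable] = continuous_map_borel_measurable_vague[OF \<phi>] c
  have "(\<integral>N. \<phi> N \<partial>distr P vague_borel c) = (\<integral>x. \<phi> (c x) \<partial>P)" by (rule integral_distr) measurable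
  also have "\<dots> = (\<integral>x. (if Z x \<in> decr_seqs then (\<phi> \<circ> decode) (Z x) else 0) \<partial>P)"
  proof (rule integral_cong_AE[OF _ measurable_compose[OF Zm m]])
    show "AE x in P. \<phi> (c x) = (if Z x \<in> decr_seqs then (\<phi> \<circ> decode) (Z x) else 0)"
      using ae by eventually_elim simp
  qed measurable
  also have "\<dots> = (\<integral>z. (if z \<in> decr_seqs then (\<phi> \<circ> decode) z else 0) \<partial>distr P borel Z)"
    by (rule integral_distr[symmetric, OF Zm m])
  finally show "(\<integral>N. \<phi> N \<partial>distr P vague_borel c) = \<dots>" .
qed

text \<open>The limits in \<open>lim\<close> are the monomial moments of the renewal code by
  \<open>renewal_monomial\<close>; \<open>lt\<close> ensures that the limit law is carried by
  genuine codes.\<close>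

lemma laws_converge_DRPP:
  assumes \<sigma>: "nonneg_law \<sigma>" and \<rho>: "nonneg_law \<rho>" and lt: "laplace \<rho> 1 < 1"
    and P: "\<And>n. prob_space (P n)" and c: "\<And>n. c n \<in> measurable (P n) vague_borel"
    and Z: "\<And>n k. (\<lambda>x. Z n x k) \<in> borel_measurable (P n)"
    and ae: "\<And>n. AE x in P n. Z n x \<in> decr_seqs \<and> c n x = decode (Z n x)"
    and lim: "\<And>e d. 0 < e d \<Longrightarrow> (\<lambda>n. \<integral>x. monomial e (Suc d) (Z n x) \<partial>P n)
      \<longlonglongrightarrow> laplace \<sigma> (hd (suffix_sums d e)) * prod_list (map (laplace \<rho>) (tl (suffix_sums d e)))"
  shows "laws_converge vague_topology (\<lambda>n. distr (P n) vague_borel (c n)) (DRPP_law \<sigma> \<rho>)"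
  unfolding laws_converge_def
proof (intro allI impI, elim conjE)
  fix \<phi> :: "real measure \<Rightarrow> real"
  assume \<phi>: "continuous_map vague_topology euclideanreal \<phi>" and b: "bounded (\<phi> ` topspace vague_topology)"
  then obtain C where C: "\<And>N. N \<in> point_configs \<Longrightarrow> \<bar>\<phi> N\<bar> \<le> C"
    unfolding topspace_vague_topology bounded_iff by auto
  interpret S: sequence_space \<rho> by (rule sequence_space_nonneg_law[OF \<rho>])
  interpret s: prob_space \<sigma> by (rule prob_space_nonneg_law[OF \<sigma>])
  interpret Q: pair_prob_space \<sigma> S.S ..
  let ?Q = "\<sigma> \<Otimes>\<^sub>M S.S" and ?c = "\<lambda>(u, w). config (\<lambda>i. u + (\<Sum>j<i. w j))"
  have Qp: "prob_space ?Q" by (rule Q.P.prob_space_axioms)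
  have ae': "AE p in ?Q. renewal_code p \<in> decr_seqs \<and> ?c p = decode (renewal_code p)"
    using renewal_code_AE[OF \<sigma> \<rho> lt]
  proof eventually_elim
    case (elim p)
    then show ?case using config_eq_decode[of "\<lambda>i. fst p + (\<Sum>j<i. snd p j)"]
      by (simp add: renewal_code_def[abs_def] case_prod_beta)
  qed
  note Lim = integral_coded[OF Qp DRPP_measurable[OF \<sigma> \<rho>] renewal_code_measurable[OF \<sigma> \<rho>] ae' \<phi>]
  note Pre = integral_coded[OF P c Z ae \<phi>]
  have "(\<lambda>n. \<integral>z. (if z \<in> decr_seqs then (\<phi> \<circ> decode) z else 0) \<partial>distr (P n) borel (Z n))
      \<longlonglongrightarrow> (\<integral>z. (if z \<in> decr_seqs then (\<phi> \<circ> decode) z else 0) \<partial>distr ?Q borel renewal_code)"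
  proof (rule cube_laws_converge[OF Pre(1) Lim(1) _ Lim(3)])
    fix z assume "z \<in> decr_seqs" then show "\<bar>(\<phi> \<circ> decode) z\<bar> \<le> C" using C decode_point_configs by simp
  next
    fix e :: "nat \<Rightarrow> nat" and d assume e: "0 < e d"
    have mm: "monomial e (Suc d) \<in> borel_measurable borel"
      by (intro borel_measurable_continuous_onI continuous_on_monomial)
    have 1: "(\<integral>z. monomial e (Suc d) z \<partial>distr (P n) borel (Z n)) = (\<integral>x. monomial e (Suc d) (Z n x) \<partial>P n)" for n
      by (rule integral_distr[OF measurable_coordinatewise_then_product[OF Z] mm])
    have "(\<integral>z. monomial e (Suc d) z \<partial>distr ?Q borel renewal_code) = (\<integral>p. monomial e (Suc d) (renewal_code p) \<partial>?Q)"
      by (rule integral_distr[OF measurable_coordinatewise_then_product[OF renewal_code_measurable[OF \<sigma> \<rho>]] mm])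
    also have "\<dots> = enn2real (\<integral>\<^sup>+p. ennreal (monomial e (Suc d) (renewal_code p)) \<partial>?Q)"
      by (rule integral_eq_nn_integral[OF monomial_renewal_measurable[OF \<sigma> \<rho>]])
         (auto simp: monomial_def renewal_code_def simp del: prod.lessThan_Suc intro!: prod_nonneg)
    also have "\<dots> = laplace \<sigma> (hd (suffix_sums d e)) * prod_list (map (laplace \<rho>) (tl (suffix_sums d e)))"
      unfolding renewal_monomial[OF \<sigma> \<rho>]
      by (intro enn2real_ennreal mult_nonneg_nonneg prod_list_nonneg) (auto simp: laplace_nonneg)
    finally show "(\<lambda>n. \<integral>z. monomial e (Suc d) z \<partial>distr (P n) borel (Z n)) \<longlonglongrightarrow> (\<integral>z. monomial e (Suc d) z \<partial>distr ?Q borel renewal_code)"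
      using lim[of e d, OF e] by (simp add: 1)
  qed
  then show "(\<lambda>n. \<integral>N. \<phi> N \<partial>distr (P n) vague_borel (c n)) \<longlonglongrightarrow> (\<integral>N. \<phi> N \<partial>DRPP_law \<sigma> \<rho>)"
    unfolding DRPP_law_def Pre(2) Lim(2) .
qed

section \<open>Hitting times\<close>

lemma Inf_enat_eq_iff:
  "Inf {enat n | n. P n} = enat m \<longleftrightarrow> P m \<and> (\<forall>j<m. \<not> P j)"
  "Inf {enat n | n. P n} = \<infinity> \<longleftrightarrow> (\<forall>n. \<not> P n)"
proof -
  let ?A = "{enat n | n. P n}"
  have in_A: "Inf ?A \<in> ?A" if "P n" for n
  proof -
    have "\<exists>x. x \<in> ?A" using that by blast
    then have "(LEAST x. x \<in> ?A) \<in> ?A" by (rule LeastI_ex)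
    then show ?thesis using that unfolding Inf_enat_def by auto
  qed
  have low: "Inf ?A \<le> enat n" if "P n" for n by (rule Inf_lower) (use that in auto)
  show "Inf ?A = \<infinity> \<longleftrightarrow> (\<forall>n. \<not> P n)"
  proof
    assume "Inf ?A = \<infinity>" then show "\<forall>n. \<not> P n" using low by force
  next
    assume "\<forall>n. \<not> P n" then have "?A = {}" by auto
    then show "Inf ?A = \<infinity>" unfolding Inf_enat_def by simp
  qed
  show "Inf ?A = enat m \<longleftrightarrow> P m \<and> (\<forall>j<m. \<not> P j)"
  proof
    assume eq: "Inf ?A = enat m"
    then obtain n where n: "P n" using \<open>Inf ?A = \<infinity> \<longleftrightarrow> (\<forall>n. \<not> P n)\<close> by force
    have "P m" using in_A[OF n] unfolding eq by auto
    moreover have "\<not> P j" if "j < m" for j using low[of j] that unfolding eq by auto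
    ultimately show "P m \<and> (\<forall>j<m. \<not> P j)" by blast
  next
    assume m: "P m \<and> (\<forall>j<m. \<not> P j)"
    then obtain n where n: "Inf ?A = enat n" "P n" using in_A[of m] by auto
    then have "n \<le> m" using low[of m] m by simp
    then show "Inf ?A = enat m" using n m by (metis le_neq_implies_less)
  qed
qed

lemma hit_time_Suc_eq_enat:
  "hit_time T B (Suc k) x = enat m \<longleftrightarrow>
    (hit_time T B k x < enat m \<and> (T ^^ m) x \<in> B) \<and> (\<forall>j<m. \<not> (hit_time T B k x < enat j \<and> (T ^^ j) x \<in> B))"
  unfolding hit_time.simps Inf_enat_eq_iff ..

lemma hit_time_Suc_eq_infinity:
  "hit_time T B (Suc k) x = \<infinity> \<longleftrightarrow> (\<forall>n. \<not> (hit_time T B k x < enat n \<and> (T ^^ n) x \<in> B))"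
  unfolding hit_time.simps Inf_enat_eq_iff ..

declare hit_time.simps(2) [simp del]

lemma hit_time_1_eq_enat:
  "hit_time T B 1 x = enat m \<longleftrightarrow> 0 < m \<and> (T ^^ m) x \<in> B \<and> (\<forall>j. 0 < j \<and> j < m \<longrightarrow> (T ^^ j) x \<notin> B)"
  unfolding One_nat_def hit_time_Suc_eq_enat by (auto simp: zero_enat_def)

lemma hit_time_1_eq_infinity:
  "hit_time T B 1 x = \<infinity> \<longleftrightarrow> (\<forall>j>0. (T ^^ j) x \<notin> B)"
  unfolding One_nat_def hit_time_Suc_eq_infinity by (simp add: zero_enat_def) (metis not_gr_zero)

lemma hit_time_less_Suc:
  "hit_time T B (Suc k) x = enat m \<Longrightarrow> hit_time T B k x < enat m"
  by (simp only: hit_time_Suc_eq_enat)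

lemma hit_time_ge: "enat k \<le> hit_time T B k x"
proof (induction k)
  case (Suc k)
  show ?case
  proof (cases "hit_time T B (Suc k) x")
    case (enat m)
    have "enat k < enat m" using le_less_trans[OF Suc hit_time_less_Suc[OF enat]] .
    then show ?thesis unfolding enat by simp
  next
    case infinity
    show ?thesis unfolding infinity by simp
  qed
qed (simp add: zero_enat_def)

lemma hit_time_infinity_Suc:
  "hit_time T B k x = \<infinity> \<Longrightarrow> hit_time T B (Suc k) x = \<infinity>"
  by (simp only: hit_time_Suc_eq_infinity) simp

text \<open>Each visit is sought strictly after the previous one, starting from time 0. Restarting
  the clock at the first visit therefore does not count that visit again.\<close>

lemma hit_time_shift:
  assumes m: "hit_time T B 1 x = enat m"
  shows "hit_time T B (Suc k) x = enat m + hit_time T B k ((T ^^ m) x)"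
proof (induction k)
  case 0
  show ?case using m by simp
next
  case (Suc k)
  let ?h = "hit_time T B k ((T ^^ m) x)"
  have P: "hit_time T B (Suc k) x < enat n \<and> (T ^^ n) x \<in> B
      \<longleftrightarrow> (\<exists>n'. n = m + n' \<and> ?h < enat n' \<and> (T ^^ n') ((T ^^ m) x) \<in> B)" for n
  proof -
    have "enat m + ?h < enat n \<longleftrightarrow> (\<exists>n'. n = m + n' \<and> ?h < enat n')"
    proof (cases ?h)
      case (enat h)
      have "m + h < n \<longleftrightarrow> (\<exists>n'. n = m + n' \<and> h < n')" by (auto intro: exI[of _ "n - m"])
      then show ?thesis unfolding enat by simp
    next
      case infinity
      show ?thesis unfolding infinity by simp
    qed
    moreover have "(T ^^ (m + n')) x = (T ^^ n') ((T ^^ m) x)" for n'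
      by (simp add: funpow_add add.commute[of m])
    ultimately show ?thesis unfolding Suc by metis
  qed
  show ?case
  proof (cases "hit_time T B (Suc k) ((T ^^ m) x)")
    case (enat n')
    have "hit_time T B (Suc (Suc k)) x = enat (m + n')"
      using enat unfolding hit_time_Suc_eq_enat P by auto
    then show ?thesis unfolding enat by simp
  next
    case infinity
    have "hit_time T B (Suc (Suc k)) x = \<infinity>"
      using infinity unfolding hit_time_Suc_eq_infinity P by auto
    then show ?thesis unfolding infinity by simp
  qed
qed

definition hit_code :: "('a \<Rightarrow> 'a) \<Rightarrow> 'a set \<Rightarrow> real \<Rightarrow> 'a \<Rightarrow> nat \<Rightarrow> real" where
  "hit_code T B g x k = (case hit_time T B (Suc k) x of enat n \<Rightarrow> exp (- g * real n) | \<infinity> \<Rightarrow> 0)"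

text \<open>The product of the exponentials \<open>exp (- s\<^sub>j g (r\<^sub>j - r\<^sub>j\<^sub>-\<^sub>1))\<close> over successive waiting times.\<close>

primrec hit_exp :: "('a \<Rightarrow> 'a) \<Rightarrow> 'a set \<Rightarrow> real \<Rightarrow> real list \<Rightarrow> 'a \<Rightarrow> real" where
  "hit_exp T B g [] x = 1"
| "hit_exp T B g (s # ss) x = (case hit_time T B 1 x of
     enat n \<Rightarrow> exp (- (s * g) * real n) * hit_exp T B g ss ((T ^^ n) x) | \<infinity> \<Rightarrow> 0)"

lemma hit_exp_bounds:
  assumes "0 \<le> g" "\<forall>s\<in>set ss. 0 \<le> s"
  shows "0 \<le> hit_exp T B g ss x \<and> hit_exp T B g ss x \<le> 1"
  using assms(2)
proof (induction ss arbitrary: x)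
  case (Cons s ss)
  have IH: "0 \<le> hit_exp T B g ss y \<and> hit_exp T B g ss y \<le> 1" for y using Cons by simp
  show ?case using IH assms(1) Cons.prems
    by (cases "hit_time T B 1 x") (auto intro!: mult_le_one)
qed simp

text \<open>The functional equation behind all dynamical arguments: one step of \<open>T\<close>
  costs one factor, and the list is shortened exactly when the step lands in \<open>B\<close>. It
  yields both the telescoping over visits and the asymptotic invariance.\<close>

lemma hit_exp_step:
  "hit_exp T B g (s # ss) x = exp (- (s * g)) * (if T x \<in> B then hit_exp T B g ss (T x) else hit_exp T B g (s # ss) (T x))"
proof (cases "T x \<in> B")
  case True
  then have "hit_time T B 1 x = enat 1" unfolding hit_time_1_eq_enat by auto
  then show ?thesis using True by simp
next
  case False
  show ?thesis
  proof (cases "hit_time T B 1 (T x)")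
    case (enat n)
    then have n: "0 < n \<and> (T ^^ n) (T x) \<in> B \<and> (\<forall>j. 0 < j \<and> j < n \<longrightarrow> (T ^^ j) (T x) \<notin> B)" unfolding hit_time_1_eq_enat .
    have "(T ^^ j) x \<notin> B" if "0 < j" "j < Suc n" for j
    proof (cases j)
      case (Suc i)
      then show ?thesis using n False that by (cases "i = 0") (auto simp: funpow_swap1)
    qed (use that in simp)
    then have "hit_time T B 1 x = enat (Suc n)" unfolding hit_time_1_eq_enat using n by (auto simp: funpow_swap1)
    then show ?thesis using enat False
      by (simp add: funpow_swap1 exp_add[symmetric] algebra_simps)
  next
    case infinity
    then have n: "\<forall>j>0. (T ^^ j) (T x) \<notin> B" unfolding hit_time_1_eq_infinity .
    have "(T ^^ j) x \<notin> B" if "0 < j" for j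
    proof (cases j)
      case (Suc i)
      then show ?thesis using n False that by (cases "i = 0") (auto simp: funpow_swap1)
    qed (use that in simp)
    then have "hit_time T B 1 x = \<infinity>" unfolding hit_time_1_eq_infinity by blast
    then show ?thesis using infinity False by simp
  qed
qed

lemma hit_exp_iterate:
  assumes "\<And>j. 0 < j \<Longrightarrow> j \<le> n \<Longrightarrow> (T ^^ j) x \<notin> B"
  shows "hit_exp T B g (s # ss) x = exp (- (s * g) * real n) * hit_exp T B g (s # ss) ((T ^^ n) x)"
  using assms
proof (induction n)
  case (Suc n)
  have "hit_exp T B g (s # ss) x = exp (- (s * g) * real n) * hit_exp T B g (s # ss) ((T ^^ n) x)"
    by (rule Suc.IH) (use Suc.prems in auto)
  also have "hit_exp T B g (s # ss) ((T ^^ n) x) = exp (- (s * g)) * hit_exp T B g (s # ss) ((T ^^ Suc n) x)"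
    using Suc.prems[of "Suc n"] hit_exp_step[of T B g s ss "(T ^^ n) x"] by (simp del: hit_exp.simps)
  finally show ?case by (simp add: exp_add[symmetric] algebra_simps del: hit_exp.simps)
qed simp

lemma hit_code_decr_seqs:
  assumes g: "0 < g" shows "hit_code T B g x \<in> decr_seqs"
proof -
  \<comment> \<open>The visit number \<open>Suc k\<close> cannot take place before time
    \<open>Suc k\<close>. So the code decays geometrically at every point, not only almost
    everywhere.\<close>
  have b: "0 \<le> hit_code T B g x k \<and> hit_code T B g x k \<le> exp (- g * real (Suc k))" for k
  proof (cases "hit_time T B (Suc k) x")
    case (enat n)
    then have "Suc k \<le> n" using hit_time_ge[of "Suc k" T B x] by simp
    then show ?thesis using enat g by (simp add: hit_code_def)
  qed (simp add: hit_code_def)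
  have "hit_code T B g x k \<le> 1" for k
  proof -
    have "exp (- g * real (Suc k)) \<le> 1" using g by simp
    then show ?thesis using b[of k] by linarith
  qed
  moreover have "hit_code T B g x (Suc k) \<le> hit_code T B g x k" for k
  proof (cases "hit_time T B (Suc (Suc k)) x")
    case (enat n)
    then have "hit_time T B (Suc k) x < enat n" by (rule hit_time_less_Suc)
    then obtain m where "hit_time T B (Suc k) x = enat m" "m < n" by (cases "hit_time T B (Suc k) x") auto
    then show ?thesis using enat g unfolding hit_code_def by simp
  next
    case infinity
    then have "hit_code T B g x (Suc k) = 0" unfolding hit_code_def by simp
    then show ?thesis using b[of k] by simp
  qed
  moreover have "hit_code T B g x \<longlonglongrightarrow> 0"
  proof (rule tendsto_sandwich[of "\<lambda>_. 0"])
    have "(\<lambda>k. exp (- g) ^ Suc k) \<longlonglongrightarrow> 0"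
      using g by (intro LIMSEQ_Suc LIMSEQ_realpow_zero) auto
    also have "(\<lambda>k. exp (- g) ^ Suc k) = (\<lambda>k. exp (- g * real (Suc k)))"
      by (simp only: exp_of_nat_mult[symmetric] mult.commute)
    finally show "(\<lambda>k. exp (- g * real (Suc k))) \<longlonglongrightarrow> 0" .
  qed (use b in auto)
  ultimately show ?thesis using b by (auto simp: decr_seqs_def decseq_Suc_iff)
qed

text \<open>Exponents on the points become suffix sums on the waiting times. When one of the visits
  involved is missing both sides are 0, on the left because the last exponent is positive and the
  last entry vanishes.\<close>

lemma monomial_hit_code:
  "0 < e d \<Longrightarrow> monomial e (Suc d) (hit_code T B g x) = hit_exp T B g (suffix_sums d e) x"
proof (induction d arbitrary: e x)
  case 0
  show ?case
    using 0 by (cases "hit_time T B 1 x") (auto simp: monomial_def hit_code_def exp_of_nat_mult[symmetric] mult_ac)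
next
  case (Suc d)
  show ?case
  proof (cases "hit_time T B 1 x")
    case (enat m)
    have "monomial e (Suc (Suc d)) (hit_code T B g x)
        = exp (- g * real m) ^ (\<Sum>k\<le>Suc d. e k) * monomial (\<lambda>k. e (Suc k)) (Suc d) (hit_code T B g ((T ^^ m) x))"
    proof (rule monomial_Suc_shift)
      show "hit_code T B g x (Suc k) = exp (- g * real m) * hit_code T B g ((T ^^ m) x) k" for k
        unfolding hit_code_def hit_time_shift[OF enat, of "Suc k"]
        by (cases "hit_time T B (Suc k) ((T ^^ m) x)") (auto simp: exp_add[symmetric] algebra_simps)
      show "hit_code T B g x 0 = exp (- g * real m)" using enat by (simp add: hit_code_def)
    qed
    also have "exp (- g * real m) ^ (\<Sum>k\<le>Suc d. e k) = exp (- (real (\<Sum>k\<le>Suc d. e k) * g) * real m)"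
      by (simp only: exp_of_nat_mult[symmetric]) (simp add: mult_ac del: sum.atMost_Suc of_nat_sum)
    finally show ?thesis using Suc enat by simp
  next
    case infinity
    then have "hit_time T B (Suc k) x = \<infinity>" for k by (induction k) (simp, simp only: hit_time_infinity_Suc)
    then have "hit_code T B g x k = 0" for k unfolding hit_code_def by (simp only: enat.case)
    then have "monomial e (Suc (Suc d)) (hit_code T B g x) = 0"
      unfolding monomial_def using Suc.prems by (intro prod_zero) (auto intro: bexI[of _ "Suc d"])
    then show ?thesis using infinity by simp
  qed
qed

declare hit_exp.simps(2) [simp del]

lemma hit_process_eq_decode:
  assumes g: "0 < scaling a (measure M B)"
  shows "hit_process M T a B x = decode (hit_code T B (scaling a (measure M B)) x)"
proof (rule measure_eqI)
  let ?g = "scaling a (measure M B)"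
  let ?z = "hit_code T B ?g x"
  let ?I = "{k. 1 \<le> k \<and> hit_time T B k x \<noteq> \<infinity>}" and ?t = "\<lambda>k. ?g * real (the_enat (hit_time T B k x))"
  show "sets (hit_process M T a B x) = sets (decode ?z)" by (simp add: hit_process_def decode_def)
  fix A assume "A \<in> sets (hit_process M T a B x)"
  then have A: "A \<in> sets nonneg_borel" by (simp add: hit_process_def)
  have pos: "0 < ?z k \<longleftrightarrow> hit_time T B (Suc k) x \<noteq> \<infinity>" for k
    by (cases "hit_time T B (Suc k) x") (simp_all add: hit_code_def)
  have val: "- ln (?z k) = ?t (Suc k)" if "hit_time T B (Suc k) x \<noteq> \<infinity>" for k
    using that by (cases "hit_time T B (Suc k) x") (simp_all add: hit_code_def)
  \<comment> \<open>Visits are numbered from 1 in \<open>hit_process\<close> and from 0 in the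
    code.\<close>
  have b: "bij_betw Suc {k \<in> {k. 0 < ?z k}. - ln (?z k) \<in> A} {k \<in> ?I. ?t k \<in> A}"
  proof (rule bij_betwI[where g="\<lambda>k. k - 1"])
    show "Suc \<in> {k \<in> {k. 0 < ?z k}. - ln (?z k) \<in> A} \<rightarrow> {k \<in> ?I. ?t k \<in> A}"
      using val unfolding pos by auto
    show "(\<lambda>k. k - 1) \<in> {k \<in> ?I. ?t k \<in> A} \<rightarrow> {k \<in> {k. 0 < ?z k}. - ln (?z k) \<in> A}"
    proof
      fix k assume k: "k \<in> {k \<in> ?I. ?t k \<in> A}"
      then obtain j where j: "k = Suc j" by (cases k) auto
      show "k - 1 \<in> {k \<in> {k. 0 < ?z k}. - ln (?z k) \<in> A}" using k val[of j] unfolding j pos by (simp del: hit_time.simps)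
    qed
  qed auto
  show "emeasure (hit_process M T a B x) A = emeasure (decode ?z) A"
  proof -
    have count: "emeasure (count_space J) {k \<in> J. P k} = (if finite {k \<in> J. P k} then of_nat (card {k \<in> J. P k}) else \<infinity>)"
      for J :: "nat set" and P by (rule emeasure_count_space) auto
    show ?thesis
      unfolding hit_process_def decode_def emeasure_dirac_sum[OF A] count
        bij_betw_finite[OF b] bij_betw_same_card[OF b] ..
  qed
qed

context mp_system
begin

lemma hit_time_measurable:
  assumes [measurable]: "B \<in> sets M"
  shows "hit_time T B k \<in> measurable M (count_space UNIV)"
proof (induction k)
  case (Suc k)
  note [measurable] = Suc
  have p: "Measurable.pred M (\<lambda>x. hit_time T B (Suc k) x = enat m)" for m
    unfolding hit_time_Suc_eq_enat by measurable
  have q: "Measurable.pred M (\<lambda>x. hit_time T B (Suc k) x = \<infinity>)"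
    unfolding hit_time_Suc_eq_infinity by measurable
  have "hit_time T B (Suc k) -` {e} \<inter> space M \<in> sets M" for e
    using p q by (cases e) (auto simp: pred_def vimage_def Int_def conj_commute simp del: hit_time.simps)
  then show ?case by (subst measurable_count_space_eq2_countable) auto
qed (simp add: zero_enat_def)

lemma hit_exp_measurable:
  assumes [measurable]: "B \<in> sets M"
  shows "hit_exp T B g ss \<in> borel_measurable M"
proof (induction ss)
  case (Cons s ss)
  note [measurable] = Cons hit_time_measurable[OF assms]
  have eq: "hit_exp T B g (s # ss) = (\<lambda>x. case hit_time T B 1 x of
     enat n \<Rightarrow> exp (- (s * g) * real n) * hit_exp T B g ss ((T ^^ n) x) | \<infinity> \<Rightarrow> 0)"
    by (auto simp: hit_exp.simps)
  show ?case unfolding eq by measurable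
qed simp

lemma hit_code_measurable:
  assumes [measurable]: "B \<in> sets M"
  shows "(\<lambda>x. hit_code T B g x k) \<in> borel_measurable M"
proof -
  note [measurable] = hit_time_measurable[OF assms]
  show ?thesis unfolding hit_code_def by measurable
qed

end

lemma decode_measurable:
  assumes Z: "\<And>k. (\<lambda>x. Z x k) \<in> borel_measurable \<Omega>" and G: "\<And>x. x \<in> space \<Omega> \<Longrightarrow> Z x \<in> decr_seqs"
  shows "(\<lambda>x. decode (Z x)) \<in> measurable \<Omega> vague_borel"
proof (rule measurable_vague_borelI)
  fix t :: real assume t: "0 \<le> t"
  have "emeasure (decode (Z x)) {0..t} = (\<Sum>k. indicator {exp (- t)..} (Z x k))" if "x \<in> space \<Omega>" for x
  proof -
    have "emeasure (decode (Z x)) {0..t} = (\<integral>\<^sup>+k. indicator {k. exp (- t) \<le> Z x k} k \<partial>count_space UNIV)"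
      unfolding emeasure_decode_Icc[OF G[OF that] t] by (subst nn_integral_indicator) auto
    also have "\<dots> = (\<Sum>k. indicator {exp (- t)..} (Z x k))"
      unfolding nn_integral_count_space_nat by (intro suminf_cong) (simp add: indicator_def)
    finally show ?thesis .
  qed
  moreover have "(\<lambda>x. \<Sum>k. indicator {exp (- t)..} (Z x k) :: ennreal) \<in> borel_measurable \<Omega>"
    using Z by measurable
  ultimately show "(\<lambda>x. emeasure (decode (Z x)) {0..t}) \<in> borel_measurable \<Omega>"
    by (simp cong: measurable_cong)
qed (use G decode_point_configs in auto)

section \<open>Uniform sets\<close>

text \<open>Summation by parts. The exponent \<open>Suc k\<close> is the right one because
  \<open>d k\<close> first enters the partial sum over \<open>k<n\<close> at
  \<open>n = Suc k\<close>.\<close>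

lemma finite_abel_sum:
  fixes d :: "nat \<Rightarrow> real"
  shows "(\<Sum>k<N. r ^ Suc k * d k) = r ^ N * (\<Sum>k<N. d k) + (1 - r) * (\<Sum>n<N. r ^ n * (\<Sum>k<n. d k))"
  by (induction N) (simp_all add: algebra_simps)

text \<open>Averages the bound \<open>U\<close> with the weights \<open>(1 - r) * r ^ n\<close>.
  These have total mass 1, so the constant \<open>K\<close> is not enlarged. The factor
  \<open>r\<close> in front of \<open>l\<close> is left over from the summation by parts.\<close>

lemma abel_bound:
  fixes c d :: "nat \<Rightarrow> real"
  assumes r: "0 < r" "r < 1" and c: "summable (\<lambda>n. r ^ n * c n)"
    and m: "0 \<le> m" and K: "0 \<le> K"
    and U: "\<And>N. \<bar>(\<Sum>k<N. d k) - a * c N\<bar> \<le> m * (\<epsilon> * c N + K)"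
    and L: "(\<lambda>N. \<Sum>k<N. r ^ k * d k) \<longlonglongrightarrow> l"
  shows "\<bar>r * l - a * ((1 - r) * (\<Sum>n. r ^ n * c n))\<bar> \<le> m * (\<epsilon> * ((1 - r) * (\<Sum>n. r ^ n * c n)) + K)"
proof -
  define U where "U N = (\<Sum>k<N. d k)" for N
  have c0: "(\<lambda>n. r ^ n * c n) \<longlonglongrightarrow> 0" by (rule summable_LIMSEQ_zero[OF c])
  have r0: "(\<lambda>n. r ^ n) \<longlonglongrightarrow> 0" using r by (intro LIMSEQ_realpow_zero) auto
  \<comment> \<open>Together with \<open>c0\<close> this removes the boundary term
    \<open>r ^ N * U N\<close> of the summation by parts.\<close>
  have "(\<lambda>N. r ^ N * (U N - a * c N)) \<longlonglongrightarrow> 0"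
  proof (rule tendsto_0_le[where K=1])
    show "(\<lambda>N. m * (\<epsilon> * (r ^ N * c N) + r ^ N * K)) \<longlonglongrightarrow> 0"
      using tendsto_mult[OF tendsto_const[of m] tendsto_add[OF tendsto_mult[OF tendsto_const[of \<epsilon>] c0] tendsto_mult[OF r0 tendsto_const[of K]]]]
      by simp
    show "\<forall>\<^sub>F N in sequentially. norm (r ^ N * (U N - a * c N)) \<le> norm (m * (\<epsilon> * (r ^ N * c N) + r ^ N * K)) * 1"
    proof (rule always_eventually, rule allI)
      fix N
      have "norm (r ^ N * (U N - a * c N)) = r ^ N * \<bar>U N - a * c N\<bar>" using r by (simp add: abs_mult)
      also have "\<dots> \<le> r ^ N * (m * (\<epsilon> * c N + K))" using U[of N] r by (intro mult_left_mono) (auto simp: U_def)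
      also have "\<dots> = m * (\<epsilon> * (r ^ N * c N) + r ^ N * K)" by (simp add: algebra_simps)
      finally show "norm (r ^ N * (U N - a * c N)) \<le> norm (m * (\<epsilon> * (r ^ N * c N) + r ^ N * K)) * 1" by simp
    qed
  qed
  from tendsto_add[OF this tendsto_mult[OF tendsto_const[of a] c0]]
  have U0: "(\<lambda>N. r ^ N * U N) \<longlonglongrightarrow> 0" by (simp add: algebra_simps)
  have "(\<lambda>N. (\<Sum>k<N. r ^ Suc k * d k) - r ^ N * U N) \<longlonglongrightarrow> r * l - 0"
    using tendsto_mult[OF tendsto_const[of r] L] by (intro tendsto_diff U0) (simp add: sum_distrib_left mult_ac)
  then have lim: "(\<lambda>N. (1 - r) * (\<Sum>n<N. r ^ n * U n)) \<longlonglongrightarrow> r * l"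
    unfolding finite_abel_sum U_def by simp
  have cs: "(\<lambda>N. \<Sum>n<N. r ^ n * c n) \<longlonglongrightarrow> (\<Sum>n. r ^ n * c n)" by (rule summable_LIMSEQ[OF c])
  have fin: "\<bar>(1 - r) * (\<Sum>n<N. r ^ n * U n) - a * ((1 - r) * (\<Sum>n<N. r ^ n * c n))\<bar>
      \<le> m * (\<epsilon> * ((1 - r) * (\<Sum>n<N. r ^ n * c n)) + K)" for N
  proof -
    have "(1 - r) * (\<Sum>n<N. r ^ n * U n) - a * ((1 - r) * (\<Sum>n<N. r ^ n * c n))
        = (1 - r) * (\<Sum>n<N. r ^ n * (U n - a * c n))"
      by (simp add: sum_subtractf sum_distrib_left algebra_simps)
    also have "\<bar>\<dots>\<bar> \<le> (1 - r) * (\<Sum>n<N. r ^ n * \<bar>U n - a * c n\<bar>)"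
      using r sum_abs[of "\<lambda>n. r ^ n * (U n - a * c n)" "{..<N}"] by (simp add: abs_mult)
    also have "\<dots> \<le> (1 - r) * (\<Sum>n<N. r ^ n * (m * (\<epsilon> * c n + K)))"
      using r U by (intro mult_left_mono sum_mono) (auto simp: U_def)
    also have "\<dots> = m * (\<epsilon> * ((1 - r) * (\<Sum>n<N. r ^ n * c n)) + K * ((1 - r) * (\<Sum>n<N. r ^ n)))"
      by (simp add: sum.distrib sum_distrib_left algebra_simps)
    also have "(1 - r) * (\<Sum>n<N. r ^ n) = 1 - r ^ N" using r by (simp add: sum_gp_strict)
    also have "m * (\<epsilon> * ((1 - r) * (\<Sum>n<N. r ^ n * c n)) + K * (1 - r ^ N))
        \<le> m * (\<epsilon> * ((1 - r) * (\<Sum>n<N. r ^ n * c n)) + K)"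
      using r m K by (intro mult_left_mono add_left_mono) (auto simp: mult_left_le)
    finally show ?thesis .
  qed
  have "(\<lambda>N. \<bar>(1 - r) * (\<Sum>n<N. r ^ n * U n) - a * ((1 - r) * (\<Sum>n<N. r ^ n * c n))\<bar>)
      \<longlonglongrightarrow> \<bar>r * l - a * ((1 - r) * (\<Sum>n. r ^ n * c n))\<bar>"
    by (intro tendsto_intros lim cs)
  moreover have "(\<lambda>N. m * (\<epsilon> * ((1 - r) * (\<Sum>n<N. r ^ n * c n)) + K))
      \<longlonglongrightarrow> m * (\<epsilon> * ((1 - r) * (\<Sum>n. r ^ n * c n)) + K)"
    by (intro tendsto_intros cs)
  ultimately show ?thesis by (rule LIMSEQ_le) (use fin in blast)
qed

section \<open>Transfer sums over subsets of a uniform set\<close>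

locale uniform_system = cempt_system M T + regular_growth c \<alpha>
  for M :: "'a measure" and T :: "'a \<Rightarrow> 'a" and c :: "nat \<Rightarrow> real" and \<alpha> :: real +
  fixes Y :: "'a set" and f :: "'a \<Rightarrow> real" and I :: real
  assumes Y_sets [measurable]: "Y \<in> sets M" and Y_fin: "emeasure M Y < \<infinity>"
    and f_int: "integrable M f" and f_nonneg: "AE x in M. 0 \<le> f x"
    and I_eq: "(\<integral>x. f x \<partial>M) = I" and I_pos: "0 < I"
    and unif: "\<And>\<epsilon>. 0 < \<epsilon> \<Longrightarrow> \<exists>N0. \<forall>N\<ge>N0. AE x in M. x \<in> Y \<longrightarrow> \<bar>(\<Sum>k<N. (L ^^ k) f x) - I * c N\<bar> \<le> \<epsilon> * c N"
begin

lemma finite_subset_Y: "B \<in> sets M \<Longrightarrow> B \<subseteq> Y \<Longrightarrow> emeasure M B < \<infinity>"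
  using emeasure_mono[of B Y M] Y_fin by (auto intro: le_less_trans)

text \<open>What matters is that \<open>K\<close> depends on \<open>\<epsilon>\<close> alone and
  that the whole error carries the factor \<open>measure M B\<close>. From \<open>N0\<close> on,
  uniformity gives the estimate; an earlier sum is at most the sum up to \<open>N0\<close> with
  \<open>D\<close> replaced by the indicator of \<open>B\<close>, since the functions
  \<open>(L ^^ k) f\<close> are nonnegative.\<close>

lemma partial_sum_bound:
  assumes \<epsilon>: "0 < \<epsilon>"
  shows "\<exists>K\<ge>0. \<forall>B D N. B \<in> sets M \<longrightarrow> B \<subseteq> Y \<longrightarrow> D \<in> borel_measurable M \<longrightarrow> (\<forall>x. \<bar>D x\<bar> \<le> indicator B x) \<longrightarrow>
    \<bar>(\<Sum>k<N. \<integral>x. (L ^^ k) f x * D x \<partial>M) - (I * (\<integral>x. D x \<partial>M)) * c N\<bar> \<le> measure M B * (\<epsilon> * c N + K)"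
proof -
  obtain N0 where N0: "\<And>N. N \<ge> N0 \<Longrightarrow> AE x in M. x \<in> Y \<longrightarrow> \<bar>(\<Sum>k<N. (L ^^ k) f x) - I * c N\<bar> \<le> \<epsilon> * c N"
    using unif[OF \<epsilon>] by blast
  \<comment> \<open>An early sum is at most \<open>I * c N0 + \<epsilon> * c N0\<close> times the
    measure of \<open>B\<close>, and the quantity subtracted from it at most \<open>I * c N0\<close>
    times that measure.\<close>
  define K where "K = 2 * I * c N0 + \<epsilon> * c N0"
  have K0: "0 \<le> K" using I_pos \<epsilon> c_nonneg by (auto simp: K_def)
  show ?thesis
  proof (intro exI[of _ K] conjI K0 allI impI)
    fix B and D :: "'a \<Rightarrow> real" and N
    assume B [measurable]: "B \<in> sets M" and BY: "B \<subseteq> Y" and D [measurable]: "D \<in> borel_measurable M"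
      and Db: "\<forall>x. \<bar>D x\<bar> \<le> indicator B x"
    have fin: "emeasure M B < \<infinity>" by (rule finite_subset_Y[OF B BY])
    have iB: "integrable M (indicator B :: 'a \<Rightarrow> real)" using fin by simp
    have iL: "integrable M (\<lambda>x. (L ^^ k) f x * G x)"
      if "G \<in> borel_measurable M" "\<forall>x. \<bar>G x\<bar> \<le> indicator B x" for k G
    proof (rule integrable_mult_AE_bounded[OF integrable_Ln[OF f_int] that(1), where C=1], rule AE_I2)
      fix x show "\<bar>G x\<bar> \<le> 1" by (rule order_trans[OF that(2)[rule_format, of x] indicator_le_1])
    qed
    have big: "\<bar>(\<Sum>k<N. \<integral>x. (L ^^ k) f x * G x \<partial>M) - (I * (\<integral>x. G x \<partial>M)) * c N\<bar> \<le> measure M B * (\<epsilon> * c N)"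
      if G [measurable]: "G \<in> borel_measurable M" "\<forall>x. \<bar>G x\<bar> \<le> indicator B x" and N: "N \<ge> N0" for G N
    proof -
      have iG: "integrable M G"
        by (rule Bochner_Integration.integrable_bound[OF iB]) (use that in auto)
      note iLk = iL[OF that(1,2)]
      have e: "(\<Sum>k<N. \<integral>x. (L ^^ k) f x * G x \<partial>M) - (I * (\<integral>x. G x \<partial>M)) * c N
          = (\<integral>x. (\<Sum>k<N. (L ^^ k) f x * G x) - (I * c N) * G x \<partial>M)"
        using iLk iG by (simp add: Bochner_Integration.integral_diff Bochner_Integration.integral_sum)
      have "\<bar>\<integral>x. (\<Sum>k<N. (L ^^ k) f x * G x) - (I * c N) * G x \<partial>M\<bar>
          \<le> (\<integral>x. \<bar>(\<Sum>k<N. (L ^^ k) f x * G x) - (I * c N) * G x\<bar> \<partial>M)"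
        by (rule integral_abs_bound)
      also have "\<dots> \<le> (\<integral>x. (\<epsilon> * c N) * indicator B x \<partial>M)"
      proof (rule integral_mono_AE)
        show "integrable M (\<lambda>x. \<bar>(\<Sum>k<N. (L ^^ k) f x * G x) - (I * c N) * G x\<bar>)"
          using iLk iG by (intro integrable_abs Bochner_Integration.integrable_diff Bochner_Integration.integrable_sum) auto
        show "AE x in M. \<bar>(\<Sum>k<N. (L ^^ k) f x * G x) - (I * c N) * G x\<bar> \<le> (\<epsilon> * c N) * indicator B x"
          using N0[OF N]
        proof eventually_elim
          case (elim x)
          have e: "(\<Sum>k<N. (L ^^ k) f x * G x) - (I * c N) * G x = ((\<Sum>k<N. (L ^^ k) f x) - I * c N) * G x"
            by (simp add: sum_distrib_right left_diff_distrib)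
          show ?case
          proof (cases "x \<in> B")
            case True
            then have "\<bar>(\<Sum>k<N. (L ^^ k) f x) - I * c N\<bar> * \<bar>G x\<bar> \<le> (\<epsilon> * c N) * 1"
              using elim BY that(2)[rule_format, of x] by (intro mult_mono) auto
            then show ?thesis using True unfolding e abs_mult by simp
          next
            case False
            then have "G x = 0" using that(2)[rule_format, of x] by simp
            then show ?thesis using False by simp
          qed
        qed
      qed (use iB in simp)
      also have "\<dots> = measure M B * (\<epsilon> * c N)" by (simp add: mult.commute)
      finally show ?thesis unfolding e .
    qed
    have cN: "0 \<le> measure M B * (\<epsilon> * c N)" using \<epsilon> c_nonneg by simp
    show "\<bar>(\<Sum>k<N. \<integral>x. (L ^^ k) f x * D x \<partial>M) - (I * (\<integral>x. D x \<partial>M)) * c N\<bar> \<le> measure M B * (\<epsilon> * c N + K)"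
    proof (cases "N0 \<le> N")
      case True
      have "0 \<le> measure M B * K" using K0 by simp
      then show ?thesis using big[OF D Db True] by (simp add: distrib_left)
    next
      case False
      have Ib: "\<bar>\<integral>x. D x \<partial>M\<bar> \<le> measure M B"
      proof -
        have "\<bar>\<integral>x. D x \<partial>M\<bar> \<le> (\<integral>x. \<bar>D x\<bar> \<partial>M)" by (rule integral_abs_bound)
        also have "\<dots> \<le> (\<integral>x. indicator B x \<partial>M)"
          using Db iB by (intro integral_mono integrable_abs Bochner_Integration.integrable_bound[OF iB]) auto
        finally show ?thesis by simp
      qed
      have nnk: "0 \<le> (\<integral>x. (L ^^ k) f x * indicator B x \<partial>M)" for k
        using Ln_nonneg[OF f_int f_nonneg, of k] by (intro integral_nonneg_AE) (auto elim!: eventually_mono)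
      have "\<bar>\<Sum>k<N. \<integral>x. (L ^^ k) f x * D x \<partial>M\<bar> \<le> (\<Sum>k<N. \<integral>x. (L ^^ k) f x * indicator B x \<partial>M)"
      proof (rule order_trans[OF sum_abs sum_mono])
        fix k
        have "\<bar>\<integral>x. (L ^^ k) f x * D x \<partial>M\<bar> \<le> (\<integral>x. \<bar>(L ^^ k) f x * D x\<bar> \<partial>M)"
          by (rule integral_abs_bound)
        also have "\<dots> \<le> (\<integral>x. (L ^^ k) f x * indicator B x \<partial>M)"
        proof (rule integral_mono_AE)
          show "AE x in M. \<bar>(L ^^ k) f x * D x\<bar> \<le> (L ^^ k) f x * indicator B x"
            using Ln_nonneg[OF f_int f_nonneg, of k] by eventually_elim (simp add: abs_mult mult_left_mono Db)
        qed (use iL[OF D Db] iL[of "indicator B"] in auto)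
        finally show "\<bar>\<integral>x. (L ^^ k) f x * D x \<partial>M\<bar> \<le> (\<integral>x. (L ^^ k) f x * indicator B x \<partial>M)" .
      qed
      also have "\<dots> \<le> (\<Sum>k<N0. \<integral>x. (L ^^ k) f x * indicator B x \<partial>M)"
        using False nnk by (intro sum_mono2) auto
      also have "\<dots> \<le> (I * measure M B) * c N0 + measure M B * (\<epsilon> * c N0)"
        using big[of "indicator B" N0] unfolding abs_le_iff by simp
      finally have 1: "\<bar>\<Sum>k<N. \<integral>x. (L ^^ k) f x * D x \<partial>M\<bar> \<le> (I * measure M B) * c N0 + measure M B * (\<epsilon> * c N0)" .
      have 2: "\<bar>(I * (\<integral>x. D x \<partial>M)) * c N\<bar> \<le> (I * measure M B) * c N0"
        using Ib I_pos c_nonneg[of N] monoD[OF c_mono, of N N0] False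
        by (simp add: abs_mult, intro mult_mono) auto
      have "\<bar>(\<Sum>k<N. \<integral>x. (L ^^ k) f x * D x \<partial>M) - (I * (\<integral>x. D x \<partial>M)) * c N\<bar> \<le> measure M B * K"
        using abs_triangle_ineq4[of "\<Sum>k<N. \<integral>x. (L ^^ k) f x * D x \<partial>M" "(I * (\<integral>x. D x \<partial>M)) * c N"] 1 2
        by (simp add: K_def algebra_simps)
      then show ?thesis using cN by (simp add: distrib_left)
    qed
  qed
qed

text \<open>
  Telescoping over the visits to \<open>B\<close>: with \<open>Q = hit_exp (s # ss)\<close> and \<open>P\<close> equal to \<open>hit_exp ss\<close> on \<open>B\<close>
  and to \<open>Q\<close> elsewhere, \<open>P = (P - Q) + r * (P \<circ> T)\<close>.
\<close>

lemma hit_exp_series: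
  assumes B [measurable]: "B \<in> sets M" and g: "0 < g" and s: "0 < s" and ss: "\<forall>t\<in>set ss. 0 \<le> t"
    and u: "integrable M u"
  defines "D \<equiv> \<lambda>x. indicator B x * (hit_exp T B g ss x - hit_exp T B g (s # ss) x)"
  shows "(\<lambda>N. \<Sum>k<N. exp (- (s * g)) ^ k * (\<integral>x. (L ^^ k) u x * D x \<partial>M))
    \<longlonglongrightarrow> (\<integral>x. u x * (hit_exp T B g (s # ss) x + D x) \<partial>M)"
proof -
  let ?H = "hit_exp T B g ss" and ?Q = "hit_exp T B g (s # ss)" and ?r = "exp (- (s * g))"
  define P where "P x = ?Q x + D x" for x
  have r: "0 < ?r" "?r < 1" using s g by auto
  have Hb: "0 \<le> ?H x \<and> ?H x \<le> 1" for x using g ss by (intro hit_exp_bounds) auto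
  have Qb: "0 \<le> ?Q x \<and> ?Q x \<le> 1" for x using g ss s by (intro hit_exp_bounds) auto
  have [measurable]: "?H \<in> borel_measurable M" "?Q \<in> borel_measurable M" by (intro hit_exp_measurable B)+
  have Dm [measurable]: "D \<in> borel_measurable M" unfolding D_def by measurable
  have Pm [measurable]: "P \<in> borel_measurable M" unfolding P_def[abs_def] by measurable
  have Peq: "P x = (if x \<in> B then ?H x else ?Q x)" for x by (simp add: P_def D_def)
  have Pb: "\<bar>P x\<bar> \<le> 1" for x unfolding Peq using Hb Qb by (simp add: abs_le_iff)
  have Db: "\<bar>D x\<bar> \<le> 1" for x
    using Hb[of x] Qb[of x] by (auto simp: D_def indicator_def abs_le_iff)
  have step: "P x = D x + ?r * P (T x)" for x
    unfolding P_def[of x] Peq[of "T x"] using hit_exp_step[of T B g s ss x] by simp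
  have iter: "P x = (\<Sum>k<N. ?r ^ k * D ((T ^^ k) x)) + ?r ^ N * P ((T ^^ N) x)" for N x
  proof (induction N)
    case (Suc N)
    show ?case unfolding Suc using step[of "(T ^^ N) x"] by (simp add: algebra_simps)
  qed simp
  have i: "integrable M (\<lambda>x. u x * G ((T ^^ k) x))" if "G \<in> borel_measurable M" "\<And>x. \<bar>G x\<bar> \<le> 1" for G k
    using that by (intro integrable_mult_AE_bounded[OF u, where C=1]) auto
  have int: "(\<integral>x. u x * P x \<partial>M) = (\<Sum>k<N. ?r ^ k * (\<integral>x. (L ^^ k) u x * D x \<partial>M)) + ?r ^ N * (\<integral>x. u x * P ((T ^^ N) x) \<partial>M)" for N
  proof -
    have "(\<integral>x. u x * P x \<partial>M) = (\<integral>x. (\<Sum>k<N. ?r ^ k * (u x * D ((T ^^ k) x))) + ?r ^ N * (u x * P ((T ^^ N) x)) \<partial>M)"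
    proof (rule Bochner_Integration.integral_cong[OF refl])
      fix x
      show "u x * P x = (\<Sum>k<N. ?r ^ k * (u x * D ((T ^^ k) x))) + ?r ^ N * (u x * P ((T ^^ N) x))"
        by (subst iter[of x N]) (simp add: distrib_left sum_distrib_left mult_ac)
    qed
    also have "\<dots> = (\<Sum>k<N. ?r ^ k * (\<integral>x. u x * D ((T ^^ k) x) \<partial>M)) + ?r ^ N * (\<integral>x. u x * P ((T ^^ N) x) \<partial>M)"
      using i[OF Dm Db] i[OF Pm Pb] by (simp add: Bochner_Integration.integral_add Bochner_Integration.integral_sum)
    finally show ?thesis by (simp only: Ln_dual[OF u Dm Db])
  qed
  have "(\<lambda>N. ?r ^ N * (\<integral>x. u x * P ((T ^^ N) x) \<partial>M)) \<longlonglongrightarrow> 0"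
  proof (rule tendsto_0_le[where K="\<integral>x. \<bar>u x\<bar> \<partial>M"])
    show "(\<lambda>N. ?r ^ N) \<longlonglongrightarrow> 0" using r by (intro LIMSEQ_realpow_zero) auto
    show "\<forall>\<^sub>F N in sequentially. norm (?r ^ N * (\<integral>x. u x * P ((T ^^ N) x) \<partial>M)) \<le> norm (?r ^ N) * (\<integral>x. \<bar>u x\<bar> \<partial>M)"
    proof (rule always_eventually, rule allI)
      fix N
      have "\<bar>\<integral>x. u x * P ((T ^^ N) x) \<partial>M\<bar> \<le> (\<integral>x. \<bar>u x * P ((T ^^ N) x)\<bar> \<partial>M)"
        by (rule integral_abs_bound)
      also have "\<dots> \<le> (\<integral>x. \<bar>u x\<bar> \<partial>M)"
        using u integrable_abs[OF i[OF Pm Pb]] Pb by (intro integral_mono) (auto simp: abs_mult intro: mult_left_le)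
      finally show "norm (?r ^ N * (\<integral>x. u x * P ((T ^^ N) x) \<partial>M)) \<le> norm (?r ^ N) * (\<integral>x. \<bar>u x\<bar> \<partial>M)"
        using r by (simp add: abs_mult mult_left_mono del: exp_ge_zero)
    qed
  qed
  then have "(\<lambda>N. (\<integral>x. u x * P x \<partial>M) - ?r ^ N * (\<integral>x. u x * P ((T ^^ N) x) \<partial>M)) \<longlonglongrightarrow> (\<integral>x. u x * P x \<partial>M) - 0"
    by (intro tendsto_diff tendsto_const)
  moreover have "(\<integral>x. u x * P x \<partial>M) - ?r ^ N * (\<integral>x. u x * P ((T ^^ N) x) \<partial>M)
      = (\<Sum>k<N. ?r ^ k * (\<integral>x. (L ^^ k) u x * D x \<partial>M))" for N
    using int[of N] by linarith
  ultimately have "(\<lambda>N. \<Sum>k<N. ?r ^ k * (\<integral>x. (L ^^ k) u x * D x \<partial>M)) \<longlonglongrightarrow> (\<integral>x. u x * P x \<partial>M)"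
    by simp
  then show ?thesis unfolding P_def .
qed

end

section \<open>Rare events\<close>

text \<open>A finite net of the compact set, carried over from classes to representatives, so that
  it can be combined with integrals of functions.\<close>

lemma L1_compact_net:
  assumes U: "compact_in_L1 M \<U>" and e: "0 < e"
  shows "\<exists>F. finite F \<and> (\<forall>g\<in>F. integrable M g) \<and>
    (\<forall>u. integrable M u \<longrightarrow> L1_class M u \<in> \<U> \<longrightarrow> (\<exists>g\<in>F. (\<integral>x. \<bar>u x - g x\<bar> \<partial>M) < e))"
proof -
  interpret ms: Metric_space "L1_space M" "L1_dist M" by (rule Metric_space_L1)
  have c: "compactin ms.mtopology \<U>" using U by (simp add: compact_in_L1_def)
  have sub: "\<U> \<subseteq> L1_space M" using compactin_subset_topspace[OF c] by simp
  have "\<exists>\<F>. finite \<F> \<and> \<F> \<subseteq> (\<lambda>G. ms.mball G e) ` \<U> \<and> \<U> \<subseteq> \<Union>\<F>"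
  proof (rule compactinD[OF c])
    show "\<U> \<subseteq> \<Union> ((\<lambda>G. ms.mball G e) ` \<U>)" using sub e by (auto intro: ms.centre_in_mball_iff[THEN iffD2])
  qed auto
  then obtain K where K: "finite K" "K \<subseteq> \<U>" "\<U> \<subseteq> (\<Union>G\<in>K. ms.mball G e)"
    by (metis finite_subset_image)
  let ?r = "\<lambda>G. SOME g. g \<in> G"
  show ?thesis
  proof (intro exI[of _ "?r ` K"] conjI ballI allI impI)
    show "finite (?r ` K)" using K by simp
    fix g assume "g \<in> ?r ` K"
    then show "integrable M g" using K sub L1_space_some(1) by blast
  next
    fix u assume u: "integrable M u" "L1_class M u \<in> \<U>"
    then obtain G where G: "G \<in> K" "L1_class M u \<in> ms.mball G e" using K by blast
    have "u \<in> L1_class M u" using u by (simp add: L1_class_def)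
    then have "?r (L1_class M u) \<in> L1_class M u" by (rule someI[of "\<lambda>g. g \<in> L1_class M u"])
    then have ae: "AE x in M. ?r (L1_class M u) x = u x" by (simp add: L1_class_def)
    have iG: "integrable M (?r G)" "integrable M (?r (L1_class M u))" using G K sub u L1_space_some(1) by blast+
    have "(\<integral>x. \<bar>u x - ?r G x\<bar> \<partial>M) = L1_dist M G (L1_class M u)"
      unfolding L1_dist_def using ae iG u
      by (intro integral_cong_AE) (auto elim!: eventually_mono)
    also have "\<dots> < e" using G(2) by simp
    finally show "\<exists>g\<in>?r ` K. (\<integral>x. \<bar>u x - g x\<bar> \<partial>M) < e" using G(1) by blast
  qed
qed

text \<open>Positivity of the scaling is automatic for large \<open>n\<close> only. It is required
  here for all \<open>n\<close> and achieved in the end by shifting the sequence.\<close>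

locale rare_events = uniform_system M T c \<alpha> Y f I
  for M :: "'a measure" and T :: "'a \<Rightarrow> 'a" and c :: "nat \<Rightarrow> real" and \<alpha> :: real
    and Y :: "'a set" and f :: "'a \<Rightarrow> real" and I :: real +
  fixes a :: "nat \<Rightarrow> real" and B :: "nat \<Rightarrow> 'a set"
  assumes ac: "(\<lambda>n. a n / c n) \<longlonglongrightarrow> 1"
    and B_sets [measurable]: "\<And>n. B n \<in> sets M" and B_sub: "\<And>n. B n \<subseteq> Y"
    and B_pos: "\<And>n. 0 < measure M (B n)" and B_0: "(\<lambda>n. measure M (B n)) \<longlonglongrightarrow> 0"
    and \<gamma>_pos: "\<And>n. 0 < scaling a (measure M (B n))"
begin

abbreviation "b n \<equiv> measure M (B n)"
abbreviation "\<gamma> n \<equiv> scaling a (b n)"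
abbreviation "Q n ss \<equiv> hit_exp T (B n) (\<gamma> n) ss"

definition avg :: "nat \<Rightarrow> ('a \<Rightarrow> real) \<Rightarrow> real" where
  "avg n h = (\<integral>x. indicator (B n) x * h x \<partial>M) / b n"

text \<open>Expectation under the density \<open>f / I\<close>, to which the expectations under all
  other densities are compared.\<close>

definition ref :: "nat \<Rightarrow> real list \<Rightarrow> real" where
  "ref n ss = (\<integral>x. f x * Q n ss x \<partial>M) / I"

text \<open>The Abel mean of \<open>c\<close> multiplied by the measure of \<open>B n\<close>. The
  scaling is made for this product to have a positive limit,
  \<open>Gamma (1 + \<alpha>) / s powr \<alpha>\<close>.\<close>

definition A :: "nat \<Rightarrow> real \<Rightarrow> real" where
  "A n s = b n * ((1 - exp (- (s * \<gamma> n))) * (\<Sum>k. exp (- (s * \<gamma> n) * real k) * c k))"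

lemma B_fin: "emeasure M (B n) < \<infinity>"
  by (rule finite_subset_Y[OF B_sets B_sub])

lemma emeasure_B_0: "(\<lambda>n. emeasure M (B n)) \<longlonglongrightarrow> 0"
proof -
  have "(\<lambda>n. ennreal (b n)) \<longlonglongrightarrow> ennreal 0" by (intro tendsto_ennrealI B_0)
  then show ?thesis using B_fin by (simp add: emeasure_eq_ennreal_measure less_top)
qed

lemma \<gamma>_0: "\<gamma> \<longlonglongrightarrow> 0"
  by (rule laplace_scaling(2)[OF ac B_pos B_0 zero_less_one])

lemma A_lim: "0 < s \<Longrightarrow> (\<lambda>n. A n s) \<longlonglongrightarrow> Gamma (1 + \<alpha>) / s powr \<alpha>"
  unfolding A_def by (rule laplace_scaling(4)[OF ac B_pos B_0])

lemma Q_bounds: "\<forall>t\<in>set ss. 0 \<le> t \<Longrightarrow> 0 \<le> Q n ss x \<and> Q n ss x \<le> 1"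
  using \<gamma>_pos by (intro hit_exp_bounds) (auto intro: less_imp_le)

lemma Q_measurable [measurable]: "Q n ss \<in> borel_measurable M"
  by (rule hit_exp_measurable[OF B_sets])

lemma avg_integrable:
  fixes h :: "'a \<Rightarrow> real"
  assumes "h \<in> borel_measurable M" "\<And>x. x \<in> B n \<Longrightarrow> \<bar>h x\<bar> \<le> C"
  shows "integrable M (\<lambda>x. indicator (B n) x * h x)"
proof (rule Bochner_Integration.integrable_bound)
  show "integrable M (\<lambda>x. C * indicator (B n) x)" using B_fin[of n] by simp
  show "AE x in M. norm (indicator (B n) x * h x) \<le> norm (C * indicator (B n) x)"
    using assms(2) by (auto simp: indicator_def intro: order_trans[OF _ abs_ge_self])
qed (use assms in measurable)

lemma integrable_Q:
  assumes "integrable M u" "\<forall>t\<in>set ss. 0 \<le> t"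
  shows "integrable M (\<lambda>x. u x * Q n ss x)"
  using Q_bounds[of ss n] assms by (intro integrable_mult_AE_bounded[where C=1]) (auto simp: abs_le_iff intro: order_trans[of _ 0])

lemma abs_integral_Q_le:
  assumes "integrable M u" "\<forall>t\<in>set ss. 0 \<le> t"
  shows "\<bar>\<integral>x. u x * Q n ss x \<partial>M\<bar> \<le> (\<integral>x. \<bar>u x\<bar> \<partial>M)"
proof -
  have "\<bar>\<integral>x. u x * Q n ss x \<partial>M\<bar> \<le> (\<integral>x. \<bar>u x * Q n ss x\<bar> \<partial>M)"
    by (rule integral_abs_bound)
  also have "\<dots> \<le> (\<integral>x. \<bar>u x\<bar> \<partial>M)"
    using Q_bounds[of ss n] integrable_Q[OF assms, of n] assms
    by (intro integral_mono integrable_abs) (auto simp: abs_mult intro: mult_left_le)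
  finally show ?thesis .
qed

lemma ref_bounds:
  assumes "\<forall>t\<in>set ss. 0 \<le> t"
  shows "0 \<le> ref n ss \<and> ref n ss \<le> 1"
proof -
  have "(\<integral>x. f x * Q n ss x \<partial>M) \<le> (\<integral>x. f x \<partial>M)"
    using Q_bounds[OF assms, of n] f_nonneg
    by (intro integral_mono_AE integrable_Q f_int assms) (auto elim!: eventually_mono intro: mult_left_le)
  moreover have "0 \<le> (\<integral>x. f x * Q n ss x \<partial>M)"
    using f_nonneg Q_bounds[OF assms, of n] by (intro integral_nonneg_AE) (auto elim!: eventually_mono)
  ultimately show ?thesis using I_pos I_eq by (simp add: ref_def)
qed

text \<open>The series of \<open>hit_exp_series\<close> is summed by \<open>abel_bound\<close>, with
  partial sums controlled by \<open>partial_sum_bound\<close>. The resulting error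
  \<open>\<epsilon> * A n s + b n * K\<close> has limit \<open>\<epsilon>\<close> times the limit of
  \<open>A\<close>, and \<open>\<epsilon>\<close> is arbitrary.\<close>

lemma renewal_relation:
  assumes s: "0 < s" and ss: "\<forall>t\<in>set ss. 0 \<le> t"
  shows "(\<lambda>n. ref n (s # ss) - A n s * (avg n (Q n ss) - avg n (Q n (s # ss)))) \<longlonglongrightarrow> 0"
proof -
  let ?Q = "\<lambda>n. Q n (s # ss)" and ?H = "\<lambda>n. Q n ss"
  let ?r = "\<lambda>n. exp (- (s * \<gamma> n))"
  define \<delta> where "\<delta> n = avg n (?H n) - avg n (?Q n)" for n
  define y where "y n = ref n (s # ss) - A n s * \<delta> n" for n
  define w where "w n = (\<integral>x. \<bar>f x\<bar> * indicator (B n) x \<partial>M)" for n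
  have sss: "\<forall>t\<in>set (s # ss). 0 \<le> t" using s ss by auto
  note Hb = Q_bounds[OF ss] and Qb = Q_bounds[OF sss]
  have A0: "\<forall>\<^sub>F n in sequentially. 0 \<le> A n s"
    using order_tendstoD(1)[OF A_lim[OF s], of 0] s \<alpha> by (auto elim!: eventually_mono intro!: Gamma_real_pos)
  have w0: "w \<longlonglongrightarrow> 0" unfolding w_def by (rule integral_small_sets[OF f_int B_sets emeasure_B_0])
  have r1: "?r \<longlonglongrightarrow> 1"
    using tendsto_exp[OF tendsto_minus[OF tendsto_mult[OF tendsto_const[of s] \<gamma>_0]]] by simp
  have bound: "\<exists>K\<ge>0. \<forall>\<^sub>F n in sequentially. \<bar>I * y n\<bar> \<le> \<epsilon> * A n s + b n * K + (1 - ?r n) * I + w n" if \<epsilon>: "0 < \<epsilon>" for \<epsilon>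
  proof -
    obtain K where K: "0 \<le> K" and KB: "\<And>B D N. B \<in> sets M \<Longrightarrow> B \<subseteq> Y \<Longrightarrow> D \<in> borel_measurable M \<Longrightarrow> (\<forall>x. \<bar>D x\<bar> \<le> indicator B x) \<Longrightarrow>
      \<bar>(\<Sum>k<N. \<integral>x. (L ^^ k) f x * D x \<partial>M) - (I * (\<integral>x. D x \<partial>M)) * c N\<bar> \<le> measure M B * (\<epsilon> * c N + K)"
      using partial_sum_bound[OF \<epsilon>] by blast
    show ?thesis
    proof (intro exI[of _ K] conjI K)
      show "\<forall>\<^sub>F n in sequentially. \<bar>I * y n\<bar> \<le> \<epsilon> * A n s + b n * K + (1 - ?r n) * I + w n"
        using laplace_scaling(3)[OF ac B_pos B_0 s]
      proof eventually_elim
        case (elim n)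
        define D where "D x = indicator (B n) x * (?H n x - ?Q n x)" for x
        have [measurable]: "D \<in> borel_measurable M" unfolding D_def by measurable
        have Db: "\<bar>D x\<bar> \<le> indicator (B n) x" for x
          using Hb[of n x] Qb[of n x] by (auto simp: D_def indicator_def abs_le_iff)
        have r: "0 < ?r n" "?r n < 1" using s \<gamma>_pos[of n] by auto
        have pw: "exp (- (s * \<gamma> n) * real k) = ?r n ^ k" for k by (simp only: exp_of_nat_mult[symmetric] mult.commute)
        have iH: "integrable M (\<lambda>x. indicator (B n) x * ?H n x)"
          using Hb by (intro avg_integrable[where C=1]) (auto simp: abs_le_iff intro: order_trans[of _ 0])
        have iQ: "integrable M (\<lambda>x. indicator (B n) x * ?Q n x)"
          using Qb by (intro avg_integrable[where C=1] Q_measurable) (auto simp: abs_le_iff  intro: order_trans[of _ 0])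
        have "(\<integral>x. D x \<partial>M) = (\<integral>x. indicator (B n) x * ?H n x \<partial>M) - (\<integral>x. indicator (B n) x * ?Q n x \<partial>M)"
          unfolding D_def right_diff_distrib by (intro Bochner_Integration.integral_diff iH iQ)
        then have ID: "(\<integral>x. D x \<partial>M) = b n * \<delta> n"
          using B_pos[of n] by (simp add: \<delta>_def avg_def right_diff_distrib)
        have ser: "(\<lambda>N. \<Sum>k<N. ?r n ^ k * (\<integral>x. (L ^^ k) f x * D x \<partial>M)) \<longlonglongrightarrow> (\<integral>x. f x * (?Q n x + D x) \<partial>M)"
          using hit_exp_series[OF B_sets \<gamma>_pos s ss f_int, of n] unfolding D_def .
        have "\<bar>?r n * (\<integral>x. f x * (?Q n x + D x) \<partial>M) - (I * (\<integral>x. D x \<partial>M)) * ((1 - ?r n) * (\<Sum>k. ?r n ^ k * c k))\<bar>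
            \<le> b n * (\<epsilon> * ((1 - ?r n) * (\<Sum>k. ?r n ^ k * c k)) + K)"
        proof (rule abel_bound[OF r _ _ K KB ser])
          show "summable (\<lambda>k. ?r n ^ k * c k)" using elim by (simp only: pw)
        qed (use Db B_sub in auto)
        then have main: "\<bar>?r n * (\<integral>x. f x * (?Q n x + D x) \<partial>M) - I * (A n s * \<delta> n)\<bar> \<le> \<epsilon> * A n s + b n * K"
          unfolding ID A_def pw by (simp add: algebra_simps)
        have ifD: "integrable M (\<lambda>x. f x * D x)"
          by (intro integrable_mult_AE_bounded[OF f_int, where C=1] AE_I2 order_trans[OF Db indicator_le_1]) measurable
        have split: "(\<integral>x. f x * (?Q n x + D x) \<partial>M) = I * ref n (s # ss) + (\<integral>x. f x * D x \<partial>M)"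
          using integrable_Q[OF f_int sss, of n] ifD I_pos
          by (simp add: distrib_left Bochner_Integration.integral_add ref_def)
        have fD: "\<bar>\<integral>x. f x * D x \<partial>M\<bar> \<le> w n"
        proof -
          have "\<bar>\<integral>x. f x * D x \<partial>M\<bar> \<le> (\<integral>x. \<bar>f x * D x\<bar> \<partial>M)"
            by (rule integral_abs_bound)
          also have "\<dots> \<le> w n" unfolding w_def
          proof (intro integral_mono integrable_abs ifD)
            show "integrable M (\<lambda>x. \<bar>f x\<bar> * indicator (B n) x)"
              using f_int by (intro integrable_mult_AE_bounded[where C=1]) (auto simp: indicator_def)
            show "\<bar>f x * D x\<bar> \<le> \<bar>f x\<bar> * indicator (B n) x" for x
              using Db[of x] by (simp add: abs_mult mult_left_mono)
          qed
          finally show ?thesis .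
        qed
        \<comment> \<open>Three errors: that of the Abel estimate, the factor
          \<open>1 - ?r n\<close> from the summation by parts, and the integral of \<open>f\<close>
          against \<open>D\<close>, which is small because \<open>D\<close> lives on
          \<open>B n\<close>.\<close>
        have 1: "I * y n = (?r n * (\<integral>x. f x * (?Q n x + D x) \<partial>M) - I * (A n s * \<delta> n))
            + (1 - ?r n) * (I * ref n (s # ss)) - ?r n * (\<integral>x. f x * D x \<partial>M)"
          unfolding split y_def by (simp add: algebra_simps)
        have 2: "\<bar>(1 - ?r n) * (I * ref n (s # ss))\<bar> \<le> (1 - ?r n) * I"
          using ref_bounds[OF sss, of n] r I_pos by (simp add: abs_mult mult_left_le)
        have 3: "\<bar>?r n * (\<integral>x. f x * D x \<partial>M)\<bar> \<le> w n"
        proof -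
          have "\<bar>?r n * (\<integral>x. f x * D x \<partial>M)\<bar> \<le> 1 * \<bar>\<integral>x. f x * D x \<partial>M\<bar>"
            unfolding abs_mult using r by (intro mult_right_mono) auto
          then show ?thesis using fD by simp
        qed
        show ?case using 1 2 3 main unfolding abs_le_iff by linarith
      qed
    qed
  qed
  have "(\<lambda>n. I * y n) \<longlonglongrightarrow> 0"
  proof (rule LIMSEQ_I)
    fix e :: real assume e: "0 < e"
    define G where "G = Gamma (1 + \<alpha>) / s powr \<alpha>"
    have G: "0 < G" unfolding G_def using s \<alpha> by (auto intro!: Gamma_real_pos)
    define \<epsilon> where "\<epsilon> = e / (2 * G)"
    have \<epsilon>: "0 < \<epsilon>" "\<epsilon> * G < e" using e G by (auto simp: \<epsilon>_def)
    obtain K where K: "\<forall>\<^sub>F n in sequentially. \<bar>I * y n\<bar> \<le> \<epsilon> * A n s + b n * K + (1 - ?r n) * I + w n"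
      using bound[OF \<epsilon>(1)] by blast
    have "(\<lambda>n. \<epsilon> * A n s + b n * K + (1 - ?r n) * I + w n) \<longlonglongrightarrow> \<epsilon> * G + 0 * K + (1 - 1) * I + 0"
      unfolding G_def by (intro tendsto_intros A_lim[OF s] B_0 r1 w0)
    then have "\<forall>\<^sub>F n in sequentially. \<epsilon> * A n s + b n * K + (1 - ?r n) * I + w n < e"
      using \<epsilon>(2) by (intro order_tendstoD) auto
    with K have "\<forall>\<^sub>F n in sequentially. norm (I * y n - 0) < e"
      by eventually_elim simp
    then show "\<exists>n0. \<forall>n\<ge>n0. norm (I * y n - 0) < e" by (simp only: eventually_sequentially)
  qed
  then have "y \<longlonglongrightarrow> 0" using I_pos tendsto_mult_left_iff[of I y 0 sequentially] by simp
  then show ?thesis unfolding y_def \<delta>_def .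
qed

text \<open>By \<open>hit_exp_step\<close>, \<open>Q\<close> and its composition with
  \<open>T\<close> differ by at most \<open>1 - ?r\<close> off the preimage of \<open>B n\<close>
  and by at most 1 on it, and this preimage has the measure of \<open>B n\<close>. Such
  asymptotically invariant functions cannot distinguish \<open>u\<close> from the multiple of
  \<open>f\<close> with the same integral.\<close>

lemma asymptotically_constant:
  assumes s: "0 < s" and ss: "\<forall>t\<in>set ss. 0 \<le> t" and u: "integrable M u"
  shows "(\<lambda>n. (\<integral>x. u x * Q n (s # ss) x \<partial>M) - (\<integral>x. u x \<partial>M) * ref n (s # ss)) \<longlonglongrightarrow> 0"
proof -
  let ?Q = "\<lambda>n. Q n (s # ss)"
  have sss: "\<forall>t\<in>set (s # ss). 0 \<le> t" using s ss by auto
  note Qb = Q_bounds[OF sss]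
  define g where "g x = u x - (\<integral>x. u x \<partial>M) / I * f x" for x
  have g: "integrable M g" unfolding g_def using u f_int by auto
  have g0: "(\<integral>x. g x \<partial>M) = 0" unfolding g_def using u f_int I_pos I_eq by simp
  have "(\<lambda>n. \<integral>x. g x * ?Q n x \<partial>M) \<longlonglongrightarrow> 0"
  proof (rule asymptotically_invariant_imp_constant[OF _ _ _ g g0])
    show "\<bar>?Q n x\<bar> \<le> 1" for n x using Qb[of n x] by (simp add: abs_le_iff)
    fix w :: "'a \<Rightarrow> real" assume w: "integrable M w"
    let ?bd = "\<lambda>n. (1 - exp (- (s * \<gamma> n))) * (\<integral>x. \<bar>w x\<bar> \<partial>M) + (\<integral>x. \<bar>w x\<bar> * indicator (T -` B n \<inter> space M) x \<partial>M)"
    have lim: "?bd \<longlonglongrightarrow> 0"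
    proof -
      have e: "emeasure M (T -` B n \<inter> space M) = emeasure M (B n)" for n
        using emeasure_distr[OF T_measurable B_sets[of n]] distr_T by simp
      have "(\<lambda>n. \<integral>x. \<bar>w x\<bar> * indicator (T -` B n \<inter> space M) x \<partial>M) \<longlonglongrightarrow> 0"
        by (rule integral_small_sets[OF w]) (auto simp: e emeasure_B_0 intro: measurable_sets)
      moreover have "(\<lambda>n. exp (- (s * \<gamma> n))) \<longlonglongrightarrow> exp (- (s * 0))" by (intro tendsto_intros \<gamma>_0)
      ultimately have "?bd \<longlonglongrightarrow> (1 - exp (- (s * 0))) * (\<integral>x. \<bar>w x\<bar> \<partial>M) + 0"
        by (intro tendsto_add tendsto_mult tendsto_diff tendsto_const)
      then show ?thesis by simp
    qed
    show "(\<lambda>n. \<integral>x. w x * (?Q n x - ?Q n (T x)) \<partial>M) \<longlonglongrightarrow> 0"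
    proof (rule tendsto_0_le[OF lim, where K=1], rule always_eventually, rule allI)
      fix n
      let ?r = "exp (- (s * \<gamma> n))"
      have r: "0 < ?r" "?r < 1" using s \<gamma>_pos[of n] by auto
      have TB: "T -` B n \<inter> space M \<in> sets M" by (rule measurable_sets[OF T_measurable B_sets])
      have pt: "\<bar>?Q n x - ?Q n (T x)\<bar> \<le> (1 - ?r) + indicator (T -` B n \<inter> space M) x" if x: "x \<in> space M" for x
      proof (cases "T x \<in> B n")
        case True
        then have ind: "indicator (T -` B n \<inter> space M) x = (1 :: real)" using x by simp
        show ?thesis using Qb[of n x] Qb[of n "T x"] r unfolding ind abs_le_iff by linarith
      next
        case False
        then have "?Q n x - ?Q n (T x) = - (1 - ?r) * ?Q n (T x)"
          using hit_exp_step[of T "B n" "\<gamma> n" s ss x] by (simp add: algebra_simps)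
        then have "\<bar>?Q n x - ?Q n (T x)\<bar> = (1 - ?r) * ?Q n (T x)"
          using r Qb[of n "T x"] by (simp add: abs_mult)
        also have "\<dots> \<le> (1 - ?r)" using r Qb[of n "T x"] by (intro mult_left_le) auto
        finally show ?thesis by (simp add: add_increasing2)
      qed
      have i1: "integrable M (\<lambda>x. \<bar>w x\<bar> * indicator (T -` B n \<inter> space M) x)"
        using w TB by (intro integrable_mult_AE_bounded[where C=1]) (auto simp: indicator_def)
      have i2: "integrable M (\<lambda>x. w x * (?Q n x - ?Q n (T x)))"
      proof (rule integrable_mult_AE_bounded[OF w, where C=1])
        show "(\<lambda>x. ?Q n x - ?Q n (T x)) \<in> borel_measurable M" by measurable
        show "AE x in M. \<bar>?Q n x - ?Q n (T x)\<bar> \<le> 1"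
        proof (rule AE_I2)
          fix x show "\<bar>?Q n x - ?Q n (T x)\<bar> \<le> 1"
            using Qb[of n x] Qb[of n "T x"] unfolding abs_le_iff by linarith
        qed
      qed
      have "\<bar>\<integral>x. w x * (?Q n x - ?Q n (T x)) \<partial>M\<bar> \<le> (\<integral>x. \<bar>w x * (?Q n x - ?Q n (T x))\<bar> \<partial>M)"
        by (rule integral_abs_bound)
      also have "\<dots> \<le> (\<integral>x. (1 - ?r) * \<bar>w x\<bar> + \<bar>w x\<bar> * indicator (T -` B n \<inter> space M) x \<partial>M)"
      proof (rule integral_mono)
        fix x assume x: "x \<in> space M"
        show "\<bar>w x * (?Q n x - ?Q n (T x))\<bar> \<le> (1 - ?r) * \<bar>w x\<bar> + \<bar>w x\<bar> * indicator (T -` B n \<inter> space M) x"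
          using mult_left_mono[OF pt[OF x] abs_ge_zero[of "w x"]] unfolding abs_mult by (simp add: algebra_simps)
      qed (use i1 i2 w in \<open>auto \<close>)
      also have "\<dots> = ?bd n" using i1 w by simp
      also have "\<dots> \<le> norm (?bd n) * 1" by simp
      finally show "norm (\<integral>x. w x * (?Q n x - ?Q n (T x)) \<partial>M) \<le> norm (?bd n) * 1" by simp
    qed
  qed (rule Q_measurable)
  moreover have "(\<integral>x. g x * ?Q n x \<partial>M) = (\<integral>x. u x * ?Q n x \<partial>M) - (\<integral>x. u x \<partial>M) * ref n (s # ss)" for n
    using integrable_Q[OF u sss, of n] integrable_Q[OF f_int sss, of n]
    by (simp add: g_def left_diff_distrib mult.assoc ref_def)
  ultimately show ?thesis by simp
qed

text \<open>On a finite net the convergence is uniform, and \<open>Q\<close> is bounded by 1, so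
  passing from \<open>u\<close> to a net point costs its L1 distance. One third of \<open>e\<close>
  is for this, one for the net point itself, and one because the integral of the net point is only
  close to 1.\<close>

lemma uniformly_constant:
  assumes s: "0 < s" and ss: "\<forall>t\<in>set ss. 0 \<le> t" and U: "compact_in_L1 M \<U>" and e: "0 < e"
  shows "\<forall>\<^sub>F n in sequentially. \<forall>u. integrable M u \<longrightarrow> (\<integral>x. u x \<partial>M) = 1 \<longrightarrow> L1_class M u \<in> \<U> \<longrightarrow>
    \<bar>(\<integral>x. u x * Q n (s # ss) x \<partial>M) - ref n (s # ss)\<bar> \<le> e"
proof -
  have sss: "\<forall>t\<in>set (s # ss). 0 \<le> t" using s ss by auto
  obtain F where F: "finite F" "\<And>g. g \<in> F \<Longrightarrow> integrable M g"
    "\<And>u. integrable M u \<Longrightarrow> L1_class M u \<in> \<U> \<Longrightarrow> \<exists>g\<in>F. (\<integral>x. \<bar>u x - g x\<bar> \<partial>M) < e / 3"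
    using L1_compact_net[OF U, of "e / 3"] e by auto
  have "\<forall>\<^sub>F n in sequentially. \<forall>g\<in>F. \<bar>(\<integral>x. g x * Q n (s # ss) x \<partial>M) - (\<integral>x. g x \<partial>M) * ref n (s # ss)\<bar> < e / 3"
  proof (intro eventually_ball_finite F ballI)
    fix g assume "g \<in> F"
    from tendstoD[OF asymptotically_constant[OF s ss F(2)[OF this]], of "e / 3"] e
    show "\<forall>\<^sub>F n in sequentially. \<bar>(\<integral>x. g x * Q n (s # ss) x \<partial>M) - (\<integral>x. g x \<partial>M) * ref n (s # ss)\<bar> < e / 3"
      by (simp add: dist_real_def)
  qed
  then show ?thesis
  proof eventually_elim
    case (elim n)
    show ?case
    proof (intro allI impI)
      fix u assume u: "integrable M u" "(\<integral>x. u x \<partial>M) = 1" "L1_class M u \<in> \<U>"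
      obtain g where g: "g \<in> F" "(\<integral>x. \<bar>u x - g x\<bar> \<partial>M) < e / 3" using F(3)[OF u(1,3)] by blast
      note ig = F(2)[OF g(1)]
      have iug: "integrable M (\<lambda>x. u x - g x)" using u ig by auto
      have 1: "\<bar>(\<integral>x. u x * Q n (s # ss) x \<partial>M) - (\<integral>x. g x * Q n (s # ss) x \<partial>M)\<bar> < e / 3"
      proof -
        have "(\<integral>x. u x * Q n (s # ss) x \<partial>M) - (\<integral>x. g x * Q n (s # ss) x \<partial>M) = (\<integral>x. (u x - g x) * Q n (s # ss) x \<partial>M)"
          unfolding left_diff_distrib
          by (intro Bochner_Integration.integral_diff[symmetric] integrable_Q u ig sss)
        then show ?thesis using abs_integral_Q_le[OF iug sss, of n] g(2) by simp
      qed
      have 2: "\<bar>(\<integral>x. g x \<partial>M) * ref n (s # ss) - ref n (s # ss)\<bar> < e / 3"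
      proof -
        have "\<bar>(\<integral>x. g x \<partial>M) - 1\<bar> \<le> (\<integral>x. \<bar>u x - g x\<bar> \<partial>M)"
          using integral_norm_bound[of M "\<lambda>x. u x - g x"] u ig by (simp add: abs_minus_commute)
        then have "\<bar>(\<integral>x. g x \<partial>M) - 1\<bar> < e / 3" using g(2) by simp
        moreover have "\<bar>(\<integral>x. g x \<partial>M) * ref n (s # ss) - ref n (s # ss)\<bar> = \<bar>(\<integral>x. g x \<partial>M) - 1\<bar> * ref n (s # ss)"
        proof -
          have "(\<integral>x. g x \<partial>M) * ref n (s # ss) - ref n (s # ss) = ((\<integral>x. g x \<partial>M) - 1) * ref n (s # ss)"
            by (simp add: left_diff_distrib)
          then show ?thesis using ref_bounds[OF sss, of n] by (simp only: abs_mult abs_of_nonneg)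
        qed
        moreover have "\<bar>(\<integral>x. g x \<partial>M) - 1\<bar> * ref n (s # ss) \<le> \<bar>(\<integral>x. g x \<partial>M) - 1\<bar>"
          using ref_bounds[OF sss, of n] by (intro mult_left_le) auto
        ultimately show ?thesis by linarith
      qed
      show "\<bar>(\<integral>x. u x * Q n (s # ss) x \<partial>M) - ref n (s # ss)\<bar> \<le> e"
        using 1 2 elim[rule_format, OF g(1)] unfolding abs_less_iff abs_le_iff by linarith
    qed
  qed
qed

text \<open>Without an early return the orbit avoids \<open>B n\<close> up to time
  \<open>\<tau> n x\<close>, so \<open>Q\<close> there equals
  \<open>exp (- (s * \<gamma> n) * real (\<tau> n x))\<close> times \<open>Q\<close> at the point
  reached. On each level set of \<open>\<tau> n\<close>, duality turns the conditional mean of the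
  second factor into an integral of \<open>Q\<close> against an element of the compact set. This is
  close to \<open>ref\<close>, uniformly over the levels, so the expectation factorizes.\<close>

lemma cluster_relation:
  fixes \<tau> :: "nat \<Rightarrow> 'a \<Rightarrow> nat"
  assumes s: "0 < s" and ss: "\<forall>t\<in>set ss. 0 \<le> t" and U: "compact_in_L1 M \<U>"
    and \<tau> [measurable]: "\<And>n k. {x \<in> B n. \<tau> n x = k} \<in> sets M"
    and comp: "\<And>n k. 0 < measure M {x \<in> B n. \<tau> n x = k} \<Longrightarrow>
           L1_class M ((L ^^ k) (\<lambda>x. indicator {x \<in> B n. \<tau> n x = k} x / measure M {x \<in> B n. \<tau> n x = k})) \<in> \<U>"
    and ret: "(\<lambda>n. measure (uniform_measure M (B n)) {x \<in> B n. hit_time T (B n) 1 x \<le> enat (\<tau> n x)}) \<longlonglongrightarrow> 0"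
  shows "(\<lambda>n. avg n (Q n (s # ss)) - avg n (\<lambda>x. exp (- s * (\<gamma> n * real (\<tau> n x)))) * ref n (s # ss)) \<longlonglongrightarrow> 0"
proof -
  let ?Q = "\<lambda>n. Q n (s # ss)"
  have sss: "\<forall>t\<in>set (s # ss). 0 \<le> t" using s ss by auto
  note Qb = Q_bounds[OF sss] and Rb = ref_bounds[OF sss]
  \<comment> \<open>\<open>\<tau> n\<close> is measurable only on \<open>B n\<close>; outside it is
    replaced by 0.\<close>
  define \<tau>' where "\<tau>' n x = (if x \<in> B n then \<tau> n x else 0)" for n x
  define R where "R n = {x \<in> B n. hit_time T (B n) 1 x \<le> enat (\<tau> n x)}" for n
  have \<tau>'m [measurable]: "\<tau>' n \<in> measurable M (count_space UNIV)" for n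
  proof -
    have "\<tau>' n -` {k} \<inter> space M \<in> sets M" for k
    proof -
      have "\<tau>' n -` {k} \<inter> space M = {x \<in> B n. \<tau> n x = k} \<union> (if k = 0 then space M - B n else {})"
        using sets.sets_into_space[OF B_sets[of n]] by (auto simp: \<tau>'_def split: if_splits)
      then show ?thesis by simp
    qed
    then show ?thesis by (subst measurable_count_space_eq2_countable) auto
  qed
  have [measurable]: "R n \<in> sets M" for n
  proof -
    have "(\<lambda>x. hit_time T (B n) 1 x \<le> enat k) \<in> measurable M (count_space UNIV)" for k
      by (rule measurable_compose[OF hit_time_measurable[OF B_sets]]) simp
    then have [measurable]: "Measurable.pred M (\<lambda>x. hit_time T (B n) 1 x \<le> enat (\<tau>' n x))"
      by (rule measurable_compose_countable[OF _ \<tau>'m])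
    have "{x \<in> space M. x \<in> B n \<and> hit_time T (B n) 1 x \<le> enat (\<tau>' n x)} \<in> sets M" by measurable
    also have "{x \<in> space M. x \<in> B n \<and> hit_time T (B n) 1 x \<le> enat (\<tau>' n x)} = R n"
      using sets.sets_into_space[OF B_sets[of n]] by (auto simp: R_def \<tau>'_def)
    finally show ?thesis .
  qed
  have ret': "(\<lambda>n. measure M (R n) / b n) \<longlonglongrightarrow> 0"
  proof -
    have "emeasure M (B n) \<noteq> 0" "emeasure M (B n) \<noteq> \<infinity>" for n
      using B_pos[of n] B_fin[of n] by (auto simp: measure_def less_top[symmetric])
    then have "measure (uniform_measure M (B n)) (R n) = measure M (B n \<inter> R n) / b n" for n
      by (intro measure_uniform_measure) auto
    moreover have "B n \<inter> R n = R n" for n by (auto simp: R_def)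
    ultimately show ?thesis using ret[folded R_def] by simp
  qed
  define V where "V n x = ?Q n ((T ^^ \<tau>' n x) x)" for n x
  define \<ee> where "\<ee> n x = exp (- (s * \<gamma> n) * real (\<tau>' n x))" for n x
  have Vm [measurable]: "V n \<in> borel_measurable M" for n
    unfolding V_def by (rule measurable_compose_countable[where f="\<lambda>i x. ?Q n ((T ^^ i) x)" and g="\<tau>' n", OF _ \<tau>'m])
       (rule measurable_compose[OF Tn_measurable Q_measurable])
  have [measurable]: "(\<lambda>x. real (\<tau>' n x)) \<in> borel_measurable M" for n
    by (rule measurable_compose[OF \<tau>'m]) simp
  have em [measurable]: "\<ee> n \<in> borel_measurable M" for n unfolding \<ee>_def by measurable
  have eb: "0 < \<ee> n x \<and> \<ee> n x \<le> 1" for n x using s \<gamma>_pos[of n] by (simp add: \<ee>_def)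
  have Vb: "0 \<le> V n x \<and> V n x \<le> 1" for n x unfolding V_def by (rule Qb)
  have avg_e: "avg n (\<lambda>x. exp (- s * (\<gamma> n * real (\<tau> n x)))) = avg n (\<ee> n)" for n
    unfolding avg_def by (intro arg_cong2[where f="(/)"] Bochner_Integration.integral_cong) (auto simp: indicator_def \<ee>_def \<tau>'_def mult_ac)
  have 1: "\<bar>avg n (?Q n) - avg n (\<lambda>x. \<ee> n x * V n x)\<bar> \<le> measure M (R n) / b n" for n
  proof -
    have Rfin: "emeasure M (R n) < \<infinity>" using emeasure_mono[of "R n" "B n" M] B_fin[of n] by (auto simp: R_def intro: le_less_trans)
    have i1: "integrable M (\<lambda>x. indicator (B n) x * ?Q n x)"
      using Qb[of n] by (intro avg_integrable[where C=1] Q_measurable) (auto simp: abs_le_iff  intro: order_trans[of _ 0])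
    have eV: "0 \<le> \<ee> n x * V n x \<and> \<ee> n x * V n x \<le> 1" for x using eb[of n x] Vb[of n x] by (auto intro: mult_le_one)
    have i2: "integrable M (\<lambda>x. indicator (B n) x * (\<ee> n x * V n x))"
      using eV by (intro avg_integrable[where C=1]) (auto simp: abs_le_iff intro: order_trans[of _ 0])
    have pt: "\<bar>indicator (B n) x * ?Q n x - indicator (B n) x * (\<ee> n x * V n x)\<bar> \<le> indicator (R n) x" for x
    proof (cases "x \<in> B n \<and> x \<notin> R n")
      case True
      then have nr: "enat (\<tau> n x) < hit_time T (B n) 1 x" by (auto simp: R_def)
      have "(T ^^ j) x \<notin> B n" if "0 < j" "j \<le> \<tau> n x" for j
      proof
        assume "(T ^^ j) x \<in> B n"
        then have "hit_time T (B n) 1 x \<noteq> \<infinity>" using that unfolding hit_time_1_eq_infinity by blast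
        then obtain m where m: "hit_time T (B n) 1 x = enat m" by auto
        then have "j < m" using nr that by simp
        then show False using m that \<open>(T ^^ j) x \<in> B n\<close> unfolding hit_time_1_eq_enat by blast
      qed
      then have "?Q n x = exp (- (s * \<gamma> n) * real (\<tau> n x)) * ?Q n ((T ^^ \<tau> n x) x)" by (rule hit_exp_iterate)
      then have "?Q n x = \<ee> n x * V n x" using True unfolding \<ee>_def V_def \<tau>'_def by simp
      then show ?thesis by simp
    next
      case False
      then show ?thesis using Qb[of n x] eV[of x] by (auto simp: indicator_def abs_le_iff R_def)
    qed
    have "\<bar>(\<integral>x. indicator (B n) x * ?Q n x \<partial>M) - (\<integral>x. indicator (B n) x * (\<ee> n x * V n x) \<partial>M)\<bar>
        = \<bar>\<integral>x. indicator (B n) x * ?Q n x - indicator (B n) x * (\<ee> n x * V n x) \<partial>M\<bar>"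
      using i1 i2 by simp
    also have "\<dots> \<le> (\<integral>x. \<bar>indicator (B n) x * ?Q n x - indicator (B n) x * (\<ee> n x * V n x)\<bar> \<partial>M)"
      by (rule integral_abs_bound)
    also have "\<dots> \<le> (\<integral>x. indicator (R n) x \<partial>M)"
      using i1 i2 Rfin by (intro integral_mono pt integrable_abs Bochner_Integration.integrable_diff) auto
    finally have "\<bar>(\<integral>x. indicator (B n) x * ?Q n x \<partial>M) - (\<integral>x. indicator (B n) x * (\<ee> n x * V n x) \<partial>M)\<bar> \<le> measure M (R n)"
      by simp
    then show ?thesis unfolding avg_def diff_divide_distrib[symmetric] using B_pos[of n]
      by (simp add: divide_right_mono)
  qed
  have 2: "\<forall>\<^sub>F n in sequentially. \<bar>avg n (\<lambda>x. \<ee> n x * V n x) - avg n (\<ee> n) * ref n (s # ss)\<bar> \<le> \<epsilon>" if \<epsilon>: "0 < \<epsilon>" for \<epsilon>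
    using uniformly_constant[OF s ss U \<epsilon>]
  proof eventually_elim
    case (elim n)
    let ?x = "ref n (s # ss)"
    define W where "W x = \<ee> n x * (V n x - ?x)" for x
    define E where "E k = {x \<in> B n. \<tau> n x = k}" for k
    have Em [measurable]: "E k \<in> sets M" for k unfolding E_def by measurable
    have Efin: "emeasure M (E k) < \<infinity>" for k using emeasure_mono[of "E k" "B n" M] B_fin[of n] by (auto simp: E_def intro: le_less_trans)
    have [measurable]: "W \<in> borel_measurable M" unfolding W_def by measurable
    have Wb: "\<bar>W x\<bar> \<le> 1" for x
    proof -
      have "\<bar>V n x - ?x\<bar> \<le> 1" using Vb[of n x] Rb[of n] unfolding abs_le_iff by linarith
      then show ?thesis unfolding W_def abs_mult using eb[of n x] by (intro mult_le_one) auto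
    qed
    have iE: "integrable M (\<lambda>x. indicator (E k) x * G x)" if "G \<in> borel_measurable M" "\<And>x. \<bar>G x\<bar> \<le> 1" for G :: "'a \<Rightarrow> real" and k
      using that Efin[of k] by (intro integrable_mult_AE_bounded[where C=1]) auto
    \<comment> \<open>There may be infinitely many levels, so the error on each must be proportional
      to its measure. Null levels are treated apart, since \<open>comp\<close> speaks of levels of
      positive measure.\<close>
    have piece: "\<bar>\<integral>x. indicator (E k) x * W x \<partial>M\<bar> \<le> \<epsilon> * measure M (E k)" for k
    proof (cases "measure M (E k) = 0")
      case True
      then have "AE x in M. x \<notin> E k" using Efin[of k] by (intro AE_not_in) (auto simp: null_sets_def emeasure_eq_ennreal_measure less_top)
      then have "(\<integral>x. indicator (E k) x * W x \<partial>M) = (\<integral>x. 0 \<partial>M)"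
        by (intro integral_cong_AE) (auto elim!: eventually_mono)
      then show ?thesis using True by simp
    next
      case False
      then have p: "0 < measure M (E k)" using measure_nonneg[of M "E k"] by linarith
      define u where "u x = indicator (E k) x / measure M (E k)" for x
      have u: "integrable M u" unfolding u_def using Efin[of k] by simp
      have u1: "(\<integral>x. u x \<partial>M) = 1" unfolding u_def using p by simp
      have "\<bar>(\<integral>x. (L ^^ k) u x * ?Q n x \<partial>M) - ?x\<bar> \<le> \<epsilon>"
      proof (rule elim[rule_format])
        show "L1_class M ((L ^^ k) u) \<in> \<U>" using comp[of n k] p unfolding u_def E_def by simp
      qed (use integrable_Ln[OF u] integral_Ln[OF u] u1 in auto)
      also have "(\<integral>x. (L ^^ k) u x * ?Q n x \<partial>M) = (\<integral>x. u x * ?Q n ((T ^^ k) x) \<partial>M)"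
        using Qb[of n] by (intro Ln_dual[symmetric, OF u Q_measurable, where C=1]) (auto simp: abs_le_iff  intro: order_trans[of _ 0])
      also have "\<dots> - ?x = (\<integral>x. indicator (E k) x * (?Q n ((T ^^ k) x) - ?x) \<partial>M) / measure M (E k)"
      proof -
        have j: "integrable M (\<lambda>x. indicator (E k) x * ?Q n ((T ^^ k) x))"
          using Qb[of n] by (intro iE measurable_compose[OF Tn_measurable Q_measurable]) (auto simp: abs_le_iff  intro: order_trans[of _ 0])
        have "(\<integral>x. indicator (E k) x * (?Q n ((T ^^ k) x) - ?x) \<partial>M) = (\<integral>x. indicator (E k) x * ?Q n ((T ^^ k) x) - ?x * indicator (E k) x \<partial>M)"
          by (simp add: algebra_simps)
        also have "\<dots> = (\<integral>x. indicator (E k) x * ?Q n ((T ^^ k) x) \<partial>M) - ?x * measure M (E k)"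
          using j Efin[of k] by (subst Bochner_Integration.integral_diff) (auto)
        finally show ?thesis using p by (simp add: u_def diff_divide_distrib)
      qed
      finally have st: "\<bar>\<integral>x. indicator (E k) x * (?Q n ((T ^^ k) x) - ?x) \<partial>M\<bar> \<le> \<epsilon> * measure M (E k)"
        using p by (simp add: abs_divide divide_le_eq)
      have "(\<integral>x. indicator (E k) x * W x \<partial>M) = (\<integral>x. exp (- (s * \<gamma> n) * real k) * (indicator (E k) x * (?Q n ((T ^^ k) x) - ?x)) \<partial>M)"
        by (intro Bochner_Integration.integral_cong) (auto simp: indicator_def W_def E_def \<ee>_def V_def \<tau>'_def)
      also have "\<dots> = exp (- (s * \<gamma> n) * real k) * (\<integral>x. indicator (E k) x * (?Q n ((T ^^ k) x) - ?x) \<partial>M)" by (rule integral_mult_right_zero)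
      finally have "\<bar>\<integral>x. indicator (E k) x * W x \<partial>M\<bar> = exp (- (s * \<gamma> n) * real k) * \<bar>\<integral>x. indicator (E k) x * (?Q n ((T ^^ k) x) - ?x) \<partial>M\<bar>"
        by (simp add: abs_mult)
      also have "\<dots> \<le> 1 * \<bar>\<integral>x. indicator (E k) x * (?Q n ((T ^^ k) x) - ?x) \<partial>M\<bar>"
        using s \<gamma>_pos[of n] by (intro mult_right_mono) auto
      finally show ?thesis using st by simp
    qed
    have part: "\<bar>\<integral>x. (\<Sum>k<N. indicator (E k) x * W x) \<partial>M\<bar> \<le> \<epsilon> * b n" for N
    proof -
      have "\<bar>\<integral>x. (\<Sum>k<N. indicator (E k) x * W x) \<partial>M\<bar> = \<bar>\<Sum>k<N. \<integral>x. indicator (E k) x * W x \<partial>M\<bar>"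
        using iE[of W] Wb by (subst Bochner_Integration.integral_sum) auto
      also have "\<dots> \<le> (\<Sum>k<N. \<epsilon> * measure M (E k))" by (rule order_trans[OF sum_abs sum_mono]) (rule piece)
      also have "\<dots> = \<epsilon> * measure M (\<Union>k<N. E k)"
        using Efin by (subst measure_finite_Union) (auto simp: sum_distrib_left disjoint_family_on_def E_def less_top[symmetric])
      also have "\<dots> \<le> \<epsilon> * b n"
        using \<epsilon> B_fin[of n] by (intro mult_left_mono measure_mono_fmeasurable) (auto simp: fmeasurable_def E_def)
      finally show ?thesis .
    qed
    have iW: "integrable M (\<lambda>x. indicator (B n) x * W x)" by (rule avg_integrable[where C=1]) (use Wb in auto)
    have "(\<lambda>N. \<integral>x. (\<Sum>k<N. indicator (E k) x * W x) \<partial>M) \<longlonglongrightarrow> (\<integral>x. indicator (B n) x * W x \<partial>M)"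
    proof (rule integral_dominated_convergence[where w="\<lambda>x. indicator (B n) x"])
      have val: "(\<Sum>k<N. indicator (E k) x * W x) = (if x \<in> B n \<and> \<tau> n x < N then W x else 0)" for N x
      proof -
        have "(\<Sum>k<N. indicator (E k) x * W x) = (\<Sum>k<N. if k = \<tau> n x then (if x \<in> B n then W x else 0) else 0)"
          by (intro sum.cong) (auto simp: E_def indicator_def)
        then show ?thesis by (simp add: sum.delta)
      qed
      show "AE x in M. (\<lambda>N. \<Sum>k<N. indicator (E k) x * W x) \<longlonglongrightarrow> indicator (B n) x * W x"
      proof (rule AE_I2)
        fix x
        have "\<forall>\<^sub>F N in sequentially. (\<Sum>k<N. indicator (E k) x * W x) = indicator (B n) x * W x"
          using eventually_gt_at_top[of "\<tau> n x"] by eventually_elim (simp add: val)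
        then show "(\<lambda>N. \<Sum>k<N. indicator (E k) x * W x) \<longlonglongrightarrow> indicator (B n) x * W x" by (rule tendsto_eventually)
      qed
      show "AE x in M. norm (\<Sum>k<N. indicator (E k) x * W x) \<le> indicator (B n) x" for N
        unfolding val using Wb by (auto simp: indicator_def)
    qed (use B_fin[of n] in auto)
    then have "\<bar>\<integral>x. indicator (B n) x * W x \<partial>M\<bar> \<le> \<epsilon> * b n"
      by (intro LIMSEQ_le_const2[OF tendsto_rabs]) (use part in auto)
    moreover have "avg n (\<lambda>x. \<ee> n x * V n x) - avg n (\<ee> n) * ?x = (\<integral>x. indicator (B n) x * W x \<partial>M) / b n"
    proof -
      have eV: "\<bar>\<ee> n x * V n x\<bar> \<le> 1" "\<bar>\<ee> n x\<bar> \<le> 1" for x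
        unfolding abs_mult using eb[of n x] Vb[of n x] by (auto intro: mult_le_one)
      note j = avg_integrable[of "\<lambda>x. \<ee> n x * V n x" n 1, OF _ eV(1)] avg_integrable[of "\<ee> n" n 1, OF _ eV(2)]
      have "(\<integral>x. indicator (B n) x * W x \<partial>M) = (\<integral>x. indicator (B n) x * (\<ee> n x * V n x) - ?x * (indicator (B n) x * \<ee> n x) \<partial>M)"
        by (simp add: W_def algebra_simps)
      also have "\<dots> = (\<integral>x. indicator (B n) x * (\<ee> n x * V n x) \<partial>M) - ?x * (\<integral>x. indicator (B n) x * \<ee> n x \<partial>M)"
        using j by (subst Bochner_Integration.integral_diff) auto
      finally show ?thesis by (simp add: avg_def diff_divide_distrib)
    qed
    ultimately show ?case using B_pos[of n] by (simp add: abs_divide divide_le_eq)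
  qed
  have "(\<lambda>n. avg n (\<lambda>x. \<ee> n x * V n x) - avg n (\<ee> n) * ref n (s # ss)) \<longlonglongrightarrow> 0"
  proof (rule LIMSEQ_I)
    fix e :: real assume "0 < e"
    then have "\<forall>\<^sub>F n in sequentially. norm (avg n (\<lambda>x. \<ee> n x * V n x) - avg n (\<ee> n) * ref n (s # ss) - 0) < e"
      using 2[of "e / 2"] by (auto elim!: eventually_mono)
    then show "\<exists>n0. \<forall>n\<ge>n0. norm (avg n (\<lambda>x. \<ee> n x * V n x) - avg n (\<ee> n) * ref n (s # ss) - 0) < e"
      by (simp only: eventually_sequentially)
  qed
  moreover have "(\<lambda>n. avg n (?Q n) - avg n (\<lambda>x. \<ee> n x * V n x)) \<longlonglongrightarrow> 0"
    by (rule tendsto_0_le[OF ret', where K=1]) (use 1 B_pos in \<open>auto intro!: always_eventually \<close>)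
  ultimately have "(\<lambda>n. (avg n (?Q n) - avg n (\<lambda>x. \<ee> n x * V n x)) + (avg n (\<lambda>x. \<ee> n x * V n x) - avg n (\<ee> n) * ref n (s # ss))) \<longlonglongrightarrow> 0 + 0"
    by (intro tendsto_add)
  then show ?thesis unfolding avg_e by simp
qed

end

section \<open>Convergence of the point processes\<close>

lemma integral_uniform_measure:
  fixes h :: "'a \<Rightarrow> real"
  assumes B: "B \<in> sets M" and fin: "emeasure M B < \<infinity>" and pos: "0 < measure M B"
    and [measurable]: "h \<in> borel_measurable M"
  shows "(\<integral>x. h x \<partial>uniform_measure M B) = (\<integral>x. indicator B x * h x \<partial>M) / measure M B"
proof -
  note [measurable] = B
  have e: "indicator B x / emeasure M B = ennreal (indicator B x / measure M B)" for x
    using fin pos divide_ennreal[of 1 "measure M B"]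
    by (cases "x \<in> B") (simp_all add: emeasure_eq_ennreal_measure less_top[symmetric])
  have "(\<integral>x. h x \<partial>uniform_measure M B) = (\<integral>x. (indicator B x / measure M B) *\<^sub>R h x \<partial>M)"
    unfolding uniform_measure_def e by (subst integral_density) auto
  then show ?thesis by simp
qed

lemma absolutely_continuous_uniform_measure:
  assumes [measurable]: "B \<in> sets M" shows "absolutely_continuous M (uniform_measure M B)"
  unfolding uniform_measure_def by (intro absolutely_continuousI_density) measurable

context mp_system
begin

text \<open>These laws approximate the limit laws and are the source of their existence.
  \<open>hits\<close> is there because on an infinite hitting time \<open>the_enat\<close> has an
  unspecified value, whereas \<open>hit_exp\<close> is 0.\<close>

lemma waiting_time_law:
  assumes P: "prob_space P" and sP: "sets P = sets M" and B: "B \<in> sets M" and g: "0 < g"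
    and hits: "AE x in P. hit_time T B 1 x \<noteq> \<infinity>"
  defines "\<rho> \<equiv> distr P borel (\<lambda>x. g * real (the_enat (hit_time T B 1 x)))"
  shows "nonneg_law \<rho>" and "laplace \<rho> s = (\<integral>x. hit_exp T B g [s] x \<partial>P)"
proof -
  interpret prob_space P by fact
  have m [measurable]: "(\<lambda>x. g * real (the_enat (hit_time T B 1 x))) \<in> borel_measurable P"
  proof -
    have "hit_time T B 1 \<in> measurable P (count_space UNIV)"
      using hit_time_measurable[OF B] measurable_cong_sets[OF sP refl] by blast
    then have "(\<lambda>x. real (the_enat (hit_time T B 1 x))) \<in> borel_measurable P"
      by (rule measurable_compose) simp
    then show ?thesis by measurable
  qed
  have "real_distribution \<rho>"
    unfolding \<rho>_def real_distribution_def real_distribution_axioms_def using prob_space_distr[OF m] by simp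
  moreover have "AE w in \<rho>. 0 \<le> w"
    unfolding \<rho>_def using g by (subst AE_distr_iff[OF m]) (auto simp del: One_nat_def)
  ultimately show "nonneg_law \<rho>" by (simp add: nonneg_law_def)
  have hm: "hit_exp T B g [s] \<in> borel_measurable P"
    using hit_exp_measurable[OF B] measurable_cong_sets[OF sP refl] by blast
  have "laplace \<rho> s = (\<integral>x. exp (- s * (g * real (the_enat (hit_time T B 1 x)))) \<partial>P)"
    unfolding laplace_def \<rho>_def by (rule integral_distr) measurable
  also have "\<dots> = (\<integral>x. hit_exp T B g [s] x \<partial>P)"
  proof (rule integral_cong_AE[OF _ hm])
    show "AE x in P. exp (- s * (g * real (the_enat (hit_time T B 1 x)))) = hit_exp T B g [s] x"
      using hits by eventually_elim (auto simp: hit_exp.simps mult_ac)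
  qed measurable
  finally show "laplace \<rho> s = (\<integral>x. hit_exp T B g [s] x \<partial>P)" .
qed

end

text \<open>Convergence determines the transform for \<open>s > 0\<close>; at 0 every law has
  transform 1, which is matched by the second premise.\<close>

lemma law_of_laplace_spec:
  assumes "\<exists>\<rho>. nonneg_law \<rho> \<and> (\<forall>s>0. laplace \<rho> s = \<Lambda> s)" and "\<Lambda> 0 = 1"
  shows "nonneg_law (law_of_laplace \<Lambda>)" and "0 \<le> s \<Longrightarrow> laplace (law_of_laplace \<Lambda>) s = \<Lambda> s"
proof -
  have "\<exists>\<rho>. nonneg_law \<rho> \<and> (\<forall>s\<ge>0. laplace \<rho> s = \<Lambda> s)"
    using assms laplace_0 by (metis order_le_less)
  then have "nonneg_law (law_of_laplace \<Lambda>) \<and> (\<forall>s\<ge>0. laplace (law_of_laplace \<Lambda>) s = \<Lambda> s)"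
    unfolding law_of_laplace_def by (rule someI_ex)
  then show "nonneg_law (law_of_laplace \<Lambda>)" and "0 \<le> s \<Longrightarrow> laplace (law_of_laplace \<Lambda>) s = \<Lambda> s" by auto
qed

locale clustered_rare_events = rare_events M T c \<alpha> Y f I a B
  for M :: "'a measure" and T :: "'a \<Rightarrow> 'a" and c :: "nat \<Rightarrow> real" and \<alpha> :: real
    and Y :: "'a set" and f :: "'a \<Rightarrow> real" and I :: real and a :: "nat \<Rightarrow> real" and B :: "nat \<Rightarrow> 'a set" +
  fixes \<tau> :: "nat \<Rightarrow> 'a \<Rightarrow> nat" and \<nu> :: "real measure" and \<U> :: "('a \<Rightarrow> real) set set"
  assumes \<nu>: "nonneg_law \<nu>"
    and \<tau>_measurable: "\<And>n. \<tau> n \<in> measurable (restrict_space M (B n)) (count_space UNIV)"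
    and compact: "compact_in_L1 M \<U>"
    and in_compact: "\<And>n k. 0 < measure M {x \<in> B n. \<tau> n x = k} \<Longrightarrow>
           L1_class M ((transfer_op M T ^^ k)
             (\<lambda>x. indicator {x \<in> B n. \<tau> n x = k} x / measure M {x \<in> B n. \<tau> n x = k})) \<in> \<U>"
    and weak: "weak_conv_m
           (\<lambda>n. distr (restrict_space (uniform_measure M (B n)) (B n)) borel
                  (\<lambda>x. scaling a (measure M (B n)) * real (\<tau> n x))) \<nu>"
    and no_return: "(\<lambda>n. measure (uniform_measure M (B n))
                {x \<in> B n. hit_time T (B n) 1 x \<le> enat (\<tau> n x)}) \<longlonglongrightarrow> 0"
begin

text \<open>The candidates \<open>\<Phi>\<close> and \<open>\<Psi>\<close> for the transforms of the
  two limit laws remain mere functions until the convergence of averages shows that such laws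
  exist.\<close>

definition \<Phi> :: "real \<Rightarrow> real" where
  "\<Phi> s = 1 / (laplace \<nu> s + s powr \<alpha> / Gamma (1 + \<alpha>))"

definition \<Psi> :: "real \<Rightarrow> real" where
  "\<Psi> s = laplace \<nu> s / (laplace \<nu> s + s powr \<alpha> / Gamma (1 + \<alpha>))"

lemma \<tau>_sets: "{x \<in> B n. \<tau> n x = k} \<in> sets M"
proof -
  have "\<tau> n -` {k} \<inter> space (restrict_space M (B n)) \<in> sets (restrict_space M (B n))"
    by (rule measurable_sets[OF \<tau>_measurable]) simp
  moreover have "\<tau> n -` {k} \<inter> space (restrict_space M (B n)) = {x \<in> B n. \<tau> n x = k}"
    using sets.sets_into_space[OF B_sets[of n]] by (auto simp: space_restrict_space)
  ultimately show ?thesis by (auto simp: sets_restrict_space_iff)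
qed

lemma emeasure_B: "emeasure M (B n) \<noteq> 0" "emeasure M (B n) \<noteq> \<infinity>"
  using B_fin[of n] B_pos[of n] by (auto simp: measure_def)

lemma uniform_prob: "prob_space (uniform_measure M (B n))"
  using emeasure_B by (rule prob_space_uniform_measure)

lemma avg_uniform: "h \<in> borel_measurable M \<Longrightarrow> (\<integral>x. h x \<partial>uniform_measure M (B n)) = avg n h"
  unfolding avg_def by (rule integral_uniform_measure[OF B_sets B_fin B_pos])

text \<open>The form in which weak convergence of the scaled \<open>\<tau> n\<close> is used. The
  laws are taken on the trace space of \<open>B n\<close>, the domain on which
  \<open>\<tau> n\<close> is measurable.\<close>

lemma cluster_laplace:
  assumes s: "0 < s"
  shows "(\<lambda>n. avg n (\<lambda>x. exp (- s * (\<gamma> n * real (\<tau> n x))))) \<longlonglongrightarrow> laplace \<nu> s"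
proof -
  let ?R = "\<lambda>n. restrict_space (uniform_measure M (B n)) (B n)"
  let ?\<rho> = "\<lambda>n. distr (?R n) borel (\<lambda>x. \<gamma> n * real (\<tau> n x))"
  have tm: "(\<lambda>x. real (\<tau> n x)) \<in> borel_measurable (restrict_space M (B n))" for n
    by (rule measurable_compose[OF \<tau>_measurable]) simp
  then have rm: "(\<lambda>x. real (\<tau> n x)) \<in> borel_measurable (?R n)" for n
    by (simp add: measurable_cong_sets[OF sets_restrict_space_cong[OF sets_uniform_measure] refl])
  then have gm [measurable]: "(\<lambda>x. \<gamma> n * real (\<tau> n x)) \<in> borel_measurable (?R n)" for n by measurable
  have Rp: "prob_space (?R n)" for n
    by (intro prob_space_restrict_space emeasure_uniform_measure_1 emeasure_B) simp
  have nl: "nonneg_law (?\<rho> n)" for n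
  proof -
    have "AE w in ?\<rho> n. 0 \<le> w" using \<gamma>_pos[of n] by (subst AE_distr_iff) auto
    moreover have "real_distribution (?\<rho> n)"
      unfolding real_distribution_def real_distribution_axioms_def using prob_space.prob_space_distr[OF Rp gm] by simp
    ultimately show ?thesis by (simp add: nonneg_law_def)
  qed
  have "laplace (?\<rho> n) s = avg n (\<lambda>x. exp (- s * (\<gamma> n * real (\<tau> n x))))" for n
  proof -
    have em: "(\<lambda>x. indicator (B n) x *\<^sub>R exp (- s * (\<gamma> n * real (\<tau> n x)))) \<in> borel_measurable M"
      using tm[of n] by (subst borel_measurable_restrict_space_iff[symmetric]) auto
    have "laplace (?\<rho> n) s = (\<integral>x. exp (- s * (\<gamma> n * real (\<tau> n x))) \<partial>?R n)"
      unfolding laplace_def by (rule integral_distr) measurable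
    also have "\<dots> = (\<integral>x. indicator (B n) x *\<^sub>R exp (- s * (\<gamma> n * real (\<tau> n x))) \<partial>uniform_measure M (B n))"
      using sets.sets_into_space[OF B_sets[of n]] by (intro integral_restrict_space) (simp add: Int_absorb2)
    also have "\<dots> = avg n (\<lambda>x. indicator (B n) x *\<^sub>R exp (- s * (\<gamma> n * real (\<tau> n x))))"
      by (rule avg_uniform[OF em])
    also have "\<dots> = avg n (\<lambda>x. exp (- s * (\<gamma> n * real (\<tau> n x))))"
      unfolding avg_def by (intro arg_cong2[where f="(/)"] Bochner_Integration.integral_cong) (auto simp: indicator_def)
    finally show ?thesis .
  qed
  then show ?thesis using weak_conv_laplace[OF nl \<nu> weak, of s] s by simp
qed

text \<open>With \<open>G\<close> the limit of \<open>A n s\<close>, the two relations read X = G (h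
  - q) and q = X times \<open>laplace \<nu> s\<close> in the limit. Hence X = G h / (1 + G
  \<open>laplace \<nu> s\<close>), and dividing by \<open>G\<close> gives
  \<open>\<Phi> s * h\<close>. The average for the shorter list \<open>ss\<close> enters as
  \<open>h\<close>, which drives the induction on the list.\<close>

lemma renewal_step:
  assumes s: "0 < s" and ss: "\<forall>t\<in>set ss. 0 \<le> t" and h: "(\<lambda>n. avg n (Q n ss)) \<longlonglongrightarrow> h"
  shows "(\<lambda>n. ref n (s # ss)) \<longlonglongrightarrow> \<Phi> s * h" and "(\<lambda>n. avg n (Q n (s # ss))) \<longlonglongrightarrow> \<Psi> s * h"
proof -
  define X where "X n = ref n (s # ss)" for n
  define q where "q n = avg n (Q n (s # ss))" for n
  define hn where "hn n = avg n (Q n ss)" for n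
  define e where "e n = avg n (\<lambda>x. exp (- s * (\<gamma> n * real (\<tau> n x))))" for n
  define G where "G = Gamma (1 + \<alpha>) / s powr \<alpha>"
  have G: "0 < G" unfolding G_def using s \<alpha> by (auto intro!: Gamma_real_pos)
  have \<Phi>: "\<Phi> s = G / (1 + G * laplace \<nu> s)" and \<Psi>: "\<Psi> s = laplace \<nu> s * \<Phi> s"
  proof -
    have "s powr \<alpha> / Gamma (1 + \<alpha>) = 1 / G" by (simp add: G_def)
    moreover have "laplace \<nu> s + 1 / G = (1 + G * laplace \<nu> s) / G" using G by (simp add: field_simps)
    ultimately show "\<Phi> s = G / (1 + G * laplace \<nu> s)" unfolding \<Phi>_def by simp
  qed (simp add: \<Phi>_def \<Psi>_def)
  have eL: "e \<longlonglongrightarrow> laplace \<nu> s" unfolding e_def by (rule cluster_laplace[OF s])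
  have AG: "(\<lambda>n. A n s) \<longlonglongrightarrow> G" unfolding G_def by (rule A_lim[OF s])
  have r1: "(\<lambda>n. X n - A n s * (hn n - q n)) \<longlonglongrightarrow> 0"
    unfolding X_def hn_def q_def by (rule renewal_relation[OF s ss])
  have r2: "(\<lambda>n. q n - e n * X n) \<longlonglongrightarrow> 0"
    unfolding X_def q_def e_def by (rule cluster_relation[OF s ss compact \<tau>_sets in_compact no_return])
  have hn: "hn \<longlonglongrightarrow> h" unfolding hn_def by (rule h)
  have den: "(\<lambda>n. 1 + A n s * e n) \<longlonglongrightarrow> 1 + G * laplace \<nu> s" by (intro tendsto_intros AG eL)
  have pos: "0 < 1 + G * laplace \<nu> s" using G laplace_nonneg[of \<nu> s] by (intro add_pos_nonneg) auto
  \<comment> \<open>Substituting the second relation into the first eliminates \<open>q\<close>: the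
    two errors and \<open>A n s * hn n\<close> combine to exactly
    \<open>X n * (1 + A n s * e n)\<close>.\<close>
  have "(\<lambda>n. ((X n - A n s * (hn n - q n)) - A n s * (q n - e n * X n) + A n s * hn n) / (1 + A n s * e n))
      \<longlonglongrightarrow> (0 - G * 0 + G * h) / (1 + G * laplace \<nu> s)"
    using pos by (intro tendsto_divide tendsto_add tendsto_diff tendsto_mult r1 r2 AG hn den) simp
  moreover have "\<forall>\<^sub>F n in sequentially. ((X n - A n s * (hn n - q n)) - A n s * (q n - e n * X n) + A n s * hn n) / (1 + A n s * e n) = X n"
    using order_tendstoD(1)[OF den pos]
  proof eventually_elim
    case (elim n)
    have "(X n - A n s * (hn n - q n)) - A n s * (q n - e n * X n) + A n s * hn n = X n * (1 + A n s * e n)"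
      by (simp add: algebra_simps)
    then show ?case using elim by simp
  qed
  ultimately have X: "X \<longlonglongrightarrow> \<Phi> s * h" unfolding \<Phi> by (auto dest: Lim_transform_eventually)
  then show "(\<lambda>n. ref n (s # ss)) \<longlonglongrightarrow> \<Phi> s * h" unfolding X_def .
  have "(\<lambda>n. (q n - e n * X n) + e n * X n) \<longlonglongrightarrow> 0 + laplace \<nu> s * (\<Phi> s * h)"
    by (intro tendsto_add tendsto_mult r2 eL X)
  then show "(\<lambda>n. avg n (Q n (s # ss))) \<longlonglongrightarrow> \<Psi> s * h" unfolding q_def \<Psi> by (simp add: mult.assoc)
qed

lemma avg_limit:
  assumes "\<forall>t\<in>set ss. 0 < t"
  shows "(\<lambda>n. avg n (Q n ss)) \<longlonglongrightarrow> prod_list (map \<Psi> ss)"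
  using assms
proof (induction ss)
  case Nil
  have "(\<lambda>n. avg n (Q n [])) = (\<lambda>_. 1)" using emeasure_B B_pos by (auto simp: avg_def less_le)
  then show ?case unfolding \<open>_ = (\<lambda>_. 1)\<close> by simp
next
  case (Cons s ss)
  then show ?case using renewal_step(2)[of s ss "prod_list (map \<Psi> ss)"] by (simp add: less_imp_le)
qed

text \<open>The density of \<open>P\<close> is exchanged for \<open>f / I\<close> by asymptotic
  invariance. Only the first factor feels the starting law; after the first visit the averages over
  \<open>B n\<close> take over, whence \<open>\<Phi>\<close> once and \<open>\<Psi>\<close> for the
  rest.\<close>

lemma ac_limit:
  assumes P: "prob_space P" and sP: "sets P = sets M" and ac: "absolutely_continuous M P"
    and ss: "\<forall>t\<in>set (s # ss). 0 < t"
  shows "(\<lambda>n. \<integral>x. Q n (s # ss) x \<partial>P) \<longlonglongrightarrow> \<Phi> s * prod_list (map \<Psi> ss)"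
proof -
  interpret P: prob_space P by fact
  have "emeasure P (space M) < \<infinity>" using P.emeasure_space_1 sets_eq_imp_space_eq[OF sP] by simp
  then obtain u where u: "integrable M u" "\<And>x. 0 \<le> u x" "density M (\<lambda>x. ennreal (u x)) = P"
    using Radon_Nikodym_integrable[OF ac sP] by blast
  have [measurable]: "u \<in> borel_measurable M" using u by auto
  have den: "(\<integral>x. h x \<partial>P) = (\<integral>x. u x * h x \<partial>M)" if [measurable]: "h \<in> borel_measurable M" for h :: "'a \<Rightarrow> real"
    unfolding u(3)[symmetric] by (subst integral_density) (auto simp: u(2))
  have u1: "(\<integral>x. u x \<partial>M) = 1" using den[of "\<lambda>_. 1"] P.prob_space by simp
  have 1: "(\<lambda>n. (\<integral>x. u x * Q n (s # ss) x \<partial>M) - (\<integral>x. u x \<partial>M) * ref n (s # ss)) \<longlonglongrightarrow> 0"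
    using ss by (intro asymptotically_constant u(1)) (auto intro: less_imp_le)
  have 2: "(\<lambda>n. ref n (s # ss)) \<longlonglongrightarrow> \<Phi> s * prod_list (map \<Psi> ss)"
    using ss by (intro renewal_step avg_limit) (auto intro: less_imp_le)
  from tendsto_add[OF 1 2] show ?thesis by (simp add: u1 den[OF Q_measurable])
qed

lemma AE_hits: "AE x in M. hit_time T (B n) 1 x \<noteq> \<infinity>"
proof -
  have "0 < emeasure M (B n)" using B_pos[of n] by (simp add: measure_def enn2real_positive_iff)
  from recurrence[OF B_sets this] show ?thesis
    unfolding hit_time_1_eq_infinity by eventually_elim blast
qed

lemma \<Phi>_0: "\<Phi> 0 = 1" and \<Psi>_0: "\<Psi> 0 = 1"
  using laplace_0[OF \<nu>] by (simp_all add: \<Phi>_def \<Psi>_def)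

lemma denominator_tendsto: "((\<lambda>s. laplace \<nu> s + s powr \<alpha> / Gamma (1 + \<alpha>)) \<longlongrightarrow> 1) (at_right 0)"
proof -
  have "((\<lambda>s::real. s powr \<alpha>) \<longlongrightarrow> 0) (at_right 0)"
    using \<alpha> by (intro tendsto_zero_powrI[OF tendsto_ident_at tendsto_const]) (auto simp: eventually_at_filter)
  from tendsto_add[OF laplace_tendsto_1[OF \<nu>] tendsto_divide[OF this tendsto_const[of "Gamma (1 + \<alpha>)"]]]
  show ?thesis using Gamma_real_pos[of "1 + \<alpha>"] \<alpha> by (simp add: less_imp_neq[symmetric])
qed

text \<open>\<open>\<Phi>\<close> is the limit of the Laplace transforms of the scaled first hitting
  times under the conditional measure on \<open>Y\<close>, and it tends to 1 at 0, so it is the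
  transform of a law.\<close>

lemma J_law_spec:
  "nonneg_law (J_law \<alpha> \<nu>)" "0 \<le> s \<Longrightarrow> laplace (J_law \<alpha> \<nu>) s = \<Phi> s"
proof -
  have posY: "0 < emeasure M Y"
    using B_pos[of 0] emeasure_mono[OF B_sub[of 0] Y_sets] by (auto simp: measure_def enn2real_positive_iff intro: less_le_trans)
  let ?P = "uniform_measure M Y"
  have P: "prob_space ?P" using posY Y_fin by (intro prob_space_uniform_measure) auto
  have ac: "absolutely_continuous M ?P" by (rule absolutely_continuous_uniform_measure[OF Y_sets])
  have hits: "AE x in ?P. hit_time T (B n) 1 x \<noteq> \<infinity>" for n
    by (rule absolutely_continuous_AE[OF _ ac AE_hits]) simp
  have ex: "\<exists>\<rho>. nonneg_law \<rho> \<and> (\<forall>s>0. laplace \<rho> s = \<Phi> s)"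
  proof (rule laplace_limit_exists)
    show "nonneg_law (distr ?P borel (\<lambda>x. \<gamma> n * real (the_enat (hit_time T (B n) 1 x))))" for n
      by (rule waiting_time_law[OF P _ B_sets \<gamma>_pos hits]) simp
    show "(\<lambda>n. laplace (distr ?P borel (\<lambda>x. \<gamma> n * real (the_enat (hit_time T (B n) 1 x)))) s) \<longlonglongrightarrow> \<Phi> s" if "0 < s" for s
      using ac_limit[OF P _ ac, of s "[]"] that by (simp add: waiting_time_law(2)[OF P _ B_sets \<gamma>_pos hits] del: One_nat_def)
    show "(\<Phi> \<longlongrightarrow> 1) (at_right 0)"
      unfolding \<Phi>_def[abs_def] using tendsto_divide[OF tendsto_const denominator_tendsto, of 1] by simp
  qed
  show "nonneg_law (J_law \<alpha> \<nu>)" "0 \<le> s \<Longrightarrow> laplace (J_law \<alpha> \<nu>) s = \<Phi> s"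
    unfolding J_law_def \<Phi>_def[abs_def, symmetric] by (rule law_of_laplace_spec[OF ex \<Phi>_0], assumption?)+
qed

text \<open>As for \<open>J_law\<close>, with return times under the conditional measures on
  \<open>B n\<close> as approximants.\<close>

lemma J_tilde_law_spec:
  "nonneg_law (J_tilde_law \<alpha> \<nu>)" "0 \<le> s \<Longrightarrow> laplace (J_tilde_law \<alpha> \<nu>) s = \<Psi> s"
proof -
  have hits: "AE x in uniform_measure M (B n). hit_time T (B n) 1 x \<noteq> \<infinity>" for n
    by (rule absolutely_continuous_AE[OF _ absolutely_continuous_uniform_measure[OF B_sets] AE_hits]) simp
  have ex: "\<exists>\<rho>. nonneg_law \<rho> \<and> (\<forall>s>0. laplace \<rho> s = \<Psi> s)"
  proof (rule laplace_limit_exists)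
    show "nonneg_law (distr (uniform_measure M (B n)) borel (\<lambda>x. \<gamma> n * real (the_enat (hit_time T (B n) 1 x))))" for n
      by (rule waiting_time_law[OF uniform_prob _ B_sets \<gamma>_pos hits]) simp
    show "(\<lambda>n. laplace (distr (uniform_measure M (B n)) borel (\<lambda>x. \<gamma> n * real (the_enat (hit_time T (B n) 1 x)))) s) \<longlonglongrightarrow> \<Psi> s"
      if "0 < s" for s
      using avg_limit[of "[s]"] that
      by (simp add: waiting_time_law(2)[OF uniform_prob _ B_sets \<gamma>_pos hits] avg_uniform[OF Q_measurable] del: One_nat_def)
    show "(\<Psi> \<longlongrightarrow> 1) (at_right 0)"
      unfolding \<Psi>_def[abs_def] using tendsto_divide[OF laplace_tendsto_1[OF \<nu>] denominator_tendsto] by simp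
  qed
  show "nonneg_law (J_tilde_law \<alpha> \<nu>)" "0 \<le> s \<Longrightarrow> laplace (J_tilde_law \<alpha> \<nu>) s = \<Psi> s"
    unfolding J_tilde_law_def \<Psi>_def[abs_def, symmetric] by (rule law_of_laplace_spec[OF ex \<Psi>_0], assumption?)+
qed

text \<open>Says that the limiting waiting time is not almost surely 0, so that the limiting renewal
  process has no accumulation of points.\<close>

lemma J_tilde_less_1: "laplace (J_tilde_law \<alpha> \<nu>) 1 < 1"
proof -
  have "0 < 1 / Gamma (1 + \<alpha>)" using \<alpha> by (auto intro!: Gamma_real_pos)
  moreover from this have "0 < laplace \<nu> 1 + 1 / Gamma (1 + \<alpha>)" by (intro add_nonneg_pos laplace_nonneg)
  ultimately show ?thesis by (simp add: J_tilde_law_spec(2) \<Psi>_def divide_less_eq)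
qed

text \<open>Common to both kinds of starting law, which differ only in the law
  \<open>\<sigma>\<close> of the first waiting time.\<close>

lemma hit_process_converge:
  assumes \<sigma>: "nonneg_law \<sigma>" and P: "\<And>n. prob_space (P n)" and sP: "\<And>n. sets (P n) = sets M"
    and lim: "\<And>s ss. \<forall>t\<in>set (s # ss). 0 < t \<Longrightarrow> (\<lambda>n. \<integral>x. Q n (s # ss) x \<partial>P n) \<longlonglongrightarrow> laplace \<sigma> s * prod_list (map \<Psi> ss)"
  shows "laws_converge vague_topology (\<lambda>n. distr (P n) vague_borel (hit_process M T a (B n))) (DRPP_law \<sigma> (J_tilde_law \<alpha> \<nu>))"
proof (rule laws_converge_DRPP[OF \<sigma> J_tilde_law_spec(1) J_tilde_less_1 P, where Z="\<lambda>n. hit_code T (B n) (\<gamma> n)"])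
  have zm: "(\<lambda>x. hit_code T (B n) (\<gamma> n) x k) \<in> borel_measurable (P n)" for n k
    using hit_code_measurable[OF B_sets] measurable_cong_sets[OF sP refl] by blast
  then show "(\<lambda>x. hit_code T (B n) (\<gamma> n) x k) \<in> borel_measurable (P n)" for n k .
  have eq: "hit_process M T a (B n) = (\<lambda>x. decode (hit_code T (B n) (\<gamma> n) x))" for n
    by (rule ext) (rule hit_process_eq_decode[OF \<gamma>_pos])
  show "hit_process M T a (B n) \<in> measurable (P n) vague_borel" for n
    unfolding eq by (rule decode_measurable[OF zm hit_code_decr_seqs[OF \<gamma>_pos]])
  show "AE x in P n. hit_code T (B n) (\<gamma> n) x \<in> decr_seqs \<and> hit_process M T a (B n) x = decode (hit_code T (B n) (\<gamma> n) x)" for n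
    unfolding eq by (simp add: hit_code_decr_seqs[OF \<gamma>_pos])
  fix e :: "nat \<Rightarrow> nat" and d assume e: "0 < e d"
  obtain s ss where s: "suffix_sums d e = s # ss" using suffix_sums_Cons by blast
  have pos: "\<forall>t\<in>set (s # ss). 0 < t" using suffix_sums_pos[of e d, OF e] unfolding s by blast
  have map_eq: "map (laplace (J_tilde_law \<alpha> \<nu>)) ss = map \<Psi> ss"
    using pos by (intro map_cong refl J_tilde_law_spec(2)) (auto intro: less_imp_le)
  show "(\<lambda>n. \<integral>x. monomial e (Suc d) (hit_code T (B n) (\<gamma> n) x) \<partial>P n)
      \<longlonglongrightarrow> laplace \<sigma> (hd (suffix_sums d e)) * prod_list (map (laplace (J_tilde_law \<alpha> \<nu>)) (tl (suffix_sums d e)))"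
    unfolding monomial_hit_code[of e d, OF e] s list.sel map_eq by (rule lim[OF pos])
qed

lemma converge_ac:
  assumes P: "prob_space P" and sP: "sets P = sets M" and ac: "absolutely_continuous M P"
  shows "laws_converge vague_topology (\<lambda>n. distr P vague_borel (hit_process M T a (B n))) (DRPP_law (J_law \<alpha> \<nu>) (J_tilde_law \<alpha> \<nu>))"
  using ac_limit[OF P sP ac]
  by (intro hit_process_converge J_law_spec P sP) (auto simp: J_law_spec(2) less_imp_le)

lemma converge_return:
  "laws_converge vague_topology (\<lambda>n. distr (uniform_measure M (B n)) vague_borel (hit_process M T a (B n))) (RPP_law (J_tilde_law \<alpha> \<nu>))"
  unfolding RPP_eq_DRPP[OF J_tilde_law_spec(1)]
proof (intro hit_process_converge J_tilde_law_spec uniform_prob sets_uniform_measure)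
  fix s :: real and ss assume "\<forall>t\<in>set (s # ss). 0 < t"
  then show "(\<lambda>n. \<integral>x. Q n (s # ss) x \<partial>uniform_measure M (B n)) \<longlonglongrightarrow> laplace (J_tilde_law \<alpha> \<nu>) s * prod_list (map \<Psi> ss)"
    using avg_limit[of "s # ss"] by (simp add: avg_uniform[OF Q_measurable] J_tilde_law_spec(2) less_imp_le)
qed

end

lemma weak_conv_m_offset:
  "weak_conv_m \<mu> \<mu>' \<Longrightarrow> weak_conv_m (\<lambda>n. \<mu> (n + k)) \<mu>'"
  unfolding weak_conv_m_def weak_conv_def by (auto intro: LIMSEQ_ignore_initial_segment)

lemma laws_converge_offset:
  "laws_converge X (\<lambda>n. \<Lambda> (n + n0)) \<Lambda>' \<Longrightarrow> laws_converge X \<Lambda> \<Lambda>'"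
  unfolding laws_converge_def by (blast intro: LIMSEQ_offset)

text \<open>Along the orbit of one generic point of \<open>Y\<close> the normalizing sequence may be replaced by a monotone one.\<close>

lemma (in cempt_system) uniform_normalization:
  assumes pde: "pointwise_dual_ergodic M T a" and \<alpha>: "0 < \<alpha>" "\<alpha> \<le> 1" and rv: "regularly_varying a \<alpha>"
    and Y: "uniform_set M T Y"
  shows "\<exists>c f I. uniform_system M T c \<alpha> Y f I \<and> (\<lambda>n. a n / c n) \<longlonglongrightarrow> 1"
proof -
  obtain f b where Ys [measurable]: "Y \<in> sets M" and Yp: "0 < emeasure M Y" and Yf: "emeasure M Y < \<infinity>"
    and f: "integrable M f" "AE x in M. 0 \<le> f x" "0 < (\<integral>x. f x \<partial>M)"
    and es: "(\<lambda>n. esssup (uniform_measure M Y)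
               (\<lambda>x. ereal \<bar>1 / b n * (\<Sum>k<n. (L ^^ k) f x) - (\<integral>y. f y \<partial>M)\<bar>)) \<longlonglongrightarrow> 0"
    using Y unfolding uniform_set_def by blast
  define I where "I = (\<integral>x. f x \<partial>M)"
  define S where "S n x = (\<Sum>k<n. (L ^^ k) f x)" for n x
  have I: "0 < I" using f by (simp add: I_def)
  have close: "\<exists>n0. \<forall>n\<ge>n0. AE x in M. x \<in> Y \<longrightarrow> \<bar>1 / b n * S n x - I\<bar> < \<epsilon>" if \<epsilon>: "0 < \<epsilon>" for \<epsilon>
  proof -
    have "\<forall>\<^sub>F n in sequentially. esssup (uniform_measure M Y) (\<lambda>x. ereal \<bar>1 / b n * S n x - I\<bar>) < ereal \<epsilon>"
      using es \<epsilon> unfolding S_def I_def by (intro order_tendstoD) auto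
    then have "\<forall>\<^sub>F n in sequentially. AE x in M. x \<in> Y \<longrightarrow> \<bar>1 / b n * S n x - I\<bar> < \<epsilon>"
    proof eventually_elim
      case (elim n)
      have "AE x in uniform_measure M Y. ereal \<bar>1 / b n * S n x - I\<bar> \<le> esssup (uniform_measure M Y) (\<lambda>x. ereal \<bar>1 / b n * S n x - I\<bar>)"
        by (rule esssup_AE)
      then have "AE x in uniform_measure M Y. \<bar>1 / b n * S n x - I\<bar> < \<epsilon>"
        by eventually_elim (use elim in \<open>auto dest: le_less_trans\<close>)
      then show ?case using Yp Yf by (subst (asm) AE_uniform_measure) auto
    qed
    then show ?thesis by (simp add: eventually_sequentially)
  qed
  \<comment> \<open>Only countably many tolerances and indices occur, so their exceptional sets have
    a null union and one point can be generic for all of them.\<close>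
  have "\<exists>n0. \<forall>m. \<forall>n\<ge>n0 m. AE x in M. x \<in> Y \<longrightarrow> \<bar>1 / b n * S n x - I\<bar> < 1 / real (Suc m)"
    by (rule choice) (use close in auto)
  then obtain n0 where n0: "\<And>m n. n \<ge> n0 m \<Longrightarrow> AE x in M. x \<in> Y \<longrightarrow> \<bar>1 / b n * S n x - I\<bar> < 1 / real (Suc m)" by blast
  have "AE x in M. \<forall>m n. n \<ge> n0 m \<longrightarrow> x \<in> Y \<longrightarrow> \<bar>1 / b n * S n x - I\<bar> < 1 / real (Suc m)"
    unfolding AE_all_countable using n0 by (auto intro: AE_impI)
  moreover have "AE x in M. (\<lambda>n. 1 / a n * S n x) \<longlonglongrightarrow> I"
    using pde f(1) unfolding pointwise_dual_ergodic_def S_def I_def by blast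
  moreover have "AE x in M. filterlim (\<lambda>n. S n x) at_top sequentially"
    using cempt f unfolding cempt_def S_def by blast
  moreover have "AE x in M. \<forall>k. 0 \<le> (L ^^ k) f x"
    unfolding AE_all_countable using Ln_nonneg[OF f(1,2)] by blast
  ultimately have ae: "AE x in M. (\<forall>m n. n \<ge> n0 m \<longrightarrow> x \<in> Y \<longrightarrow> \<bar>1 / b n * S n x - I\<bar> < 1 / real (Suc m)) \<and>
      (\<lambda>n. 1 / a n * S n x) \<longlonglongrightarrow> I \<and> filterlim (\<lambda>n. S n x) at_top sequentially \<and> (\<forall>k. 0 \<le> (L ^^ k) f x)"
    by eventually_elim blast
  \<comment> \<open>\<open>Y\<close> is not null, so it contains a point at which all the almost
    sure statements hold at once.\<close>
  have "\<exists>x\<in>Y. (\<forall>m n. n \<ge> n0 m \<longrightarrow> x \<in> Y \<longrightarrow> \<bar>1 / b n * S n x - I\<bar> < 1 / real (Suc m)) \<and>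
      (\<lambda>n. 1 / a n * S n x) \<longlonglongrightarrow> I \<and> filterlim (\<lambda>n. S n x) at_top sequentially \<and> (\<forall>k. 0 \<le> (L ^^ k) f x)"
  proof (rule ccontr)
    assume neg: "\<not> ?thesis"
    from ae have "AE x in M. x \<notin> Y" by eventually_elim (use neg in blast)
    then have "Y \<in> null_sets M" by (simp add: AE_iff_null_sets)
    then show False using Yp by auto
  qed
  then obtain x0 where x0: "x0 \<in> Y"
    and xb: "\<And>m n. n \<ge> n0 m \<Longrightarrow> \<bar>1 / b n * S n x0 - I\<bar> < 1 / real (Suc m)"
    and xa: "(\<lambda>n. 1 / a n * S n x0) \<longlonglongrightarrow> I" and xt: "filterlim (\<lambda>n. S n x0) at_top sequentially"
    and xp: "\<And>k. 0 \<le> (L ^^ k) f x0" by blast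
  define c where "c n = S n x0 / I" for n
  have cI: "S n x0 = I * c n" for n using I by (simp add: c_def)
  have c0: "0 \<le> c n" for n using xp I by (simp add: c_def S_def sum_nonneg)
  have cm: "mono c" unfolding c_def S_def using I xp by (intro monoI divide_right_mono sum_mono2) auto
  have ct: "filterlim c at_top sequentially"
    unfolding c_def using filterlim_tendsto_pos_mult_at_top[OF tendsto_const[of "1 / I"] _ xt] I by simp
  have "(\<lambda>n. inverse (1 / a n * S n x0 / I)) \<longlonglongrightarrow> inverse (I / I)"
    using I by (intro tendsto_inverse tendsto_divide xa) auto
  then have ac: "(\<lambda>n. a n / c n) \<longlonglongrightarrow> 1" using I by (simp add: c_def divide_simps mult_ac cong: if_cong)
  have "\<forall>\<^sub>F n in sequentially. 0 < c n" using ct by (simp add: filterlim_at_top_dense)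
  then have cn: "\<forall>\<^sub>F n in sequentially. c n \<noteq> 0" by eventually_elim simp
  have "uniform_system M T c \<alpha> Y f I"
  proof unfold_locales
    show "regularly_varying c \<alpha>" by (rule regularly_varying_equiv[OF ac rv cn])
    fix \<epsilon> :: real assume \<epsilon>: "0 < \<epsilon>"
    \<comment> \<open>The tolerance \<open>I / 2\<close> at \<open>x0\<close> forces
      \<open>0 < b N\<close> and \<open>b N \<le> 2 * c N\<close>. The tolerance
      \<open>\<epsilon> / 4\<close> at \<open>x\<close> and at \<open>x0\<close> gives a difference
      below \<open>\<epsilon> / 2 * b N\<close>, hence at most
      \<open>\<epsilon> * c N\<close>.\<close>
    obtain m where m: "1 / real (Suc m) < min (I / 2) (\<epsilon> / 4)"
      using reals_Archimedean[of "min (I / 2) (\<epsilon> / 4)"] I \<epsilon> by (auto simp: inverse_eq_divide)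
    show "\<exists>N0. \<forall>N\<ge>N0. AE x in M. x \<in> Y \<longrightarrow> \<bar>(\<Sum>k<N. (L ^^ k) f x) - I * c N\<bar> \<le> \<epsilon> * c N"
    proof (intro exI[of _ "n0 m"] allI impI)
      fix N assume N: "n0 m \<le> N"
      have x0N: "\<bar>1 / b N * S N x0 - I\<bar> < I / 2" "\<bar>1 / b N * S N x0 - I\<bar> < \<epsilon> / 4" using xb[OF N] m by auto
      have S0: "0 \<le> S N x0" using cI c0 I by simp
      have half: "I / 2 < 1 / b N * S N x0" using x0N(1) unfolding abs_less_iff by linarith
      have bN: "0 < b N"
      proof (rule ccontr)
        assume "\<not> 0 < b N"
        then have "1 / b N * S N x0 \<le> 0" using S0 by (intro mult_nonpos_nonneg) auto
        then show False using half I by linarith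
      qed
      have b2: "b N \<le> 2 * c N" using half bN I by (simp add: cI field_simps)
      show "AE x in M. x \<in> Y \<longrightarrow> \<bar>(\<Sum>k<N. (L ^^ k) f x) - I * c N\<bar> \<le> \<epsilon> * c N"
        using n0[OF N]
      proof eventually_elim
        case (elim x)
        show ?case
        proof
          assume "x \<in> Y"
          then have "\<bar>1 / b N * S N x - I\<bar> < \<epsilon> / 4" using elim m by auto
          then have "\<bar>1 / b N * S N x - 1 / b N * S N x0\<bar> < \<epsilon> / 2" using x0N(2) unfolding abs_less_iff by linarith
          moreover have "1 / b N * S N x - 1 / b N * S N x0 = (S N x - S N x0) / b N" by (simp add: diff_divide_distrib)
          ultimately have "\<bar>S N x - S N x0\<bar> < \<epsilon> / 2 * b N" using bN by (simp add: abs_divide divide_less_eq)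
          also have "\<dots> \<le> \<epsilon> / 2 * (2 * c N)" using \<epsilon> b2 by (intro mult_left_mono) auto
          finally show "\<bar>(\<Sum>k<N. (L ^^ k) f x) - I * c N\<bar> \<le> \<epsilon> * c N" by (simp add: S_def[symmetric] cI[symmetric])
        qed
      qed
    qed
  qed (use f I Yf cm c0 ct \<alpha> in \<open>auto simp: I_def\<close>)
  then show ?thesis using ac by blast
qed

theorem theorem4p4:
  fixes M :: "'a measure" and T :: "'a \<Rightarrow> 'a" and a :: "nat \<Rightarrow> real" and \<alpha> :: real
    and Y :: "'a set" and B :: "nat \<Rightarrow> 'a set" and \<tau> :: "nat \<Rightarrow> 'a \<Rightarrow> nat"
    and \<nu> :: "real measure" and \<U> :: "('a \<Rightarrow> real) set set"
  assumes "sigma_finite_measure M"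
    and "cempt M T"
    and "pointwise_dual_ergodic M T a"
    and "0 < \<alpha>" and "\<alpha> \<le> 1" and "regularly_varying a \<alpha>"
    and "uniform_set M T Y" and "emeasure M Y < \<infinity>"
    and "asymptotically_rare M B" and "\<And>n. B n \<subseteq> Y"
    and "nonneg_law \<nu>"
    and "\<And>n. \<tau> n \<in> measurable (restrict_space M (B n)) (count_space UNIV)"
    and "compact_in_L1 M \<U>"
    and "\<And>n k. 0 < measure M {x \<in> B n. \<tau> n x = k} \<Longrightarrow>
           L1_class M ((transfer_op M T ^^ k)
             (\<lambda>x. indicator {x \<in> B n. \<tau> n x = k} x / measure M {x \<in> B n. \<tau> n x = k})) \<in> \<U>"
    and "weak_conv_m
           (\<lambda>n. distr (restrict_space (uniform_measure M (B n)) (B n)) borel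
                  (\<lambda>x. scaling a (measure M (B n)) * real (\<tau> n x))) \<nu>"
    and "(\<lambda>n. measure (uniform_measure M (B n))
                {x \<in> B n. hit_time T (B n) 1 x \<le> enat (\<tau> n x)}) \<longlonglongrightarrow> 0"
  shows "(\<forall>P. prob_space P \<and> sets P = sets M \<and> absolutely_continuous M P \<longrightarrow>
            laws_converge vague_topology
              (\<lambda>n. distr P vague_borel (hit_process M T a (B n)))
              (DRPP_law (J_law \<alpha> \<nu>) (J_tilde_law \<alpha> \<nu>))) \<and>
         laws_converge vague_topology
           (\<lambda>n. distr (uniform_measure M (B n)) vague_borel (hit_process M T a (B n)))
           (RPP_law (J_tilde_law \<alpha> \<nu>))"
proof -
  interpret cempt_system M T
    using assms(1,2) by (simp add: cempt_system_def cempt_system_axioms_def)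
  obtain c f I where us: "uniform_system M T c \<alpha> Y f I" and ac: "(\<lambda>n. a n / c n) \<longlonglongrightarrow> 1"
    using uniform_normalization[OF assms(3-7)] by blast
  interpret us: uniform_system M T c \<alpha> Y f I by (rule us)
  have Bs: "B n \<in> sets M" and Bp: "0 < emeasure M (B n)" and B0: "(\<lambda>n. emeasure M (B n)) \<longlonglongrightarrow> 0" for n
    using assms(9) by (auto simp: asymptotically_rare_def)
  have fin: "emeasure M (B n) < \<infinity>" for n by (rule us.finite_subset_Y[OF Bs assms(10)])
  have mp: "0 < measure M (B n)" for n using Bp[of n] fin[of n] by (simp add: measure_def enn2real_positive_iff)
  have m0: "(\<lambda>n. measure M (B n)) \<longlonglongrightarrow> 0"
    unfolding measure_def by (rule tendsto_enn2real) (use B0 in auto)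
  \<comment> \<open>Drops the small indices, where the scaling may fail to be positive;
    \<open>laws_converge_offset\<close> brings the full sequence back.\<close>
  obtain n0 where n0: "\<And>n. n \<ge> n0 \<Longrightarrow> 0 < scaling a (measure M (B n))"
    using us.laplace_scaling(1)[OF ac mp m0 zero_less_one] by (auto simp: eventually_sequentially)
  interpret cr: clustered_rare_events M T c \<alpha> Y f I a "\<lambda>n. B (n + n0)" "\<lambda>n. \<tau> (n + n0)" \<nu> \<U>
  proof unfold_locales
    show "(\<lambda>n. measure M (B (n + n0))) \<longlonglongrightarrow> 0" by (rule LIMSEQ_ignore_initial_segment[OF m0])
    show "weak_conv_m
       (\<lambda>n. distr (restrict_space (uniform_measure M (B (n + n0))) (B (n + n0))) borel
              (\<lambda>x. scaling a (measure M (B (n + n0))) * real (\<tau> (n + n0) x))) \<nu>"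
      by (rule weak_conv_m_offset[OF assms(15)])
    show "(\<lambda>n. measure (uniform_measure M (B (n + n0)))
                {x \<in> B (n + n0). hit_time T (B (n + n0)) 1 x \<le> enat (\<tau> (n + n0) x)}) \<longlonglongrightarrow> 0"
      by (rule LIMSEQ_ignore_initial_segment[OF assms(16)])
  qed (use ac Bs assms(10) mp n0 assms(11-14) in \<open>simp_all only: le_add2\<close>)
  show ?thesis
  proof (rule conjI, intro allI impI)
    fix P :: "'a measure" assume "prob_space P \<and> sets P = sets M \<and> absolutely_continuous M P"
    then show "laws_converge vague_topology (\<lambda>n. distr P vague_borel (hit_process M T a (B n)))
        (DRPP_law (J_law \<alpha> \<nu>) (J_tilde_law \<alpha> \<nu>))"
      by (elim conjE) (rule laws_converge_offset[OF cr.converge_ac])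
  next
    show "laws_converge vague_topology
        (\<lambda>n. distr (uniform_measure M (B n)) vague_borel (hit_process M T a (B n))) (RPP_law (J_tilde_law \<alpha> \<nu>))"
      by (rule laws_converge_offset[OF cr.converge_return])
  qed
qed

end
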